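(* Let $f(u,v)$ be an isothermic cylinder with one generic family ($u$-curves) of closed planar curvature lines, and with periodic reparametrization function $w(v+\mathcal{V})=w(v)$ that yields a fundamental piece with axis $\mathrm{A}$ and generating rotation angle $\theta\in[0,\pi]$. Denote its Gauss map by $n$ and its metric by $e^{2h}$. Then the resulting Bonnet pair cylinders $f^{\pm}$ are tori if and only if 1. (Rationality condition) $k\theta\in2\pi\mathbb{N}$ for some $k\in\mathbb{N}$; and 2. (Vanishing axial part) $$\Big\langle \mathrm{A},\int_0^{\mathcal{V}}e^{-h(\omega,w(v))}\,n(\omega,v)\,dv\Big\rangle_{\mathbb{R}^3}=0.$$
   Context: $\mathbb{N}=\{1,2,\dots\}$. Identify $\mathbb{R}^3$ with $\mathrm{Im}\,\mathbb{H}$ (units $\mathbf{i},\mathbf{j},\mathbf{k}$) and $\mathbb{C}$ with $\mathrm{span}\{1,\mathbf{i}\}$, the complex unit $i$ being $\mathbf{i}$. Jacobi theta functions $\vartheta_i(z|\tau)$ follow Whittaker–Watson (lattice $\pi,\pi\tau$, nome $e^{i\pi\tau}$). Let $\tau\in\frac12+i\mathbb{R}$ with $0<\mathrm{Im}\,\tau<\mathrm{Im}\,\tau_0\approx0.3547$, where $\tau_0\in\frac12+i\mathbb{R}$ is defined by $\vartheta_2''(0|\tau_0)=0$; let $\omega\in(0,\pi/4)$ be the unique number with $\vartheta_2'(\omega|\tau)=0$. A $\tau$-admissible reparametrization function is a real analytic $w:\mathbb{R}\to(0,2\pi\,\mathrm{Im}\,\tau)$ for which $\sqrt{1-w'^2}:\mathbb{R}\to\mathbb{R}$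 (a root that may change sign) is also real analytic. An isothermic cylinder with one generic family ($u$-curves) of closed planar curvature lines is $$f(u,v)=\Phi(v)^{-1}\gamma(u,w(v))\,\mathbf{j}\,\Phi(v),\qquad \gamma(u,w)=-i\,\frac{2\vartheta_2(\omega)^2}{\vartheta_1'(0)\vartheta_1(2\omega)}\,\frac{\vartheta_1(\frac12(u+iw-3\omega))}{\vartheta_1(\frac12(u+iw+\omega))},$$ with $w$ $\tau$-admissible and $\Phi:\mathbb{R}\to\mathbb{H}_1$ (unit quaternions) solving $\Phi'\Phi^{-1}=\sqrt{1-w'(v)^2}\,W_1(w(v))\,\mathbf{k}$, $W_1(w)=i\frac{\vartheta_1'(0)}{2\vartheta_2(\omega)}\frac{\vartheta_2(\omega-iw)}{\vartheta_1(iw)}$. It is conformally parametrized by curvature lines and $2\pi$-periodic in $u$; its metric is $e^{2h(u,w(v))}(du^2+dv^2)$ with $e^{h(u,w)}=|\gamma_u(u,w)|$, its Gauss map is $n=e^{-2h}f_u\times f_v$, and its Christoffel dual $f^*$ is given by $df^*=e^{-2h}(f_u\,du-f_v\,dv)$. It yields a fundamental piece (is an isothermic cylinder from a fundamental piece) if $w$ has period $\mathcal{V}$ but $f$ is not closed after only one period, i.e. $w(v+\mathcal{V})=w(v)$ and $f(u,v+\mathcal{V})\neq f(u,v)$; the fundamental piece is $\{f(u,v): u\in[0,2\pi],\,v\in[0,\mathcal{V}]\}$. The axis $\mathrm{A}$ (a unit imaginary quaternion) and the generating rotation angle $\theta\in[0,\pi]$ are defined by the monodromy $\Phi(0)^{-1}\Phi(\mathcal{V})=\cos(\theta/2)+\sin(\theta/2)\,\mathrm{A}$.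 A Bonnet pair is two non-congruent isometric surfaces with the same mean curvature at corresponding points. The Bonnet pair cylinders $f^\pm$ resulting from $f$ are given, with a parameter $\epsilon\in\mathbb{R}$, by $df^{\pm}=(\pm\epsilon-f)\,df^*\,(\pm\epsilon+f)$; they are $2\pi$-periodic in $u$, and they are tori if they are also periodic in $v$.
   Formalization: The period V is required of the chosen root √(1−w'²) as well as of w (otherwise f(u,v+V) is no rotated copy of f and there is no monodromy); ε≠0 is assumed (for ε=0, f⁺ and f⁻ coincide up to translation); the monodromy is taken up to sign. *)

theory Defs
  imports "HOL-Analysis.Analysis"
begin

section \<open>Quaternions\<close>

text \<open>
  A quaternion \<open>a + b j\<close> with \<open>a, b \<in> span {1, i} = \<complex>\<close> is the pair \<open>(a, b)\<close>; addition, scalar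
  multiplication, norm and topology are those of the product type. Since \<open>j a = cnj a j\<close>,
  multiplication is as below. In coordinates, \<open>x\<^sub>0 + x\<^sub>1 i + x\<^sub>2 j + x\<^sub>3 k\<close> is
  \<open>(Complex x\<^sub>0 x\<^sub>1, Complex x\<^sub>2 x\<^sub>3)\<close>.
\<close>

type_synonym quat = "complex \<times> complex"

definition qmult :: "quat \<Rightarrow> quat \<Rightarrow> quat"  (infixl \<open>\<odot>\<close> 70) where
  "p \<odot> q = (fst p * fst q - snd p * cnj (snd q), fst p * snd q + snd p * cnj (fst q))"

definition qconj :: "quat \<Rightarrow> quat" where
  "qconj q = (cnj (fst q), - snd q)"

definition qinv :: "quat \<Rightarrow> quat" where
  "qinv q = inverse ((norm q)\<^sup>2) *\<^sub>R qconj q"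

definition qcomplex :: "complex \<Rightarrow> quat" where "qcomplex z = (z, 0)"
definition qreal :: "real \<Rightarrow> quat" where "qreal r = qcomplex (complex_of_real r)"
definition qi :: quat where "qi = qcomplex \<i>"
definition qj :: quat where "qj = (0, 1)"
definition qk :: quat where "qk = (0, \<i>)"

definition imH :: "real^3 \<Rightarrow> quat" where
  "imH x = (Complex 0 (x $ 1), Complex (x $ 2) (x $ 3))"

definition vecH :: "quat \<Rightarrow> real^3" where
  "vecH q = vector [Im (fst q), Re (snd q), Im (snd q)]"

lemma quaternion_units:
  "qi \<odot> qi = qreal (- 1)" "qj \<odot> qj = qreal (- 1)" "qk \<odot> qk = qreal (- 1)"
  "qi \<odot> qj = qk" "qj \<odot> qk = qi" "qk \<odot> qi = qj"
  "qj \<odot> qi = - qk" "qk \<odot> qj = - qi" "qi \<odot> qk = - qj"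
  by (simp_all add: qmult_def qi_def qj_def qk_def qreal_def qcomplex_def)

lemma qmult_assoc: "(p \<odot> q) \<odot> r = p \<odot> (q \<odot> r)"
  by (simp add: qmult_def algebra_simps)

lemma qinv_left: "q \<noteq> 0 \<Longrightarrow> qinv q \<odot> q = qreal 1"
proof -
  assume q: "q \<noteq> 0"
  have n: "(norm q)\<^sup>2 = (cmod (fst q))\<^sup>2 + (cmod (snd q))\<^sup>2"
    by (simp add: norm_prod_def)
  have "qconj q \<odot> q = qreal ((norm q)\<^sup>2)"
    unfolding n cmod_power2
    by (simp add: qconj_def qmult_def qreal_def qcomplex_def complex_eq_iff
        power2_eq_square algebra_simps)
  moreover have "qinv q \<odot> q = inverse ((norm q)\<^sup>2) *\<^sub>R (qconj q \<odot> q)"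
    by (simp add: qinv_def qmult_def scaleR_prod_def algebra_simps)
  moreover have "inverse ((norm q)\<^sup>2) *\<^sub>R qreal ((norm q)\<^sup>2) = qreal 1"
    using q by (simp add: qreal_def qcomplex_def scaleR_conv_of_real flip: of_real_mult of_real_power)
  ultimately show ?thesis by simp
qed

lemma vecH_imH: "vecH (imH x) = x"
  by (simp add: vecH_def imH_def vec_eq_iff forall_3)

lemma imH_vecH: "Re (fst q) = 0 \<Longrightarrow> imH (vecH q) = q"
  by (cases q) (simp add: vecH_def imH_def complex_eq_iff)

section \<open>Theta functions\<close>

text \<open>
  The nome is \<open>q = exp (\<i> \<pi> \<tau>)\<close>, and the fractional power \<open>q powr ((n + 1/2)\<^sup>2)\<close> of the
  Whittaker--Watson series means \<open>exp (\<i> \<pi> \<tau> (n + 1/2)\<^sup>2)\<close>.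
\<close>

definition theta1 :: "complex \<Rightarrow> complex \<Rightarrow> complex" where
  "theta1 \<tau> z = 2 * (\<Sum>n. (- 1) ^ n * exp (\<i> * of_real pi * \<tau> * (of_nat n + 1 / 2)\<^sup>2)
                        * sin (of_nat (2 * n + 1) * z))"

definition theta2 :: "complex \<Rightarrow> complex \<Rightarrow> complex" where
  "theta2 \<tau> z = 2 * (\<Sum>n. exp (\<i> * of_real pi * \<tau> * (of_nat n + 1 / 2)\<^sup>2)
                        * cos (of_nat (2 * n + 1) * z))"

section \<open>Isothermic cylinders with one family of closed planar curvature lines\<close>

definition real_analytic :: "(real \<Rightarrow> real) \<Rightarrow> bool" where
  "real_analytic g \<longleftrightarrow>
     (\<forall>x. \<exists>r>0. \<exists>a. \<forall>y. \<bar>y - x\<bar> < r \<longrightarrow> (\<lambda>n. a n * (y - x) ^ n) sums g y)"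

text \<open>
  The square root of \<open>1 - w'\<^sup>2\<close> may change sign, so it is not a function of \<open>w\<close> alone; the chosen
  analytic root \<open>s\<close> is carried along.
\<close>

definition admissible :: "complex \<Rightarrow> (real \<Rightarrow> real) \<Rightarrow> (real \<Rightarrow> real) \<Rightarrow> bool" where
  "admissible \<tau> w s \<longleftrightarrow>
     real_analytic w \<and> (\<forall>v. 0 < w v \<and> w v < 2 * pi * Im \<tau>) \<and>
     real_analytic s \<and> (\<forall>v. (s v)\<^sup>2 = 1 - (deriv w v)\<^sup>2)"

definition planar_gamma :: "complex \<Rightarrow> real \<Rightarrow> real \<Rightarrow> real \<Rightarrow> complex" where
  "planar_gamma \<tau> \<omega> u w =
     - \<i> * (2 * (theta2 \<tau> (of_real \<omega>))\<^sup>2 / (deriv (theta1 \<tau>) 0 * theta1 \<tau> (2 * of_real \<omega>)))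
     * (theta1 \<tau> ((of_real u + \<i> * of_real w - 3 * of_real \<omega>) / 2)
        / theta1 \<tau> ((of_real u + \<i> * of_real w + of_real \<omega>) / 2))"

definition frame_W1 :: "complex \<Rightarrow> real \<Rightarrow> real \<Rightarrow> complex" where
  "frame_W1 \<tau> \<omega> w =
     \<i> * (deriv (theta1 \<tau>) 0 / (2 * theta2 \<tau> (of_real \<omega>)))
     * (theta2 \<tau> (of_real \<omega> - \<i> * of_real w) / theta1 \<tau> (\<i> * of_real w))"

definition rotation_frame ::
  "complex \<Rightarrow> real \<Rightarrow> (real \<Rightarrow> real) \<Rightarrow> (real \<Rightarrow> real) \<Rightarrow> (real \<Rightarrow> quat) \<Rightarrow> bool" where
  "rotation_frame \<tau> \<omega> w s \<Phi> \<longleftrightarrow>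
     (\<forall>v. norm (\<Phi> v) = 1 \<and> \<Phi> differentiable (at v) \<and>
          vector_derivative \<Phi> (at v) \<odot> qinv (\<Phi> v)
            = s v *\<^sub>R (qcomplex (frame_W1 \<tau> \<omega> (w v)) \<odot> qk))"

definition isothermic_cylinder ::
  "complex \<Rightarrow> real \<Rightarrow> (real \<Rightarrow> real) \<Rightarrow> (real \<Rightarrow> quat) \<Rightarrow> real \<times> real \<Rightarrow> real^3" where
  "isothermic_cylinder \<tau> \<omega> w \<Phi> =
     (\<lambda>(u, v). vecH (qinv (\<Phi> v) \<odot> qcomplex (planar_gamma \<tau> \<omega> u (w v)) \<odot> qj \<odot> \<Phi> v))"

lemma imH_isothermic_cylinder:
  "imH (isothermic_cylinder \<tau> \<omega> w \<Phi> (u, v))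
     = qinv (\<Phi> v) \<odot> qcomplex (planar_gamma \<tau> \<omega> u (w v)) \<odot> qj \<odot> \<Phi> v"
  unfolding isothermic_cylinder_def prod.case
  by (rule imH_vecH) (simp add: qmult_def qinv_def qconj_def qcomplex_def qj_def algebra_simps)

definition metric_h :: "complex \<Rightarrow> real \<Rightarrow> real \<Rightarrow> real \<Rightarrow> real" where
  "metric_h \<tau> \<omega> u w = ln (cmod (vector_derivative (\<lambda>u'. planar_gamma \<tau> \<omega> u' w) (at u)))"

definition partial_u :: "(real \<times> real \<Rightarrow> real^3) \<Rightarrow> real \<times> real \<Rightarrow> real^3" where
  "partial_u f = (\<lambda>(u, v). vector_derivative (\<lambda>t. f (t, v)) (at u))"

definition partial_v :: "(real \<times> real \<Rightarrow> real^3) \<Rightarrow> real \<times> real \<Rightarrow> real^3" where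
  "partial_v f = (\<lambda>(u, v). vector_derivative (\<lambda>t. f (u, t)) (at v))"

definition gauss_map ::
  "(real \<Rightarrow> real \<Rightarrow> real) \<Rightarrow> (real \<times> real \<Rightarrow> real^3) \<Rightarrow> real \<times> real \<Rightarrow> real^3" where
  "gauss_map h f = (\<lambda>(u, v). exp (- 2 * h u v) *\<^sub>R cross3 (partial_u f (u, v)) (partial_v f (u, v)))"

definition christoffel_dual ::
  "(real \<Rightarrow> real \<Rightarrow> real) \<Rightarrow> (real \<times> real \<Rightarrow> real^3) \<Rightarrow> (real \<times> real \<Rightarrow> real^3) \<Rightarrow> bool" where
  "christoffel_dual h f f' \<longleftrightarrow>
     (\<forall>u v. (f' has_derivative
        (\<lambda>(du, dv). exp (- 2 * h u v) *\<^sub>R (du *\<^sub>R partial_u f (u, v) - dv *\<^sub>R partial_v f (u, v))))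
        (at (u, v)))"

text \<open>\<open>dg = (c - f) df' (c + f)\<close>; the two surfaces of a Bonnet pair have \<open>c = \<epsilon>\<close> and \<open>c = - \<epsilon>\<close>.\<close>

definition bonnet_cylinder ::
  "(real \<times> real \<Rightarrow> real^3) \<Rightarrow> (real \<times> real \<Rightarrow> real^3) \<Rightarrow> real \<Rightarrow> (real \<times> real \<Rightarrow> real^3) \<Rightarrow> bool" where
  "bonnet_cylinder f f' c g \<longleftrightarrow>
     (\<forall>p. \<exists>D. (g has_derivative D) (at p) \<and>
        (\<forall>x. imH (D x) = (qreal c - imH (f p)) \<odot> imH (frechet_derivative f' (at p) x)
                          \<odot> (qreal c + imH (f p))))"

definition is_torus :: "(real \<times> real \<Rightarrow> real^3) \<Rightarrow> bool" where
  "is_torus g \<longleftrightarrow> (\<forall>u v. g (u + 2 * pi, v) = g (u, v)) \<and> (\<exists>T>0. \<forall>u v. g (u, v + T) = g (u, v))"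

section \<open>Fundamental pieces\<close>

text \<open>
  The period \<open>V\<close> is required of the root \<open>s\<close> as well as of \<open>w\<close>: the square of \<open>s\<close> is then
  automatically \<open>V\<close>-periodic, but \<open>s (v + V) = - s v\<close> would be possible, and then the equation for
  \<open>\<Phi>\<close> is only \<open>2 V\<close>-periodic and has no monodromy over \<open>[0, V]\<close>.
\<close>

definition yields_fundamental_piece ::
  "(real \<Rightarrow> real) \<Rightarrow> (real \<Rightarrow> real) \<Rightarrow> (real \<times> real \<Rightarrow> real^3) \<Rightarrow> real \<Rightarrow> bool" where
  "yields_fundamental_piece w s f V \<longleftrightarrow>
     V > 0 \<and> (\<forall>v. w (v + V) = w v \<and> s (v + V) = s v) \<and> \<not> (\<forall>u v. f (u, v + V) = f (u, v))"

text \<open>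
  Unit quaternions \<open>M\<close> and \<open>- M\<close> induce the same rotation; a rotation angle in \<open>[0, \<pi>]\<close> requires
  choosing the one of the two with nonnegative real part.
\<close>

definition monodromy_axis_angle :: "(real \<Rightarrow> quat) \<Rightarrow> real \<Rightarrow> real^3 \<Rightarrow> real \<Rightarrow> bool" where
  "monodromy_axis_angle \<Phi> V A \<theta> \<longleftrightarrow>
     norm A = 1 \<and> 0 \<le> \<theta> \<and> \<theta> \<le> pi \<and>
     (qinv (\<Phi> 0) \<odot> \<Phi> V = qreal (cos (\<theta> / 2)) + sin (\<theta> / 2) *\<^sub>R imH A \<or>
      - (qinv (\<Phi> 0) \<odot> \<Phi> V) = qreal (cos (\<theta> / 2)) + sin (\<theta> / 2) *\<^sub>R imH A)"

end

theory Submission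
  imports Defs "HOL-Complex_Analysis.Complex_Analysis"
begin

text \<open>
  The frame \<open>\<Phi>\<close> solves a linear equation with \<open>V\<close>-periodic coefficients. Hence \<open>\<Phi> (v + V) = \<Phi> v \<odot> M\<close> with
  the monodromy \<open>M\<close>, and whatever is built from the frame and periodic data is turned by the rotation
  about \<open>A\<close> through \<open>\<theta>\<close> when \<open>v\<close> advances by \<open>V\<close>. The differential \<open>(c - f) df\<^sup>* (c + f)\<close> of a Bonnet
  cylinder \<open>g\<close>, with \<open>c = \<plusminus>\<epsilon>\<close>, is of this kind, so \<open>g (u, v + V)\<close> arises from \<open>g (u, v)\<close> by that rotation and
  a constant translation \<open>t\<close> (\<open>bonnet_shift\<close>).

  If \<open>k \<theta>\<close> is a multiple of \<open>2 \<pi>\<close>, then \<open>k\<close> pieces change \<open>g\<close> by a translation that is parallel to the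
  axis, and its axial part is \<open>k \<langle>A, t\<rangle>\<close>. So \<open>g\<close> closes when \<open>\<langle>A, t\<rangle> = 0\<close>
  (\<open>rational_and_axial_zero_imp_periodic\<close>). In the u-direction it always closes, because its
  u-derivative has an explicit \<open>2 \<pi>\<close>-periodic primitive (\<open>bonnet_u_periodic\<close>).

  Conversely, a periodic \<open>g\<close> is bounded, which forces \<open>\<langle>A, t\<rangle> = 0\<close>. If its period \<open>P\<close> is commensurable with
  \<open>V\<close>, then a power of \<open>M\<close> fixes the tangent vectors of \<open>g\<close>, hence it is \<open>\<plusminus>1\<close> and \<open>\<theta>\<close> is a rational multiple
  of \<open>\<pi>\<close>. If not, the metric of \<open>g\<close> has the incommensurable periods \<open>P\<close> and \<open>V\<close> and does not depend
  on \<open>v\<close>, which is impossible for non-constant \<open>w\<close> (\<open>metric_period_commensurable\<close>). For constant \<open>w\<close> the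
  cylinder is a surface of revolution, and there \<open>\<langle>A, t\<rangle> \<noteq> 0\<close> (\<open>constant_w_imp_axial_nonzero\<close>).

  The axial part of \<open>t\<close> is computed along \<open>u = \<omega>\<close>. There \<open>f\<close> has a constant length \<open>\<bar>\<rho>\<bar>\<close> and is parallel to
  \<open>f_u\<close>, so \<open>g_v = (c\<^sup>2 - \<rho>\<^sup>2) f\<^sup>*_v + 2 c \<rho> e\<^sup>-\<^sup>h n\<close> (\<open>bonnet_v_at_omega\<close>). Along v-curves the dual is
  \<open>- f (\<pi> - u, v)\<close> up to a translation (\<open>dual_is_reflection\<close>) and has no axial displacement. Hence
  \<open>\<langle>A, t\<rangle>\<close> is \<open>2 c \<rho>\<close> times the axial part of the integral of \<open>e\<^sup>-\<^sup>h n\<close> (\<open>axial_displacement\<close>).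

  The properties of the planar curves \<open>\<gamma>\<close> behind these arguments are identities for a multiple \<open>T\<close> of \<open>\<theta>\<^sub>1\<close>
  that is real on the real axis. They all follow from the addition formula \<open>T_addition\<close>, which
  is proved with Liouville's theorem. This needs the zeros of \<open>T\<close>; they are found by comparing \<open>T\<close> with a
  product whose zeros are visible (\<open>T_eq_0_iff\<close>).
\<close>

section \<open>Quasi-periodic entire functions\<close>

definition theta_lattice :: "complex \<Rightarrow> complex set" where
  "theta_lattice \<tau> = {of_int m * of_real pi + of_int n * (of_real pi * \<tau>) | m n. True}"

lemma period_of_int_multiple:
  fixes h :: "'a::ring_1 \<Rightarrow> 'b"
  assumes "\<And>x. h (x + a) = h x"
  shows "h (x + of_int m * a) = h x"
proof (induction m rule: int_induct[where k = 0])
  case (step1 i)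
  have "h (x + of_int (i + 1) * a) = h ((x + of_int i * a) + a)"
    by (simp add: algebra_simps)
  then show ?case using assms step1 by simp
next
  case (step2 i)
  have "h (x + of_int i * a) = h ((x + of_int (i - 1) * a) + a)"
    by (simp add: algebra_simps)
  then show ?case using assms step2 by simp
qed simp

lemma half_tau_notin_theta_lattice:
  assumes "Im \<tau> > 0"
  shows "of_real pi * \<tau> / 2 \<notin> theta_lattice \<tau>"
proof
  assume "of_real pi * \<tau> / 2 \<in> theta_lattice \<tau>"
  then obtain m n :: int where
    "of_real pi * \<tau> / 2 = of_int m * of_real pi + of_int n * (of_real pi * \<tau>)"
    by (auto simp: theta_lattice_def)
  then have "Im (of_real pi * \<tau> / 2) = Im (of_int m * of_real pi + of_int n * (of_real pi * \<tau>))"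
    by metis
  then have "(pi * Im \<tau>) * (1/2 - of_int n) = 0"
    by (simp add: algebra_simps)
  then have "(1/2::real) = of_int n" using assms by simp
  then have "(1::real) = of_int (2 * n)" by simp
  then have "1 = 2 * n" by linarith
  then show False by presburger
qed

lemma translate_into_cell:
  assumes "Im \<tau> > 0"
  obtains a b :: real and m n :: int where "0 \<le> a" "a \<le> 1" "0 \<le> b" "b \<le> 1"
    "x = (of_real a * of_real pi + of_real b * (of_real pi * \<tau>))
         + of_int m * of_real pi + of_int n * (of_real pi * \<tau>)"
proof -
  define b where "b = Im x / (pi * Im \<tau>)"
  define a where "a = (Re x - b * (pi * Re \<tau>)) / pi"
  have x: "x = of_real a * of_real pi + of_real b * (of_real pi * \<tau>)"
    using assms by (simp add: complex_eq_iff a_def b_def)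
  have "x = (of_real (frac a) * of_real pi + of_real (frac b) * (of_real pi * \<tau>))
         + of_int \<lfloor>a\<rfloor> * of_real pi + of_int \<lfloor>b\<rfloor> * (of_real pi * \<tau>)"
    unfolding x by (simp add: frac_def algebra_simps)
  then show thesis
    using that[of "frac a" "frac b" "\<lfloor>a\<rfloor>" "\<lfloor>b\<rfloor>"]
      frac_ge_0[of a] frac_ge_0[of b] frac_lt_1[of a] frac_lt_1[of b] by (simp add: less_imp_le)
qed

text \<open>
  The quotient \<open>f / g\<close> has only removable singularities: near \<open>0\<close> by the assumed limit, near the
  other lattice points by periodicity. The extended quotient is entire and doubly periodic, so it
  is bounded and Liouville's theorem applies. Two theta functions with the same
  multipliers can thus be compared through their zeros and their behaviour at \<open>0\<close> alone.
\<close>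

lemma quasi_periodic_quotient_constant:
  fixes f g \<sigma> e :: "complex \<Rightarrow> complex"
  assumes tau: "Im \<tau> > 0"
    and f: "f holomorphic_on UNIV" and g: "g holomorphic_on UNIV"
    and fpi: "\<And>x. f (x + of_real pi) = \<sigma> x * f x" and gpi: "\<And>x. g (x + of_real pi) = \<sigma> x * g x"
    and ftau: "\<And>x. f (x + of_real pi * \<tau>) = e x * f x"
    and gtau: "\<And>x. g (x + of_real pi * \<tau>) = e x * g x"
    and nz: "\<And>x. \<sigma> x \<noteq> 0" "\<And>x. e x \<noteq> 0"
    and zeros: "\<And>x. g x = 0 \<longleftrightarrow> x \<in> theta_lattice \<tau>"
    and lim: "((\<lambda>x. f x / g x) \<longlongrightarrow> L) (at 0)"
  obtains C where "\<And>x. f x = C * g x"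
proof -
  define h where "h x = (if g x = 0 then L else f x / g x)" for x
  have hpi: "h (x + of_real pi) = h x" for x using nz by (simp add: h_def fpi gpi)
  have htau: "h (x + of_real pi * \<tau>) = h x" for x using nz by (simp add: h_def ftau gtau)
  have hper: "h (x + (of_int m * of_real pi + of_int n * (of_real pi * \<tau>))) = h x"
    for x and m n :: int
    using period_of_int_multiple[of h "of_real pi" "x + of_int n * (of_real pi * \<tau>)" m, OF hpi]
      period_of_int_multiple[of h "of_real pi * \<tau>" x n, OF htau] by (simp add: add_ac)
  have "0 \<in> theta_lattice \<tau>" by (auto simp: theta_lattice_def intro!: exI[of _ 0])
  then have g0: "g 0 = 0" using zeros by simp
  have ev: "\<forall>\<^sub>F x in at 0. g x \<noteq> 0"
    using non_zero_neighbour_alt[OF g, of 0 "of_real pi * \<tau> / 2"]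
      half_tau_notin_theta_lattice[OF tau] zeros by (auto elim: eventually_mono)
  have "\<forall>\<^sub>F x in at 0. f x / g x = h x" using ev by eventually_elim (simp add: h_def)
  then have h0: "(h \<longlongrightarrow> h 0) (at 0)"
    using lim g0 by (auto simp: h_def intro: Lim_transform_eventually)
  have hdiff: "h field_differentiable (at x)" if "g x \<noteq> 0" for x
  proof -
    have ev: "\<forall>\<^sub>F z in nhds x. g z \<noteq> 0"
      using that holomorphic_on_imp_continuous_on[OF g]
      by (intro tendsto_imp_eventually_ne[where c = "g x"])
         (auto simp: continuous_on_eq_continuous_at isCont_def tendsto_nhds_iff)
    have "(\<lambda>x. f x / g x) field_differentiable (at x)"
      using f g that by (intro field_differentiable_divide) (auto simp: holomorphic_on_def)
    moreover have "\<forall>\<^sub>F z in nhds x. h z = f z / g z" using ev by eventually_elim (simp add: h_def)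
    ultimately show ?thesis
      unfolding field_differentiable_def by (metis DERIV_cong_ev)
  qed
  obtain r where r: "r > 0" "\<And>x. x \<in> ball 0 r - {0} \<Longrightarrow> g x \<noteq> 0"
    using ev unfolding eventually_at by (auto simp: dist_commute)
  have "h holomorphic_on ball 0 r"
  proof (rule no_isolated_singularity'[of "{0}"])
    show "h holomorphic_on ball 0 r - {0}"
      using hdiff r field_differentiable_at_within unfolding holomorphic_on_def by blast
    show "(h \<longlongrightarrow> h z) (at z within ball 0 r)" if "z \<in> {0}" for z
      using h0 that by (auto intro: tendsto_within_subset)
  qed auto
  then have hd0: "h field_differentiable (at 0)"
    using r holomorphic_on_imp_differentiable_at[of h "ball 0 r" 0] by auto
  have hd: "h field_differentiable (at x)" for x
  proof (cases "g x = 0")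
    case True
    then obtain m n :: int where x: "x = of_int m * of_real pi + of_int n * (of_real pi * \<tau>)"
      using zeros by (auto simp: theta_lattice_def)
    have eq: "h = h \<circ> (\<lambda>z. z - x)"
      using hper[of "z - x" m n for z] by (auto simp: x fun_eq_iff)
    have "h \<circ> (\<lambda>z. z - x) field_differentiable (at x)"
      using hd0 by (intro field_differentiable_compose field_differentiable_diff) auto
    then show ?thesis using eq by simp
  qed (use hdiff in auto)
  then have hol: "h holomorphic_on UNIV" by (auto simp: holomorphic_on_def)
  define K where "K = (\<lambda>(a, b). of_real a * of_real pi + of_real b * (of_real pi * \<tau>))
                        ` ({0..1::real} \<times> {0..1::real})"
  have "compact K" unfolding K_def
    by (intro compact_continuous_image compact_Times)
       (auto intro!: continuous_intros simp: case_prod_unfold)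
  then have "compact (h ` K)"
    using holomorphic_on_imp_continuous_on[OF hol]
    by (intro compact_continuous_image) (auto intro: continuous_on_subset)
  moreover have "range h \<subseteq> h ` K"
  proof
    fix y assume "y \<in> range h"
    then obtain x where y: "y = h x" by auto
    obtain a b and m n :: int where *: "0 \<le> a" "a \<le> 1" "0 \<le> b" "b \<le> 1"
      "x = (of_real a * of_real pi + of_real b * (of_real pi * \<tau>))
         + of_int m * of_real pi + of_int n * (of_real pi * \<tau>)"
      using translate_into_cell[OF tau] by blast
    have "h x = h (of_real a * of_real pi + of_real b * (of_real pi * \<tau>))"
      using hper[of "of_real a * of_real pi + of_real b * (of_real pi * \<tau>)" m n]
      by (simp add: *(5) add_ac)
    then show "y \<in> h ` K" using * by (force simp: y K_def)
  qed
  ultimately have "bounded (range h)"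
    using bounded_subset compact_imp_bounded by blast
  then have "h constant_on UNIV" using Liouville_theorem hol by blast
  then obtain C where C: "\<And>x. h x = C" by (auto simp: constant_on_def)
  have fC: "f x = C * g x" if "g x \<noteq> 0" for x
    using C[of x] that by (auto simp: h_def field_simps)
  have "f x = C * g x" for x
  proof -
    have "f x = (\<lambda>x. C * g x) x"
    proof (rule analytic_continuation_open[where f = f and s = "{x. g x \<noteq> 0}" and s' = UNIV])
      have "open (g -` (- {0}))"
        using holomorphic_on_imp_continuous_on[OF g] by (intro open_vimage) auto
      then show "open {x. g x \<noteq> 0}" by (simp add: vimage_def)
      show "{x. g x \<noteq> 0} \<noteq> {}"
        using half_tau_notin_theta_lattice[OF tau] zeros by blast
    qed (use fC f g in \<open>auto intro!: holomorphic_intros\<close>)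
    then show ?thesis by simp
  qed
  then show thesis using that by blast
qed

section \<open>A theta product with known zeros\<close>

text \<open>
  The coefficients in Euler's expansion of \<open>\<Prod>n\<ge>1. (1 - p\<^sup>n z)\<close>. Starting from the power series makes
  the function entire at once, and its functional equation \<open>euler_fun_shift\<close> becomes a recursion for the
  coefficients; no infinite product has to converge.
\<close>

definition euler_coeff :: "complex \<Rightarrow> nat \<Rightarrow> complex" where
  "euler_coeff p n = (\<Prod>k<n. - (p ^ Suc k) / (1 - p ^ Suc k))"

definition euler_fun :: "complex \<Rightarrow> complex \<Rightarrow> complex" where
  "euler_fun p z = (\<Sum>n. euler_coeff p n * z ^ n)"

lemma one_minus_power_nonzero:
  assumes p: "cmod p < 1" shows "1 - p ^ Suc n \<noteq> 0"
proof
  assume "1 - p ^ Suc n = 0"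
  then have "cmod (p ^ Suc n) = 1" by simp
  moreover have "cmod (p ^ Suc n) < 1"
    using p power_strict_mono[of "cmod p" 1 "Suc n"] by (simp add: norm_power norm_mult)
  ultimately show False by simp
qed

lemma euler_summable:
  assumes "cmod p < 1"
  shows "summable (\<lambda>n. euler_coeff p n * z ^ n)"
proof -
  have l: "(\<lambda>n. p ^ Suc n) \<longlonglongrightarrow> 0"
    using LIMSEQ_Suc[OF LIMSEQ_power_zero[OF assms]] by simp
  have "(\<lambda>n. (p ^ Suc n) * z / (1 - p ^ Suc n)) \<longlonglongrightarrow> 0 * z / (1 - 0)"
    by (intro tendsto_divide tendsto_mult tendsto_diff l tendsto_const) auto
  then have "\<forall>\<^sub>F n in sequentially. cmod ((p ^ Suc n) * z / (1 - p ^ Suc n)) < 1/2"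
    by (auto dest!: tendstoD[of _ _ _ "1/2"] simp: dist_norm)
  then obtain N where N: "\<And>n. n \<ge> N \<Longrightarrow> cmod ((p ^ Suc n) * z / (1 - p ^ Suc n)) < 1/2"
    by (auto simp: eventually_sequentially)
  show ?thesis
  proof (rule summable_ratio_test[of "1/2" N])
    fix n assume "n \<ge> N"
    have "euler_coeff p (Suc n) * z ^ Suc n
        = - ((p ^ Suc n) * z / (1 - p ^ Suc n)) * (euler_coeff p n * z ^ n)"
      by (simp add: euler_coeff_def)
    then have "cmod (euler_coeff p (Suc n) * z ^ Suc n)
        = cmod ((p ^ Suc n) * z / (1 - p ^ Suc n)) * cmod (euler_coeff p n * z ^ n)"
      by (metis norm_minus_cancel norm_mult)
    also have "\<dots> \<le> 1/2 * cmod (euler_coeff p n * z ^ n)"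
      using N[OF \<open>n \<ge> N\<close>] by (intro mult_right_mono) auto
    finally show "cmod (euler_coeff p (Suc n) * z ^ Suc n) \<le> 1/2 * cmod (euler_coeff p n * z ^ n)" .
  qed simp
qed

lemma euler_fun_holomorphic:
  assumes "cmod p < 1"
  shows "euler_fun p holomorphic_on UNIV"
  using termdiffs_strong_converges_everywhere[OF euler_summable[OF assms]]
  unfolding holomorphic_on_def field_differentiable_def euler_fun_def by blast

lemma euler_fun_0: "euler_fun p 0 = 1"
  unfolding euler_fun_def using powser_zero[of "euler_coeff p"] by (simp add: euler_coeff_def)

lemma euler_fun_shift:
  assumes p: "cmod p < 1"
  shows "euler_fun p z = (1 - p * z) * euler_fun p (p * z)"
proof -
  let ?c = "euler_coeff p"
  have s: "summable (\<lambda>n. ?c n * x ^ n)" for x by (rule euler_summable[OF p])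
  have e: "euler_fun p x = 1 + (\<Sum>n. ?c (Suc n) * x ^ Suc n)" for x
    using suminf_split_head[OF s[of x]] by (simp add: euler_fun_def euler_coeff_def)
  have sS: "summable (\<lambda>n. ?c (Suc n) * x ^ Suc n)" for x
    using s[of x] by (subst summable_Suc_iff)
  have rec: "?c (Suc n) = ?c (Suc n) * p ^ Suc n - ?c n * p ^ Suc n" for n
  proof -
    have "?c (Suc n) * (1 - p ^ Suc n) = - (p ^ Suc n) * ?c n"
      using one_minus_power_nonzero[OF p, of n] by (simp add: euler_coeff_def)
    then show ?thesis by (simp add: algebra_simps)
  qed
  have "p * z * euler_fun p (p * z) = (\<Sum>n. (p * z) * (?c n * (p * z) ^ n))"
    unfolding euler_fun_def by (rule suminf_mult[symmetric]) (rule s)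
  then have "(1 - p * z) * euler_fun p (p * z)
     = 1 + ((\<Sum>n. ?c (Suc n) * (p * z) ^ Suc n) - (\<Sum>n. (p * z) * (?c n * (p * z) ^ n)))"
    using e[of "p * z"] by (simp add: algebra_simps)
  also have "\<dots> = 1 + (\<Sum>n. ?c (Suc n) * (p * z) ^ Suc n - (p * z) * (?c n * (p * z) ^ n))"
    by (subst suminf_diff[OF sS]) (auto intro: summable_mult s)
  also have "(\<lambda>n. ?c (Suc n) * (p * z) ^ Suc n - (p * z) * (?c n * (p * z) ^ n))
      = (\<lambda>n. (?c (Suc n) * p ^ Suc n - ?c n * p ^ Suc n) * z ^ Suc n)"
    by (simp add: power_mult_distrib algebra_simps)
  also have "1 + (\<Sum>n. (?c (Suc n) * p ^ Suc n - ?c n * p ^ Suc n) * z ^ Suc n) = euler_fun p z"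
    by (simp only: e[of z] rec[symmetric])
  finally show ?thesis by simp
qed

text \<open>
  Iterating the functional equation peels off the factors \<open>1 - p\<^sup>k z\<close> one by one and leaves
  \<open>euler_fun p (p\<^sup>k z)\<close>, which tends to \<open>euler_fun p 0 = 1\<close>. So a zero can only come from one of
  the factors.
\<close>

lemma euler_fun_eq_0_iff:
  assumes p: "cmod p < 1"
  shows "euler_fun p z = 0 \<longleftrightarrow> (\<exists>k. p ^ Suc k * z = 1)"
proof
  assume "\<exists>k. p ^ Suc k * z = 1"
  then obtain k where k: "p ^ Suc k * z = 1" by blast
  have "euler_fun p (p ^ (k - j) * z) = 0" if "j \<le> k" for j
    using that
  proof (induction j)
    case 0
    have "p * (p ^ k * z) = 1" using k by (simp add: mult_ac)
    then show ?case using euler_fun_shift[OF p, of "p ^ k * z"] by simp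
  next
    case (Suc j)
    have "p * (p ^ (k - Suc j) * z) = p ^ (k - j) * z"
      using Suc.prems by (simp add: Suc_diff_Suc flip: mult.assoc power_Suc)
    moreover have "euler_fun p (p ^ (k - j) * z) = 0" using Suc by simp
    ultimately show ?case using euler_fun_shift[OF p, of "p ^ (k - Suc j) * z"]
      by (metis mult_zero_right)
  qed
  from this[of k] show "euler_fun p z = 0" by simp
next
  assume z: "euler_fun p z = 0"
  show "\<exists>k. p ^ Suc k * z = 1"
  proof (rule ccontr)
    assume no: "\<not> ?thesis"
    have zero: "euler_fun p (p ^ k * z) = 0" for k
    proof (induction k)
      case (Suc k)
      have "1 - p * (p ^ k * z) \<noteq> 0" using no by (simp add: mult.assoc)
      then show ?case using Suc euler_fun_shift[OF p, of "p ^ k * z"] by (simp add: mult.assoc)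
    qed (use z in simp)
    have "(\<lambda>k. p ^ k * z) \<longlonglongrightarrow> 0 * z" 
      by (rule tendsto_mult[OF LIMSEQ_power_zero[OF p] tendsto_const])
    moreover have "isCont (euler_fun p) 0"
      using holomorphic_on_imp_continuous_on[OF euler_fun_holomorphic[OF p]]
      by (simp add: continuous_on_eq_continuous_at)
    ultimately have "(\<lambda>k. euler_fun p (p ^ k * z)) \<longlonglongrightarrow> euler_fun p 0"
      using isCont_tendsto_compose[of 0 "euler_fun p"] by simp
    then show False using zero by (simp add: euler_fun_0 LIMSEQ_const_iff)
  qed
qed


section \<open>Zeros of odd theta functions\<close>

text \<open>
  The properties of \<open>\<theta>\<^sub>1\<close> from which the addition formulae follow. They are invariant under scaling, so
  they also hold for the multiple of \<open>\<theta>\<^sub>1\<close> that is real on the real axis.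
\<close>

locale odd_theta =
  fixes \<tau> :: complex and T :: "complex \<Rightarrow> complex"
  assumes tau: "Im \<tau> > 0"
    and holo: "T holomorphic_on UNIV"
    and odd: "\<And>x. T (- x) = - T x"
    and shift_pi: "\<And>x. T (x + of_real pi) = - T x"
    and shift_tau: "\<And>x. T (x + of_real pi * \<tau>) = - exp (- (\<i> * of_real pi * \<tau>) - 2 * \<i> * x) * T x"
    and deriv0: "deriv T 0 \<noteq> 0"
begin

definition nome2 :: complex where "nome2 = exp (2 * \<i> * of_real pi * \<tau>)"

lemma nome2_lt_1: "cmod nome2 < 1"
  using tau by (simp add: nome2_def)

definition theta_product :: "complex \<Rightarrow> complex" where
  "theta_product x = sin x * (euler_fun nome2 (exp (2 * \<i> * x)) * euler_fun nome2 (exp (- (2 * \<i> * x))))"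

lemma theta_product_holomorphic: "theta_product holomorphic_on UNIV"
proof -
  have e: "(\<lambda>x. euler_fun nome2 (g x)) holomorphic_on UNIV" if "g holomorphic_on UNIV" for g
    using holomorphic_on_compose_gen[OF that euler_fun_holomorphic[OF nome2_lt_1]] by (simp add: o_def)
  show ?thesis unfolding theta_product_def by (intro holomorphic_intros e)
qed

lemma theta_product_shift_pi: "theta_product (x + of_real pi) = - theta_product x"
proof -
  have "exp (2 * \<i> * (x + of_real pi)) = exp (2 * \<i> * x)"
    using exp_two_pi_i by (simp add: distrib_left exp_add mult_ac)
  moreover from this have "exp (- (2 * \<i> * (x + of_real pi))) = exp (- (2 * \<i> * x))"
    by (simp add: exp_minus)
  moreover have "sin (x + of_real pi) = - sin x"
    by (simp add: sin_add sin_of_real cos_of_real)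
  ultimately show ?thesis by (simp add: theta_product_def)
qed

lemma sin_via_exp: "sin x = exp (\<i> * x) * (1 - exp (- (2 * \<i> * x))) / (2 * \<i>)"
proof -
  have "exp (\<i> * x) * exp (- (2 * \<i> * x)) = exp (- (\<i> * x))"
    by (simp flip: exp_add)
  then show ?thesis unfolding sin_exp_eq right_diff_distrib mult_1_right by simp
qed

lemma theta_product_eq_0_iff: "theta_product x = 0 \<longleftrightarrow> x \<in> theta_lattice \<tau>"
proof -
  have e1: "exp (2 * \<i> * y) = 1 \<longleftrightarrow> (\<exists>m::int. y = of_int m * of_real pi)" for y
  proof -
    have "exp (2 * \<i> * y) = 1 \<longleftrightarrow> Im y = 0 \<and> (\<exists>m::int. Re y = of_int m * pi)"
      by (auto simp: exp_eq_1 mult.assoc)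
    also have "\<dots> \<longleftrightarrow> (\<exists>m::int. y = of_int m * of_real pi)"
      by (auto simp: complex_eq_iff)
    finally show ?thesis .
  qed
  have pk: "nome2 ^ k = exp (2 * \<i> * (of_nat k * (of_real pi * \<tau>)))" for k
    unfolding nome2_def by (simp add: mult_ac flip: exp_of_nat_mult)
  have up: "euler_fun nome2 (exp (2 * \<i> * y)) = 0
      \<longleftrightarrow> (\<exists>k. \<exists>m::int. y + of_nat (Suc k) * (of_real pi * \<tau>) = of_int m * of_real pi)" for y
    unfolding euler_fun_eq_0_iff[OF nome2_lt_1] pk exp_add[symmetric] distrib_left[symmetric]
      e1 by (simp add: add.commute)
  have sin0: "sin x = 0 \<longleftrightarrow> (\<exists>m::int. x = of_int m * of_real pi)"
    using e1[of x] unfolding sin_via_exp by (simp add: exp_minus)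
  have dn: "euler_fun nome2 (exp (- (2 * \<i> * x))) = 0
      \<longleftrightarrow> (\<exists>k. \<exists>m::int. - x + of_nat (Suc k) * (of_real pi * \<tau>) = of_int m * of_real pi)"
    using up[of "- x"] by simp
  show ?thesis
  proof
    assume "theta_product x = 0"
    then consider "sin x = 0" | "euler_fun nome2 (exp (2 * \<i> * x)) = 0"
      | "euler_fun nome2 (exp (- (2 * \<i> * x))) = 0"
      by (auto simp: theta_product_def)
    then show "x \<in> theta_lattice \<tau>"
    proof cases
      case 1
      then obtain m :: int where "x = of_int m * of_real pi" using sin0 by blast
      then have "x = of_int m * of_real pi + of_int 0 * (of_real pi * \<tau>)" by simp
      then show ?thesis unfolding theta_lattice_def by blast
    next
      case 2
      then obtain k and m :: int where "x + of_nat (Suc k) * (of_real pi * \<tau>) = of_int m * of_real pi"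
        using up by blast
      then have "x = of_int m * of_real pi + of_int (- int (Suc k)) * (of_real pi * \<tau>)"
        by (simp add: algebra_simps)
      then show ?thesis unfolding theta_lattice_def by blast
    next
      case 3
      then obtain k and m :: int where "- x + of_nat (Suc k) * (of_real pi * \<tau>) = of_int m * of_real pi"
        using dn by blast
      then have "x = of_int (- m) * of_real pi + of_int (int (Suc k)) * (of_real pi * \<tau>)"
        by (simp add: algebra_simps)
      then show ?thesis unfolding theta_lattice_def by blast
    qed
  next
    assume "x \<in> theta_lattice \<tau>"
    then obtain m n :: int where x: "x = of_int m * of_real pi + of_int n * (of_real pi * \<tau>)"
      by (auto simp: theta_lattice_def)
    consider "n = 0" | k where "n = - int (Suc k)" | k where "n = int (Suc k)"
      by (metis int_cases of_nat_0 not0_implies_Suc)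
    then show "theta_product x = 0"
    proof cases
      case 1
      then have "sin x = 0" using x sin0 by auto
      then show ?thesis by (simp add: theta_product_def)
    next
      case 2
      have "x + of_nat (Suc k) * (of_real pi * \<tau>) = of_int m * of_real pi"
        unfolding x 2 by (simp add: algebra_simps)
      then have "euler_fun nome2 (exp (2 * \<i> * x)) = 0" using up by blast
      then show ?thesis by (simp add: theta_product_def)
    next
      case 3
      have "- x + of_nat (Suc k) * (of_real pi * \<tau>) = of_int (- m) * of_real pi"
        unfolding x 3 by (simp add: algebra_simps)
      then have "euler_fun nome2 (exp (- (2 * \<i> * x))) = 0" using dn by blast
      then show ?thesis by (simp add: theta_product_def)
    qed
  qed
qed

text \<open>
  Passing from \<open>x\<close> to \<open>x + \<pi> \<tau>\<close> moves one factor from the first Euler function to the second, and the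
  two boundary factors combine with the sine. The functional equation cannot be divided by
  \<open>1 - q\<^sup>2 Z\<close> where that vanishes; these are lattice points, where both sides are zero.
\<close>

lemma theta_product_shift_tau:
  "theta_product (x + of_real pi * \<tau>)
     = - exp (- (\<i> * of_real pi * \<tau>) - 2 * \<i> * x) * theta_product x"
proof (cases "x + of_real pi * \<tau> \<in> theta_lattice \<tau>")
  case True
  then obtain m n :: int where "x + of_real pi * \<tau> = of_int m * of_real pi + of_int n * (of_real pi * \<tau>)"
    by (auto simp: theta_lattice_def)
  then have "x = of_int m * of_real pi + of_int (n - 1) * (of_real pi * \<tau>)"
    by (simp add: algebra_simps)
  then have "x \<in> theta_lattice \<tau>" unfolding theta_lattice_def by blast
  then have "theta_product x = 0" "theta_product (x + of_real pi * \<tau>) = 0"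
    using True theta_product_eq_0_iff by blast+
  then show ?thesis by simp
next
  case False
  define Z q where "Z = exp (2 * \<i> * x)" and "q = exp (\<i> * of_real pi * \<tau>)"
  have nz: "Z \<noteq> 0" "q \<noteq> 0" by (simp_all add: Z_def q_def)
  have p: "nome2 = q\<^sup>2" by (simp add: nome2_def q_def mult_ac flip: exp_of_nat_mult)
  have Z: "exp (2 * \<i> * (x + of_real pi * \<tau>)) = q\<^sup>2 * Z"
    by (simp add: p[symmetric] nome2_def Z_def distrib_left exp_add mult_ac)
  have Z': "exp (- (2 * \<i> * (x + of_real pi * \<tau>))) = inverse (q\<^sup>2 * Z)"
    using Z by (simp add: exp_minus)
  have "sin (x + of_real pi * \<tau>) \<noteq> 0"
    using False theta_product_eq_0_iff by (auto simp: theta_product_def)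
  then have ne: "q\<^sup>2 * Z \<noteq> 1" unfolding sin_via_exp Z' by (metis inverse_1 diff_self mult_zero_right div_0)
  have "exp (\<i> * (x + of_real pi * \<tau>)) = q * exp (\<i> * x)"
    by (simp add: q_def distrib_left exp_add mult_ac)
  then have s: "sin (x + of_real pi * \<tau>) = q * exp (\<i> * x) * (1 - inverse (q\<^sup>2 * Z)) / (2 * \<i>)"
    by (simp add: sin_via_exp Z')
  have s0: "sin x = exp (\<i> * x) * (1 - inverse Z) / (2 * \<i>)"
    by (simp add: sin_via_exp Z_def exp_minus)
  have f1: "euler_fun nome2 Z = (1 - q\<^sup>2 * Z) * euler_fun nome2 (q\<^sup>2 * Z)"
    using euler_fun_shift[OF nome2_lt_1, of Z] by (simp add: p)
  have f2: "euler_fun nome2 (inverse (q\<^sup>2 * Z)) = (1 - inverse Z) * euler_fun nome2 (inverse Z)"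
    using euler_fun_shift[OF nome2_lt_1, of "inverse (q\<^sup>2 * Z)"] nz by (simp add: p field_simps)
  have e: "exp (- (\<i> * of_real pi * \<tau>) - 2 * \<i> * x) = inverse (q * Z)"
    by (simp add: q_def Z_def exp_diff exp_minus field_simps)
  have "theta_product (x + of_real pi * \<tau>)
     = q * exp (\<i> * x) * (1 - inverse (q\<^sup>2 * Z)) / (2 * \<i>) *
       (euler_fun nome2 (q\<^sup>2 * Z) * ((1 - inverse Z) * euler_fun nome2 (inverse Z)))"
    by (simp only: theta_product_def Z Z' s f2)
  also have "\<dots> = (q * (1 - inverse (q\<^sup>2 * Z))) * (exp (\<i> * x) * (1 - inverse Z) / (2 * \<i>)
       * (euler_fun nome2 (q\<^sup>2 * Z) * euler_fun nome2 (inverse Z)))"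
    by (simp only: divide_inverse mult_ac)
  also have "q * (1 - inverse (q\<^sup>2 * Z)) = - inverse (q * Z) * (1 - q\<^sup>2 * Z)"
    using nz by (simp add: field_simps power2_eq_square)
  also have "- inverse (q * Z) * (1 - q\<^sup>2 * Z) * (exp (\<i> * x) * (1 - inverse Z) / (2 * \<i>)
       * (euler_fun nome2 (q\<^sup>2 * Z) * euler_fun nome2 (inverse Z)))
     = - inverse (q * Z) * ((exp (\<i> * x) * (1 - inverse Z) / (2 * \<i>)) *
        (((1 - q\<^sup>2 * Z) * euler_fun nome2 (q\<^sup>2 * Z)) * euler_fun nome2 (inverse Z)))"
    by (simp only: divide_inverse mult_ac)
  also have "\<dots> = - inverse (q * Z) * theta_product x"
    by (simp only: f1[symmetric] s0[symmetric]) (simp add: theta_product_def Z_def exp_minus)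
  finally show ?thesis by (simp add: e)
qed

lemma T_has_deriv: "(T has_field_derivative deriv T x) (at x)"
  using holo holomorphic_derivI by blast

lemma T_0: "T 0 = 0" using odd[of 0] by simp

text \<open>
  The theta product has the multipliers of \<open>T\<close>, and its zeros are visible factor by factor. Both
  functions have a simple zero at \<open>0\<close>, so they are proportional by the Liouville argument.
\<close>

theorem T_eq_0_iff: "T x = 0 \<longleftrightarrow> x \<in> theta_lattice \<tau>"
proof -
  define R where "R x = euler_fun nome2 (exp (2 * \<i> * x)) * euler_fun nome2 (exp (- (2 * \<i> * x)))" for x
  have e: "(\<lambda>x. euler_fun nome2 (g x)) holomorphic_on UNIV" if "g holomorphic_on UNIV" for g
    using holomorphic_on_compose_gen[OF that euler_fun_holomorphic[OF nome2_lt_1]] by (simp add: o_def)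
  have "R holomorphic_on UNIV" unfolding R_def by (intro holomorphic_intros e)
  then have "(R has_field_derivative deriv R 0) (at 0)" using holomorphic_derivI by blast
  then have "((\<lambda>x. sin x * R x) has_field_derivative R 0) (at 0)"
    by (auto intro!: derivative_eq_intros)
  then have dP: "(theta_product has_field_derivative R 0) (at 0)"
    unfolding theta_product_def R_def .
  have "nome2 ^ Suc k \<noteq> 1" for k
    using one_minus_power_nonzero[OF nome2_lt_1, of k] by auto
  then have R0: "R 0 \<noteq> 0"
    using euler_fun_eq_0_iff[OF nome2_lt_1, of 1] by (auto simp: R_def)
  have "((\<lambda>x. T x / theta_product x) \<longlongrightarrow> deriv T 0 / R 0) (at 0)"
    by (rule lhopital_complex_simple[OF T_has_deriv dP])
       (auto simp: T_0 R0, simp add: theta_product_def)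
  then obtain C where C: "\<And>x. T x = C * theta_product x"
    by (rule quasi_periodic_quotient_constant[OF tau holo theta_product_holomorphic, rotated 7,
        where \<sigma> = "\<lambda>_. -1" and e = "\<lambda>x. - exp (- (\<i> * of_real pi * \<tau>) - 2 * \<i> * x)"])
       (auto simp: shift_pi shift_tau theta_product_shift_pi theta_product_shift_tau theta_product_eq_0_iff)
  have "C \<noteq> 0"
  proof
    assume "C = 0"
    then have "T = (\<lambda>_. 0)" using C by auto
    then show False using deriv0 by simp
  qed
  then show ?thesis using C theta_product_eq_0_iff by simp
qed

end

section \<open>Addition formulae\<close>

context odd_theta
begin

text \<open>
  For \<open>T = \<theta>\<^sub>1\<close> this is \<open>\<theta>\<^sub>2\<close>.
\<close>

definition T2 :: "complex \<Rightarrow> complex" where "T2 x = T (x + of_real pi / 2)"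

lemma T_minus_pi: "T (x - of_real pi) = - T x"
  using shift_pi[of "x - of_real pi"] by simp

lemma T2_even: "T2 (- x) = T2 x"
  using odd[of "x - of_real pi / 2"] shift_pi[of "x - of_real pi / 2"]
  by (simp add: T2_def algebra_simps)

lemma T2_shift_pi: "T2 (x + of_real pi) = - T2 x"
  using shift_pi[of "x + of_real pi / 2"] by (simp add: T2_def algebra_simps)

lemma T2_shift_tau:
  "T2 (x + of_real pi * \<tau>) = exp (- (\<i> * of_real pi * \<tau>) - 2 * \<i> * x) * T2 x"
proof -
  have "exp (- (\<i> * of_real pi * \<tau>) - 2 * \<i> * (x + of_real pi / 2))
      = exp (- (\<i> * of_real pi * \<tau>) - 2 * \<i> * x) * exp (- (of_real pi * \<i>))"
    unfolding exp_add[symmetric] by (rule arg_cong[where f = exp]) (simp add: algebra_simps)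
  then show ?thesis
    using shift_tau[of "x + of_real pi / 2"] by (simp add: T2_def algebra_simps exp_minus)
qed

lemma T_shift_half_pi: "T (x + of_real pi / 2) = T2 x" "T (x - of_real pi / 2) = - T2 x"
  using T_minus_pi[of "x + of_real pi / 2"] by (simp_all add: T2_def algebra_simps)

lemma T2_shift_half_pi: "T2 (x + of_real pi / 2) = - T x" "T2 (x - of_real pi / 2) = T x"
  using shift_pi[of x] by (simp_all add: T2_def algebra_simps)

lemma T_half_pi_minus: "T (of_real pi / 2 - x) = T2 x" "T2 (of_real pi / 2 - x) = T x"
  using T_shift_half_pi(1)[of "- x"] T2_shift_half_pi(1)[of "- x"] T2_even[of x] odd[of x]
  by (simp_all add: algebra_simps)

lemma T2_holo: "T2 holomorphic_on UNIV"
proof -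
  have "(T \<circ> (\<lambda>x. x + of_real pi / 2)) holomorphic_on UNIV"
    by (intro holomorphic_on_compose holomorphic_intros holomorphic_on_subset[OF holo]) auto
  then show ?thesis by (simp add: o_def T2_def[abs_def])
qed

lemma deriv_T2: "deriv T2 x = deriv T (x + of_real pi / 2)"
  unfolding T2_def[abs_def]
  by (rule DERIV_imp_deriv)
     (use DERIV_chain2[OF T_has_deriv, of "\<lambda>x. x + of_real pi / 2" 1 x UNIV]
      in \<open>auto intro!: derivative_eq_intros simp: DERIV_shift[symmetric] T_has_deriv\<close>)

lemma T2_has_deriv: "(T2 has_field_derivative deriv T2 x) (at x)"
  using T2_holo holomorphic_derivI by blast

lemma dT_has_deriv: "(deriv T has_field_derivative deriv (deriv T) x) (at x)"
  using holo holomorphic_deriv holomorphic_derivI open_UNIV by blast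

lemma dT2_has_deriv: "(deriv T2 has_field_derivative deriv (deriv T2) x) (at x)"
  using T2_holo holomorphic_deriv holomorphic_derivI open_UNIV by blast

lemma T_compose_deriv:
  assumes "(g has_field_derivative g') (at x within S)"
  shows "((\<lambda>x. T (g x)) has_field_derivative deriv T (g x) * g') (at x within S)"
    and "((\<lambda>x. T2 (g x)) has_field_derivative deriv T2 (g x) * g') (at x within S)"
    and "((\<lambda>x. deriv T (g x)) has_field_derivative deriv (deriv T) (g x) * g') (at x within S)"
    and "((\<lambda>x. deriv T2 (g x)) has_field_derivative deriv (deriv T2) (g x) * g') (at x within S)"
  using DERIV_chain2 assms T_has_deriv T2_has_deriv dT_has_deriv dT2_has_deriv by blast+

text \<open>
  The rows of the zero lattice have heights in \<open>\<int> \<pi> Im \<tau>\<close>, so there is no zero strictly between two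
  consecutive rows.
\<close>

lemma T_nonzero_strip:
  assumes "0 < Im x" "Im x < pi * Im \<tau>"
  shows "T x \<noteq> 0" "T2 x \<noteq> 0"
proof -
  have *: "T y \<noteq> 0" if y: "0 < Im y" "Im y < pi * Im \<tau>" for y
  proof
    assume "T y = 0"
    then obtain m n :: int where "y = of_int m * of_real pi + of_int n * (of_real pi * \<tau>)"
      using T_eq_0_iff by (auto simp: theta_lattice_def)
    then have i: "Im y = of_int n * (pi * Im \<tau>)" by simp
    have pos: "pi * Im \<tau> > 0" using tau by simp
    have "0 < (of_int n :: real)" using y(1) pos i by (simp add: zero_less_mult_iff)
    moreover have "of_int n < (1::real)" using y(2) pos unfolding i
      by (metis mult_less_cancel_right_pos mult_1)
    ultimately show False by simp
  qed
  show "T x \<noteq> 0" "T2 x \<noteq> 0"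
    using *[of x] *[of "x + of_real pi / 2"] assms by (simp_all add: T2_def)
qed

lemma T_nonzero_real:
  assumes "0 < x" "x < pi"
  shows "T (of_real x) \<noteq> 0"
proof
  assume "T (of_real x) = 0"
  then obtain m n :: int where e: "of_real x = of_int m * of_real pi + of_int n * (of_real pi * \<tau>)"
    using T_eq_0_iff by (auto simp: theta_lattice_def)
  have "Im (of_real x) = of_int n * (pi * Im \<tau>)" unfolding e by simp
  then have n: "n = 0" using tau by simp
  have x: "x = of_int m * pi" using arg_cong[OF e, of Re] n by simp
  have "0 < (of_int m :: real)" using assms(1) x by (simp add: zero_less_mult_iff)
  moreover have "of_int m < (1::real)" using assms(2) unfolding x by simp
  ultimately show False by simp
qed

lemma T2_nonzero_real:
  assumes "- (pi / 2) < x" "x < pi / 2"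
  shows "T2 (of_real x) \<noteq> 0"
  using T_nonzero_real[of "x + pi / 2"] assms by (simp add: T2_def)

lemma T2_0_nonzero: "T2 0 \<noteq> 0"
  using T2_nonzero_real[of 0] by simp

text \<open>
  An even function that vanishes at \<open>0\<close> has a double zero there, like \<open>T\<^sup>2\<close>.
\<close>

lemma even_divided_by_T_squared:
  assumes G: "G holomorphic_on UNIV" and even: "\<And>x. G (- x) = G x" and G0: "G 0 = 0"
  shows "\<exists>L. ((\<lambda>x. G x / (T x)\<^sup>2) \<longlongrightarrow> L) (at 0)"
proof -
  \<comment> \<open>\<open>G x / x\<close> and \<open>T x / x\<close> with their singularities at \<open>0\<close> removed\<close>
  define K where "K z = (if z = 0 then deriv G 0 else G z / z)" for z
  define S where "S z = (if z = 0 then deriv T 0 else T z / z)" for z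
  have "K holomorphic_on UNIV" "S holomorphic_on UNIV"
    using pole_lemma_open[OF G open_UNIV, of 0] pole_lemma_open[OF holo open_UNIV, of 0]
    by (simp_all add: K_def[abs_def] S_def[abs_def] G0 T_0 cong: if_cong)
  then have dK: "(K has_field_derivative deriv K 0) (at 0)" and "continuous_on UNIV S"
    using holomorphic_derivI holomorphic_on_imp_continuous_on by blast+
  then have cS: "isCont S 0" by (simp add: continuous_on_eq_continuous_at)
  have dG: "(G has_field_derivative deriv G 0) (at 0)" using G holomorphic_derivI by blast
  have "((\<lambda>x. G (- x)) has_field_derivative deriv G 0 * - 1) (at 0)"
    by (rule DERIV_chain2[of G]) (auto intro!: derivative_eq_intros simp: dG)
  then have "(G has_field_derivative - deriv G 0) (at 0)" by (simp add: even)
  then have "deriv G 0 = - deriv G 0" using dG DERIV_unique by blast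
  then have "K 0 = 0" by (simp add: K_def)
  then have l1: "((\<lambda>x. K x / x) \<longlongrightarrow> deriv K 0) (at 0)"
    using dK by (simp add: has_field_derivative_iff)
  have S0: "S 0 \<noteq> 0" using deriv0 by (simp add: S_def)
  have l2: "((\<lambda>x. K x / x / (S x)\<^sup>2) \<longlongrightarrow> deriv K 0 / (S 0)\<^sup>2) (at 0)"
    using cS S0 by (intro tendsto_intros l1) (auto simp: isCont_def)
  have ev: "\<forall>\<^sub>F x in at 0. K x / x / (S x)\<^sup>2 = G x / (T x)\<^sup>2"
    unfolding eventually_at_filter
    by (rule always_eventually) (simp add: K_def S_def power_divide power2_eq_square)
  show ?thesis by (rule exI, rule Lim_transform_eventually[OF l2 ev])
qed

text \<open>
  For fixed \<open>q\<close> the difference of the two sides is an even function of \<open>p\<close> with the multipliers of \<open>T\<^sup>2\<close>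
  that vanishes at \<open>0\<close>, hence to second order. It is therefore a multiple of \<open>T\<^sup>2\<close>, and it also vanishes
  at \<open>\<pi> / 2\<close>, where \<open>T\<close> does not.
\<close>

theorem T_addition:
  "(T2 0)\<^sup>2 * (T (p + q) * T (p - q)) = (T p)\<^sup>2 * (T2 q)\<^sup>2 - (T2 p)\<^sup>2 * (T q)\<^sup>2"
proof -
  define G where "G x = (T2 0)\<^sup>2 * (T (x + q) * T (x - q)) + (T2 x)\<^sup>2 * (T q)\<^sup>2 - (T x)\<^sup>2 * (T2 q)\<^sup>2" for x
  define e where "e x = (exp (- (\<i> * of_real pi * \<tau>) - 2 * \<i> * x))\<^sup>2" for x
  have ss: "(\<lambda>x. T (x + a)) holomorphic_on UNIV" for a
    by (rule holomorphic_on_compose[unfolded o_def, of "\<lambda>x. x + a" UNIV T])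
       (auto intro!: holomorphic_intros holomorphic_on_subset[OF holo])
  have hG: "G holomorphic_on UNIV"
    unfolding G_def using ss[of q] ss[of "- q"] by (intro holomorphic_intros holo T2_holo) auto
  have hT: "(\<lambda>x. (T x)\<^sup>2) holomorphic_on UNIV" by (intro holomorphic_intros holo)
  have G0: "G 0 = 0" using odd[of q] by (simp add: G_def T_0 power2_eq_square)
  have Geven: "G (- x) = G x" for x
  proof -
    have "T (- x + q) = - T (x - q)" "T (- x - q) = - T (x + q)"
      using odd[of "x - q"] odd[of "x + q"] by simp_all
    then show ?thesis by (simp add: G_def odd[of x] T2_even[of x])
  qed
  obtain L where L: "((\<lambda>x. G x / (T x)\<^sup>2) \<longlongrightarrow> L) (at 0)"
    using even_divided_by_T_squared[OF hG Geven G0] by blast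
  have Gpi: "G (x + of_real pi) = 1 * G x" for x
    using shift_pi[of "x + q"] shift_pi[of "x - q"] shift_pi[of x] T2_shift_pi[of x]
    by (simp add: G_def algebra_simps)
  have ee: "exp (- (\<i> * of_real pi * \<tau>) - 2 * \<i> * (x + q)) * exp (- (\<i> * of_real pi * \<tau>) - 2 * \<i> * (x - q)) = e x" for x
    unfolding e_def power2_eq_square exp_add[symmetric]
    by (rule arg_cong[where f = exp]) (simp add: algebra_simps)
  have Gtau: "G (x + of_real pi * \<tau>) = e x * G x" for x
  proof -
    have "T (x + of_real pi * \<tau> + q) * T (x + of_real pi * \<tau> - q) = e x * (T (x + q) * T (x - q))"
    proof -
      have "x + of_real pi * \<tau> + q = (x + q) + of_real pi * \<tau>"
        "x + of_real pi * \<tau> - q = (x - q) + of_real pi * \<tau>" by simp_all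
      then show ?thesis by (simp only: shift_tau ee[symmetric]) simp
    qed
    then show ?thesis
      using shift_tau[of x] T2_shift_tau[of x]
      by (simp add: G_def e_def power_mult_distrib algebra_simps)
  qed
  obtain C where C: "\<And>x. G x = C * (T x)\<^sup>2"
    by (rule quasi_periodic_quotient_constant[OF tau hG hT Gpi _ Gtau _ _ _ _ L])
       (auto simp: shift_pi shift_tau e_def power_mult_distrib T_eq_0_iff)
  have "G (of_real pi / 2) = 0"
    using T_half_pi_minus(1)[of q] T_half_pi_minus(1)[of "- q"] T2_even[of q]
      T_half_pi_minus(1)[of 0] T_half_pi_minus(2)[of 0]
    by (simp add: G_def T_0 power2_eq_square)
  moreover have "T (of_real pi / 2) \<noteq> 0" using T2_0_nonzero by (simp add: T2_def)
  ultimately have "C = 0" using C[of "of_real pi / 2"] by simp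
  then show ?thesis using C[of p] by (simp add: G_def algebra_simps)
qed

text \<open>
  By the addition formula \<open>T (a + b) T (a - b)\<close> is, up to the factor \<open>T2 0 ^ 2\<close>, the determinant of the
  vectors \<open>(T\<^sup>2, T2\<^sup>2)\<close> at \<open>a\<close> and \<open>b\<close>. The identity is the Pluecker relation between the six
  determinants of four vectors in the plane.
\<close>

corollary T_three_term:
  "T (a + b) * T (a - b) * (T (c + d) * T (c - d)) - T (a + c) * T (a - c) * (T (b + d) * T (b - d))
   + T (a + d) * T (a - d) * (T (b + c) * T (b - c)) = 0" (is "?X = 0")
proof -
  define F where "F a b = T (a + b) * T (a - b)" for a b
  define k where "k = (T2 0)\<^sup>2"
  have F: "k * F a b = (T a)\<^sup>2 * (T2 b)\<^sup>2 - (T2 a)\<^sup>2 * (T b)\<^sup>2" for a b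
    unfolding F_def k_def by (rule T_addition)
  have "k * k * ?X = (k * F a b) * (k * F c d) - (k * F a c) * (k * F b d) + (k * F a d) * (k * F b c)"
    by (simp add: F_def algebra_simps)
  also have "\<dots> = 0" unfolding F by (simp add: algebra_simps)
  finally show ?thesis using T2_0_nonzero by (simp add: k_def)
qed

text \<open>
  The derivative of the addition formula with respect to \<open>q\<close>.
\<close>

corollary T_wronskian:
  "(T2 0)\<^sup>2 * (deriv T (p + q) * T (p - q) - T (p + q) * deriv T (p - q))
   = 2 * ((T p)\<^sup>2 * (T2 q * deriv T2 q) - (T2 p)\<^sup>2 * (T q * deriv T q))"
proof -
  have "((\<lambda>q. (T2 0)\<^sup>2 * (T (p + q) * T (p - q))) has_field_derivative
     (T2 0)\<^sup>2 * (deriv T (p + q) * T (p - q) - T (p + q) * deriv T (p - q))) (at q)"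
    by (auto intro!: derivative_eq_intros T_compose_deriv)
  moreover have "((\<lambda>q. (T p)\<^sup>2 * (T2 q)\<^sup>2 - (T2 p)\<^sup>2 * (T q)\<^sup>2) has_field_derivative
     2 * ((T p)\<^sup>2 * (T2 q * deriv T2 q) - (T2 p)\<^sup>2 * (T q * deriv T q))) (at q)"
    by (auto intro!: derivative_eq_intros T_compose_deriv simp: algebra_simps)
  ultimately show ?thesis using DERIV_unique unfolding T_addition by blast
qed

text \<open>
  The second derivative of the addition formula with respect to \<open>q\<close>, taken at \<open>q = 0\<close>. It says that
  \<open>T2\<^sup>2 / T\<^sup>2\<close> is, up to affine changes, the derivative of the logarithmic derivative of \<open>T\<close>; this is the
  source of the periodic primitives needed to close the surfaces in the u-direction.
\<close>

corollary T_second_log_deriv: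
  "(T2 0)\<^sup>2 * (deriv (deriv T) p * T p - (deriv T p)\<^sup>2)
   = (T p)\<^sup>2 * ((deriv T2 0)\<^sup>2 + T2 0 * deriv (deriv T2) 0) - (T2 p)\<^sup>2 * (deriv T 0)\<^sup>2"
proof -
  have "((\<lambda>q. (T2 0)\<^sup>2 * (deriv T (p + q) * T (p - q) - T (p + q) * deriv T (p - q))) has_field_derivative
     (T2 0)\<^sup>2 * (2 * (deriv (deriv T) p * T p - (deriv T p)\<^sup>2))) (at 0)"
    by (rule derivative_eq_intros T_compose_deriv refl | simp add: power2_eq_square algebra_simps)+
  moreover have "((\<lambda>q. 2 * ((T p)\<^sup>2 * (T2 q * deriv T2 q) - (T2 p)\<^sup>2 * (T q * deriv T q))) has_field_derivative
     2 * ((T p)\<^sup>2 * ((deriv T2 0)\<^sup>2 + T2 0 * deriv (deriv T2) 0) - (T2 p)\<^sup>2 * (deriv T 0)\<^sup>2)) (at 0)"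
    by (rule derivative_eq_intros T_compose_deriv refl | simp add: power2_eq_square algebra_simps T_0)+
  ultimately have "(T2 0)\<^sup>2 * (2 * (deriv (deriv T) p * T p - (deriv T p)\<^sup>2))
    = 2 * ((T p)\<^sup>2 * ((deriv T2 0)\<^sup>2 + T2 0 * deriv (deriv T2) 0) - (T2 p)\<^sup>2 * (deriv T 0)\<^sup>2)"
    using DERIV_unique unfolding T_wronskian by blast
  then show ?thesis by (metis mult.left_commute mult_left_cancel zero_neq_numeral)
qed

end

section \<open>Theta functions that are real on the real axis\<close>

locale real_theta = odd_theta +
  assumes Re_tau: "Re \<tau> = 1 / 2"
    and cnj_T: "\<And>x. cnj (T x) = T (cnj x)"
begin

lemma cnj_T2: "cnj (T2 x) = T2 (cnj x)"
  by (simp add: T2_def cnj_T)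

lemma cnj_deriv:
  assumes "F holomorphic_on UNIV" "\<And>x. cnj (F x) = F (cnj x)"
  shows "cnj (deriv F x) = deriv F (cnj x)"
proof -
  have "cnj \<circ> F \<circ> cnj = F" using assms(2) by (auto simp: fun_eq_iff)
  moreover have "(F has_field_derivative deriv F x) (at x)"
    using assms(1) holomorphic_derivI by blast
  then have "((cnj \<circ> F \<circ> cnj) has_field_derivative cnj (deriv F x)) (at (cnj x))"
    by (intro has_field_derivative_cnj_cnj) simp
  ultimately show ?thesis by (metis DERIV_imp_deriv)
qed

lemma cnj_deriv_T: "cnj (deriv T x) = deriv T (cnj x)"
  by (rule cnj_deriv[OF holo cnj_T])

lemma cnj_deriv_T2: "cnj (deriv T2 x) = deriv T2 (cnj x)"
  by (rule cnj_deriv[OF T2_holo cnj_T2])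

lemma cnj_deriv2_T2: "cnj (deriv (deriv T2) x) = deriv (deriv T2) (cnj x)"
  by (rule cnj_deriv[of "deriv T2", OF _ cnj_deriv_T2]) (simp add: T2_holo holomorphic_deriv)

text \<open>
  The zero \<open>\<pi> \<tau>\<close> has the height of an interior point of the segment, but it lies off the imaginary axis
  because \<open>Re \<tau> = 1/2\<close>.
\<close>

lemma T_imaginary_nonzero:
  assumes "0 < w" "w < 2 * pi * Im \<tau>"
  shows "T (\<i> * of_real w) \<noteq> 0"
proof
  assume "T (\<i> * of_real w) = 0"
  then obtain m n :: int where e: "\<i> * of_real w = of_int m * of_real pi + of_int n * (of_real pi * \<tau>)"
    using T_eq_0_iff by (auto simp: theta_lattice_def)
  have i: "w = of_int n * (pi * Im \<tau>)" using arg_cong[OF e, of Im] by simp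
  have pos: "pi * Im \<tau> > 0" using tau by simp
  have "0 < (of_int n :: real)" using assms(1) pos i by (simp add: zero_less_mult_iff)
  moreover have "of_int n * (pi * Im \<tau>) < 2 * (pi * Im \<tau>)" using assms(2) i by simp
  then have "of_int n < (2::real)" using pos by (metis mult_less_cancel_right_pos)
  ultimately have n: "n = 1" by simp
  have "0 = of_int m * pi + pi * Re \<tau>" using arg_cong[OF e, of Re] n by simp
  then have "pi * (of_int m + 1 / 2) = 0" by (simp add: Re_tau algebra_simps)
  then have "(of_int (2 * m + 1) :: real) = 0" by simp
  then have "2 * m + 1 = 0" by linarith
  then show False by presburger
qed

end

section \<open>The planar curves\<close>

locale planar_curves = real_theta +
  fixes \<omega> :: real
  assumes omega: "0 < \<omega>" "\<omega> < pi / 4"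
    and crit: "deriv T2 (of_real \<omega>) = 0"
begin

abbreviation om :: complex where "om \<equiv> of_real \<omega>"

definition scale :: complex where "scale = 2 * (T2 om)\<^sup>2 / (deriv T 0 * T (2 * om))"

text \<open>
  \<open>G\<close> is the planar curve family \<open>\<gamma>(u, w)\<close> as a function of \<open>z = u + \<i> w\<close>, \<open>dG\<close> its derivative, and \<open>W\<close>
  the function \<open>W\<^sub>1\<close> in the frame equation. The admissible values of \<open>z\<close> form the \<open>strip\<close>.
\<close>

definition G :: "complex \<Rightarrow> complex" where
  "G z = - \<i> * scale * (T ((z - 3 * om) / 2) / T ((z + om) / 2))"

definition dG :: "complex \<Rightarrow> complex" where
  "dG z = - \<i> * (T2 ((z - om) / 2) / T ((z + om) / 2))\<^sup>2"

definition W :: "real \<Rightarrow> complex" where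
  "W w = \<i> * (deriv T 0 / (2 * T2 om)) * (T2 (om - \<i> * of_real w) / T (\<i> * of_real w))"

definition strip :: "complex set" where "strip = {z. 0 < Im z \<and> Im z < 2 * pi * Im \<tau>}"

lemma constants_nonzero: "T2 om \<noteq> 0" "T (2 * om) \<noteq> 0" "scale \<noteq> 0"
proof -
  show "T2 om \<noteq> 0" using omega by (intro T2_nonzero_real) auto
  moreover show "T (2 * om) \<noteq> 0" using T_nonzero_real[of "2 * \<omega>"] omega by simp
  ultimately show "scale \<noteq> 0" using deriv0 by (simp add: scale_def)
qed

lemma cnj_scale: "cnj scale = scale"
  by (simp add: scale_def cnj_T cnj_T2 cnj_deriv_T)

lemma scale_of_real: "scale = of_real (Re scale)"
  by (metis cnj_scale complex_is_Real_iff Reals_cnj_iff of_real_Re)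

lemma shift_notation:
  assumes "y = (z - om) / 2"
  shows "(z - 3 * om) / 2 = y - om" "(z + om) / 2 = y + om"
  using assms by (simp_all add: field_simps)

lemma strip_nonzero:
  assumes "z \<in> strip"
  shows "T ((z - om) / 2) \<noteq> 0" "T ((z + om) / 2) \<noteq> 0" "T2 ((z - om) / 2) \<noteq> 0" "T2 ((z + om) / 2) \<noteq> 0"
  using assms T_nonzero_strip[of "(z - om) / 2"] T_nonzero_strip[of "(z + om) / 2"]
  by (simp_all add: strip_def)

lemma dG_nonzero: "z \<in> strip \<Longrightarrow> dG z \<noteq> 0"
  using strip_nonzero[of z] by (simp add: dG_def)

text \<open>
  Because \<open>T2' \<omega> = 0\<close>, one of the two terms of the Wronskian formula drops out, and what remains is a
  perfect square in \<open>y\<close>. The scaling factor of the curves is the constant that normalizes it.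
\<close>

lemma wronskian_at_omega:
  "scale * (deriv T (y - om) * T (y + om) - T (y - om) * deriv T (y + om)) = 2 * (T2 y)\<^sup>2"
proof -
  define N where "N = T om * deriv T om"
  have 1: "(T2 0)\<^sup>2 * (deriv T (y - om) * T (y + om) - T (y - om) * deriv T (y + om)) = 2 * (T2 y)\<^sup>2 * N"
    using T_wronskian[of y om] by (simp add: crit N_def algebra_simps)
  \<comment> \<open>The same formula at \<open>y = \<omega>\<close>, where \<open>T (y - \<omega>)\<close> vanishes, determines the constant \<open>N\<close>.\<close>
  have 2: "(T2 0)\<^sup>2 * (T (2 * om) * deriv T 0) = 2 * (T2 om)\<^sup>2 * N"
    using T_wronskian[of om om] by (simp add: crit N_def T_0 algebra_simps)
  have N: "scale * N = (T2 0)\<^sup>2"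
    using 2 constants_nonzero deriv0 by (simp add: scale_def field_simps)
  have "(T2 0)\<^sup>2 * (scale * (deriv T (y - om) * T (y + om) - T (y - om) * deriv T (y + om)))
      = scale * (2 * (T2 y)\<^sup>2 * N)"
    using 1 by (metis mult.left_commute)
  also have "\<dots> = (T2 0)\<^sup>2 * (2 * (T2 y)\<^sup>2)" using N by (metis mult.assoc mult.commute)
  finally show ?thesis using T2_0_nonzero by simp
qed

lemma T_quotient_has_deriv:
  assumes g: "(g has_field_derivative g') (at x)" and nz: "T (g x + om) \<noteq> 0"
  shows "((\<lambda>x. T (g x - om) / T (g x + om)) has_field_derivative
           2 / scale * (T2 (g x) / T (g x + om))\<^sup>2 * g') (at x)"
proof -
  have 1: "((\<lambda>y. T (y - om) / T (y + om)) has_field_derivative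
    (deriv T (g x - om) * T (g x + om) - T (g x - om) * deriv T (g x + om)) / (T (g x + om) * T (g x + om))) (at (g x))"
    using nz by (auto intro!: derivative_eq_intros T_compose_deriv)
  have "deriv T (g x - om) * T (g x + om) - T (g x - om) * deriv T (g x + om) = 2 * (T2 (g x))\<^sup>2 / scale"
    using wronskian_at_omega[of "g x"] constants_nonzero by (simp add: field_simps)
  then show ?thesis
    using DERIV_chain2[where f = "\<lambda>y. T (y - om) / T (y + om)" and g = g, OF 1 g] constants_nonzero
    by (simp add: power_divide power2_eq_square mult_ac)
qed

lemma G_has_deriv:
  assumes "z \<in> strip"
  shows "(G has_field_derivative dG z) (at z)"
proof -
  have nz: "T ((z - om) / 2 + om) \<noteq> 0"
    using strip_nonzero(2)[OF assms] shift_notation(2)[of "(z - om) / 2" z] by simp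
  have "((\<lambda>z. T ((z - om) / 2 - om) / T ((z - om) / 2 + om)) has_field_derivative
     2 / scale * (T2 ((z - om) / 2) / T ((z - om) / 2 + om))\<^sup>2 * (1 / 2)) (at z)"
    by (rule T_quotient_has_deriv[where g = "\<lambda>z. (z - om) / 2", OF _ nz])
       (auto intro!: derivative_eq_intros)
  then have "((\<lambda>z. - \<i> * scale * (T ((z - om) / 2 - om) / T ((z - om) / 2 + om))) has_field_derivative
     - \<i> * scale * (2 / scale * (T2 ((z - om) / 2) / T ((z - om) / 2 + om))\<^sup>2 * (1 / 2))) (at z)"
    by (rule DERIV_cmult)
  then show ?thesis
    unfolding G_def[abs_def] dG_def shift_notation(1,2)[symmetric, OF refl] using constants_nonzero by simp
qed

lemma G_periodic: "G (z + 2 * of_real pi) = G z"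
proof -
  have e: "(z + 2 * of_real pi - 3 * om) / 2 = (z - 3 * om) / 2 + of_real pi"
    "(z + 2 * of_real pi + om) / 2 = (z + om) / 2 + of_real pi" by (simp_all add: field_simps)
  show ?thesis unfolding G_def e shift_pi by simp
qed

text \<open>
  The three-term identity for the four arguments \<open>(y + x)/2\<close>, \<open>(y - x + \<pi>)/2\<close>, \<open>(y - x)/2 + \<omega>\<close> and
  \<open>(y - x)/2 - \<omega>\<close>.
\<close>

lemma theta_frame_identity:
  "T2 om * (T (y - om) * T (x + om) * T2 (om + (y - x)) - T (x - om) * T (y + om) * T2 (om - (y - x)))
   = T (2 * om) * T (y - x) * T2 y * T2 x"
proof -
  let ?h = "of_real pi / 2 :: complex"
  let ?a = "(y + x) / 2" and ?b = "(y - x) / 2 + ?h" and ?c = "(y - x) / 2 + om" and ?d = "(y - x) / 2 - om"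
  have sums: "?a + ?b = y + ?h" "?a - ?b = x - ?h" "?c + ?d = y - x" "?c - ?d = 2 * om"
     "?a + ?c = y + om" "?a - ?c = x - om" "?b + ?d = (y - x - om) + ?h" "?b - ?d = om + ?h"
     "?a + ?d = y - om" "?a - ?d = x + om" "?b + ?c = (om + (y - x)) + ?h" "?b - ?c = - om + ?h"
    by (simp_all add: field_simps)
  have "T2 (y - x - om) = T2 (om - (y - x))" using T2_even[of "om - (y - x)"] by (simp add: algebra_simps)
  then show ?thesis
    using T_three_term[of ?a ?b ?c ?d]
    unfolding sums T_shift_half_pi T2_even by (simp add: algebra_simps)
qed

text \<open>
  The v-derivative of the cylinder has the component \<open>2 Re (G * cnj W)\<close> orthogonal to the plane of the
  curve, scaled by the root \<open>s\<close>; the equality makes the parametrization conformal. It is a theta identity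
  in \<open>y = (z - \<omega>)/2\<close> and its conjugate \<open>x\<close>, since \<open>y - x = \<i> Im z\<close>.
\<close>

theorem speed_via_frame:
  assumes "z \<in> strip"
  shows "cmod (dG z) = 2 * Re (G z * cnj (W (Im z)))"
proof -
  define y where "y = (z - om) / 2"
  define x where "x = cnj y"
  have sy: "(z - 3 * om) / 2 = y - om" "(z + om) / 2 = y + om" "(z - om) / 2 = y"
    using shift_notation[OF y_def] y_def by simp_all
  have iw: "\<i> * of_real (Im z) = y - x"
    by (simp add: x_def y_def complex_eq_iff)
  have Ty: "T (y + om) \<noteq> 0" using strip_nonzero[OF assms] sy by simp
  have Tx: "T (x + om) \<noteq> 0" using Ty cnj_T[of "y + om"] by (auto simp: x_def)
  have Tw: "T (y - x) \<noteq> 0" using T_imaginary_nonzero[of "Im z"] assms iw by (simp add: strip_def)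
  have cG: "G z = - \<i> * scale * (T (y - om) / T (y + om))" by (simp add: G_def sy)
  then have cG': "cnj (G z) = \<i> * scale * (T (x - om) / T (x + om))"
    by (simp add: cnj_T cnj_scale x_def)
  have W: "W (Im z) = \<i> * (deriv T 0 / (2 * T2 om)) * (T2 (om - (y - x)) / T (y - x))"
    by (simp add: W_def iw)
  have "cnj (om - (y - x)) = om + (y - x)" "cnj (y - x) = - (y - x)" by (simp_all add: x_def)
  then have c: "cnj (T2 (om - (y - x))) = T2 (om + (y - x))" "cnj (T (y - x)) = - T (y - x)"
    by (simp_all only: cnj_T cnj_T2 odd)
  have "cnj (T2 om) = T2 om" "cnj (deriv T 0) = deriv T 0" by (simp_all add: cnj_T2 cnj_deriv_T)
  with c have W': "cnj (W (Im z)) = \<i> * (deriv T 0 / (2 * T2 om)) * (T2 (om + (y - x)) / T (y - x))"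
    unfolding W by (simp del: complex_cnj_diff)
  have k: "scale * (deriv T 0 / (2 * T2 om)) = T2 om / T (2 * om)"
    using constants_nonzero deriv0 by (simp add: scale_def field_simps power2_eq_square)
  have "of_real (2 * Re (G z * cnj (W (Im z)))) = G z * cnj (W (Im z)) + cnj (G z) * W (Im z)"
    by (simp add: complex_eq_iff)
  also have "\<dots> = (scale * (deriv T 0 / (2 * T2 om))) *
     ((T (y - om) / T (y + om)) * (T2 (om + (y - x)) / T (y - x))
       - (T (x - om) / T (x + om)) * (T2 (om - (y - x)) / T (y - x)))"
    unfolding cG' W' unfolding cG W by (simp add: algebra_simps)
  also have "\<dots> = (T2 om * (T (y - om) * T (x + om) * T2 (om + (y - x)) - T (x - om) * T (y + om) * T2 (om - (y - x))))
       / (T (2 * om) * T (y - x) * T (y + om) * T (x + om))"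
    unfolding k using Ty Tx Tw constants_nonzero by (simp add: divide_simps)
  also have "\<dots> = T2 y * T2 x / (T (y + om) * T (x + om))"
    unfolding theta_frame_identity using Ty Tx Tw constants_nonzero by (simp add: divide_simps)
  also have "\<dots> = of_real (cmod (dG z))"
  proof -
    have n: "of_real (cmod v ^ 2) = v * cnj v" for v using complex_norm_square[of v] by simp
    have "of_real (cmod (dG z)) = (of_real (cmod (T2 y) ^ 2) / of_real (cmod (T (y + om)) ^ 2) :: complex)"
      by (simp add: dG_def sy norm_mult norm_power norm_divide power_divide)
    then show ?thesis unfolding n by (simp add: cnj_T cnj_T2 x_def)
  qed
  finally show ?thesis using of_real_eq_iff by metis
qed

text \<open>
  The reflection \<open>u \<mapsto> \<pi> - u\<close> exchanges \<open>T\<close> and \<open>T2\<close>. The Christoffel dual of a planar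
  curve has the derivative \<open>1 / cnj dG\<close>, so up to sign the dual curve is the reflected one.
\<close>

lemma dG_reflect: "dG (of_real pi - cnj z) = 1 / cnj (dG z)"
proof -
  have 1: "(of_real pi - cnj z - om) / 2 = of_real pi / 2 - cnj ((z + om) / 2)"
       "(of_real pi - cnj z + om) / 2 = of_real pi / 2 - cnj ((z - om) / 2)"
    by (simp_all add: field_simps)
  show ?thesis unfolding dG_def 1 T_half_pi_minus
    by (simp add: cnj_T cnj_T2 power_divide divide_simps) (simp add: mult_ac)
qed

text \<open>
  On the line \<open>Re z = \<omega>\<close> numerator and denominator of \<open>G\<close> are conjugate up to sign, so \<open>G\<close> has constant
  modulus; and \<open>T2\<close> is real at the point \<open>\<i> w / 2\<close> that enters \<open>dG\<close>, so \<open>G\<close> is a real multiple of \<open>dG\<close>.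
\<close>

lemma G_on_critical_line:
  assumes "0 < w" "w < 2 * pi * Im \<tau>"
  shows "G (om + \<i> * of_real w) = - scale * (dG (om + \<i> * of_real w) / of_real (cmod (dG (om + \<i> * of_real w))))"
proof -
  define z where "z = om + \<i> * of_real w"
  define p where "p = om + \<i> * of_real w / 2"
  have strip: "z \<in> strip" using assms by (simp add: strip_def z_def)
  have s: "(z - 3 * om) / 2 = - cnj p" "(z + om) / 2 = p" "(z - om) / 2 = \<i> * of_real w / 2"
    by (simp_all add: z_def p_def field_simps)
  define t where "t = T2 (\<i> * of_real w / 2)"
  have "cnj t = t" using T2_even[of "\<i> * of_real w / 2"] by (simp add: t_def cnj_T2)
  then have tr: "t = of_real (Re t)" by (simp add: complex_eq_iff)
  have t0: "Re t \<noteq> 0" using strip_nonzero(3)[OF strip] tr unfolding s t_def[symmetric] by auto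
  have Tp: "T p \<noteq> 0" using strip_nonzero(2)[OF strip] s by simp
  have "dG z = - \<i> * (of_real (Re t) / T p)\<^sup>2" unfolding dG_def s t_def[symmetric] using tr by simp
  then have d: "dG z = - \<i> * (of_real ((Re t)\<^sup>2) / (T p)\<^sup>2)" by (simp add: power_divide)
  then have n: "cmod (dG z) = (Re t)\<^sup>2 / (cmod (T p))\<^sup>2"
    by (simp add: norm_mult norm_divide norm_power)
  have "dG z / of_real (cmod (dG z)) = - \<i> * of_real ((cmod (T p))\<^sup>2) / (T p)\<^sup>2"
    unfolding n unfolding d using t0 Tp by simp
  also have "\<dots> = - \<i> * cnj (T p) / T p"
    using complex_norm_square[of "T p"] Tp by (simp add: power2_eq_square)
  finally have e: "dG z / of_real (cmod (dG z)) = - \<i> * cnj (T p) / T p" .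
  have "G z = \<i> * scale * (cnj (T p) / T p)"
    unfolding G_def s odd by (simp add: cnj_T)
  then show ?thesis unfolding z_def[symmetric] e by simp
qed

text \<open>
  Up to a constant the quotient is \<open>(T (y - \<omega>) / T2 y)\<^sup>2\<close> with \<open>y = (z - \<omega>)/2\<close>. This is the derivative of
  a quotient of theta functions, by the formula for \<open>dG\<close> with the argument shifted by \<open>\<omega> + \<pi>/2\<close>.
\<close>

lemma primitive_G_squared:
  obtains P where "\<And>z. P (z + 2 * of_real pi) = P z"
    "\<And>z. z \<in> strip \<Longrightarrow> (P has_field_derivative (G z)\<^sup>2 / dG z) (at z)"
proof -
  define Q where "Q y = T2 (y - 2 * om) / T2 y" for y
  have Qq: "Q y = T (y - om - of_real pi / 2 - om) / T (y - om - of_real pi / 2 + om)" for y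
    using T_shift_half_pi(2)[of "y - 2 * om"] T_shift_half_pi(2)[of y]
    by (simp add: Q_def algebra_simps)
  have dQ: "(Q has_field_derivative 2 / scale * (T (y - om) / T2 y)\<^sup>2) (at y)" if "T2 y \<noteq> 0" for y
  proof -
    have nz: "T (y - om - of_real pi / 2 + om) \<noteq> 0"
      using T_shift_half_pi(2)[of y] that by (simp add: algebra_simps)
    have "((\<lambda>y. T (y - om - of_real pi / 2 - om) / T (y - om - of_real pi / 2 + om)) has_field_derivative
      2 / scale * (T2 (y - om - of_real pi / 2) / T (y - om - of_real pi / 2 + om))\<^sup>2 * 1) (at y)"
      by (rule T_quotient_has_deriv[where g = "\<lambda>y. y - om - of_real pi / 2", OF _ nz])
         (auto intro!: derivative_eq_intros)
    then show ?thesis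
      using T_shift_half_pi(2)[of y] T2_shift_half_pi(2)[of "y - om"]
      unfolding Qq[abs_def, symmetric] by (simp add: algebra_simps power_divide)
  qed
  show thesis
  proof (rule that[of "\<lambda>z. - \<i> * scale ^ 3 * Q ((z - om) / 2)"])
    fix z
    have e: "(z + 2 * of_real pi - om) / 2 = (z - om) / 2 + of_real pi"
      "(z - om) / 2 + of_real pi - 2 * om = ((z - om) / 2 - 2 * om) + of_real pi"
      by (simp_all add: field_simps)
    show "- \<i> * scale ^ 3 * Q ((z + 2 * of_real pi - om) / 2) = - \<i> * scale ^ 3 * Q ((z - om) / 2)"
      unfolding e(1) Q_def e(2) T2_shift_pi by simp
  next
    fix z assume z: "z \<in> strip"
    note nz = strip_nonzero[OF z]
    have "((\<lambda>z. - \<i> * scale ^ 3 * Q ((z - om) / 2)) has_field_derivative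
       - \<i> * scale ^ 3 * (2 / scale * (T ((z - om) / 2 - om) / T2 ((z - om) / 2))\<^sup>2 * (1 / 2))) (at z)"
      by (intro DERIV_cmult DERIV_chain2[where f = Q and g = "\<lambda>z. (z - om) / 2", OF dQ[OF nz(3)]]) (auto intro!: derivative_eq_intros)
    moreover have sy: "(z - 3 * om) / 2 = (z - om) / 2 - om" "(z + om) / 2 = (z - om) / 2 + om"
      using shift_notation[OF refl, of z] by simp_all
    have "(G z)\<^sup>2 / dG z = - \<i> * scale ^ 3 * (2 / scale * (T ((z - om) / 2 - om) / T2 ((z - om) / 2))\<^sup>2 * (1 / 2))"
      using nz(2,3) constants_nonzero unfolding G_def dG_def sy
      by (simp add: power_divide power_mult_distrib divide_simps) (simp add: power2_eq_square power3_eq_cube)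
    ultimately show "((\<lambda>z. - \<i> * scale ^ 3 * Q ((z - om) / 2)) has_field_derivative (G z)\<^sup>2 / dG z) (at z)"
      by simp
  qed
qed

text \<open>
  By the addition formula the quotient is a real affine function of \<open>(T / T2)\<^sup>2\<close>, that is, of the
  derivative of the periodic function \<open>T2' / T2\<close>. It matters that the constant \<open>b\<close> is real: only the
  imaginary part of the quotient enters the Bonnet differential, so the non-periodic term \<open>b z\<close> does not
  contribute.
\<close>

lemma primitive_G_quotient:
  obtains P and b :: real where "\<And>z. P (z + 2 * of_real pi) = P z"
    "\<And>z. z \<in> strip \<Longrightarrow> (P has_field_derivative G z / dG z - of_real b) (at z)"
proof -
  define a where "a = (deriv T2 0)\<^sup>2 + T2 0 * deriv (deriv T2) 0"
  define D where "D = (deriv T 0)\<^sup>2"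
  define Q where "Q y = deriv T2 y / T2 y" for y
  have D0: "D \<noteq> 0" using deriv0 by (simp add: D_def)
  have dd: "deriv (deriv T2) y = deriv (deriv T) (y + of_real pi / 2)" for y
  proof -
    have "deriv T2 = (\<lambda>y. deriv T (y + of_real pi / 2))" by (auto simp: deriv_T2)
    moreover have "((\<lambda>y. deriv T (y + of_real pi / 2)) has_field_derivative
        deriv (deriv T) (y + of_real pi / 2) * 1) (at y)"
      by (rule T_compose_deriv(3)) (auto intro!: derivative_eq_intros)
    ultimately show ?thesis by (metis DERIV_imp_deriv mult_1_right)
  qed
  have second: "(T2 0)\<^sup>2 * (deriv (deriv T2) y * T2 y - (deriv T2 y)\<^sup>2) = (T2 y)\<^sup>2 * a - (T y)\<^sup>2 * D" for y
    using T_second_log_deriv[of "y + of_real pi / 2"]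
    by (simp add: a_def D_def dd deriv_T2 T_shift_half_pi T2_shift_half_pi)
  have dQ: "(Q has_field_derivative (a - (T y / T2 y)\<^sup>2 * D) / (T2 0)\<^sup>2) (at y)" if "T2 y \<noteq> 0" for y
  proof -
    have "(Q has_field_derivative (deriv (deriv T2) y * T2 y - deriv T2 y * deriv T2 y) / (T2 y * T2 y)) (at y)"
      unfolding Q_def[abs_def] using that by (auto intro!: derivative_eq_intros T2_has_deriv dT2_has_deriv)
    moreover have "(deriv (deriv T2) y * T2 y - deriv T2 y * deriv T2 y) / (T2 y * T2 y) = (a - (T y / T2 y)\<^sup>2 * D) / (T2 0)\<^sup>2"
    proof -
      have "(a - (T y / T2 y)\<^sup>2 * D) / (T2 0)\<^sup>2 = ((T2 y)\<^sup>2 * a - (T y)\<^sup>2 * D) / ((T2 0)\<^sup>2 * (T2 y)\<^sup>2)"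
        using that T2_0_nonzero by (simp add: power_divide field_simps)
      also have "\<dots> = ((T2 0)\<^sup>2 * (deriv (deriv T2) y * T2 y - (deriv T2 y)\<^sup>2)) / ((T2 0)\<^sup>2 * (T2 y)\<^sup>2)"
        by (simp only: second)
      finally show ?thesis using T2_0_nonzero by (simp add: power2_eq_square)
    qed
    ultimately show ?thesis by simp
  qed
  define k1 where "k1 = - (scale * (T2 om)\<^sup>2 / D)"
  define k0 where "k0 = scale * ((T2 om)\<^sup>2 * a / D - (T om)\<^sup>2) / (T2 0)\<^sup>2"
  have "cnj k0 = k0"
    by (simp add: k0_def a_def D_def cnj_scale cnj_T cnj_T2 cnj_deriv_T cnj_deriv_T2 cnj_deriv2_T2)
  then have k0: "of_real (Re k0) = k0" by (simp add: complex_eq_iff)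
  show thesis
  proof (rule that[of "\<lambda>z. 2 * k1 * Q ((z - om) / 2)" "Re k0"])
    fix z
    have e: "(z + 2 * of_real pi - om) / 2 = (z - om) / 2 + of_real pi"
      by (simp add: field_simps)
    have "deriv T2 (y + of_real pi) = - deriv T2 y" for y
    proof -
      have "((\<lambda>y. T2 (y + of_real pi)) has_field_derivative deriv T2 (y + of_real pi) * 1) (at y)"
        by (rule T_compose_deriv(2)) (auto intro!: derivative_eq_intros)
      moreover have "((\<lambda>y. T2 (y + of_real pi)) has_field_derivative - deriv T2 y) (at y)"
        unfolding T2_shift_pi by (intro DERIV_minus T2_has_deriv)
      ultimately show ?thesis using DERIV_unique by fastforce
    qed
    then show "2 * k1 * Q ((z + 2 * of_real pi - om) / 2) = 2 * k1 * Q ((z - om) / 2)"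
      unfolding e by (simp add: Q_def T2_shift_pi)
  next
    fix z assume z: "z \<in> strip"
    note nz = strip_nonzero[OF z]
    define y where "y = (z - om) / 2"
    have "((\<lambda>z. 2 * k1 * Q ((z - om) / 2)) has_field_derivative
       2 * k1 * ((a - (T y / T2 y)\<^sup>2 * D) / (T2 0)\<^sup>2 * (1 / 2))) (at z)"
      unfolding y_def by (intro DERIV_cmult DERIV_chain2[where f = Q and g = "\<lambda>z. (z - om) / 2", OF dQ[OF nz(3)]]) (auto intro!: derivative_eq_intros)
    moreover have "2 * k1 * ((a - (T y / T2 y)\<^sup>2 * D) / (T2 0)\<^sup>2 * (1 / 2)) = G z / dG z - k0"
    proof -
      have "G z / dG z = scale * (T (y + om) * T (y - om)) / (T2 y)\<^sup>2"
        using nz(2,3) unfolding G_def dG_def shift_notation[OF y_def] y_def[symmetric]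
        by (simp add: power2_eq_square divide_simps)
      also have "\<dots> = scale * ((T y)\<^sup>2 * (T2 om)\<^sup>2 - (T2 y)\<^sup>2 * (T om)\<^sup>2) / ((T2 0)\<^sup>2 * (T2 y)\<^sup>2)"
      proof -
        have "T (y + om) * T (y - om) = ((T y)\<^sup>2 * (T2 om)\<^sup>2 - (T2 y)\<^sup>2 * (T om)\<^sup>2) / (T2 0)\<^sup>2"
          using T_addition[of y om] T2_0_nonzero by (simp add: eq_divide_eq mult.commute)
        then show ?thesis by (simp add: mult.commute)
      qed
      also have "\<dots> = 2 * k1 * ((a - (T y / T2 y)\<^sup>2 * D) / (T2 0)\<^sup>2 * (1 / 2)) + k0"
        using nz(3) T2_0_nonzero D0 by (simp add: y_def[symmetric] k1_def k0_def field_simps)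
      finally show ?thesis by simp
    qed
    ultimately show "((\<lambda>z. 2 * k1 * Q ((z - om) / 2)) has_field_derivative G z / dG z - of_real (Re k0)) (at z)"
      by (simp add: k0)
  qed
qed

text \<open>
  After multiplication by the denominators, constancy on an interval would be the vanishing of an entire
  function \<open>H\<close> of \<open>x = \<i> w / 2\<close> on a segment, hence everywhere. On the line \<open>Re z = \<pi> + \<omega>\<close> the factor
  \<open>dG\<close> degenerates in the limit \<open>w = 0\<close>, and there \<open>H\<close> is a positive multiple of \<open>T2 \<omega> ^ 2\<close>.
\<close>

lemma conformal_factor_not_constant:
  assumes e: "e \<noteq> 0" and w: "w1 < w2" "0 < w1" "w2 < 2 * pi * Im \<tau>"
  shows "\<exists>w\<in>{w1..w2}. (e\<^sup>2 + (cmod (G (of_real pi + om + \<i> * of_real w)))\<^sup>2)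
                         \<noteq> K * cmod (dG (of_real pi + om + \<i> * of_real w))"
proof (rule ccontr)
  assume "\<not> ?thesis"
  then have eq: "e\<^sup>2 + (cmod (G (of_real pi + om + \<i> * of_real w)))\<^sup>2
      = K * cmod (dG (of_real pi + om + \<i> * of_real w))" if "w \<in> {w1..w2}" for w
    using that by blast
  define H where "H x = of_real (e\<^sup>2) * (T2 (x + om) * T2 (om - x)) + scale\<^sup>2 * (T2 (x - om) * T2 (- x - om))
       - of_real K * (T x * T (- x))" for x
  have hol: "H holomorphic_on UNIV"
  proof -
    have h: "(\<lambda>x. T2 (g x)) holomorphic_on UNIV" "(\<lambda>x. T (g x)) holomorphic_on UNIV"
      if "g holomorphic_on UNIV" for g
      using holomorphic_on_compose_gen[OF that T2_holo] holomorphic_on_compose_gen[OF that holo]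
      by (simp_all add: o_def)
    show ?thesis unfolding H_def by (intro holomorphic_intros h)
  qed
  have zero: "H (\<i> * of_real w / 2) = 0" if "w \<in> {w1..w2}" for w
  proof -
    define z where "z = of_real pi + om + \<i> * of_real w"
    define x where "x = \<i> * of_real w / 2"
    have "z \<in> strip" using that w by (auto simp: z_def strip_def)
    note nz = strip_nonzero[OF this]
    have s: "(z - 3 * om) / 2 = (x - om) + of_real pi / 2" "(z + om) / 2 = (x + om) + of_real pi / 2"
      "(z - om) / 2 = x + of_real pi / 2"
      by (simp_all add: z_def x_def field_simps)
    have cx: "cnj x = - x" by (simp add: x_def)
    have n: "of_real (cmod v ^ 2) = v * cnj v" for v using complex_norm_square[of v] by simp
    have nT: "T2 (x + om) \<noteq> 0" using nz(2) unfolding s T_shift_half_pi .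
    have g: "(cmod (G z))\<^sup>2 = (cmod scale)\<^sup>2 * (cmod (T2 (x - om)))\<^sup>2 / (cmod (T2 (x + om)))\<^sup>2"
      by (simp add: G_def s T_shift_half_pi norm_mult norm_divide power_mult_distrib power_divide)
    have d: "cmod (dG z) = (cmod (T x))\<^sup>2 / (cmod (T2 (x + om)))\<^sup>2"
      by (simp add: dG_def s T_shift_half_pi T2_shift_half_pi norm_mult norm_divide norm_power power_divide)
    have "e\<^sup>2 * (cmod (T2 (x + om)))\<^sup>2 + (cmod scale)\<^sup>2 * (cmod (T2 (x - om)))\<^sup>2 - K * (cmod (T x))\<^sup>2 = 0"
      using eq[OF that] nT unfolding z_def[symmetric] g d by (simp add: field_simps)
    from arg_cong[OF this, of "of_real :: real \<Rightarrow> complex"] have "of_real (e\<^sup>2) * of_real ((cmod (T2 (x + om)))\<^sup>2) + of_real ((cmod scale)\<^sup>2) * of_real ((cmod (T2 (x - om)))\<^sup>2)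
       - of_real K * of_real ((cmod (T x))\<^sup>2) = (0 :: complex)"
      by simp
    then show ?thesis unfolding n x_def[symmetric]
      by (simp add: H_def cnj_T cnj_T2 cnj_scale cx power2_eq_square algebra_simps)
  qed
  define U where "U = (\<lambda>w. \<i> * of_real w / 2) ` {w1..w2}"
  have "\<i> * of_real w1 / 2 \<in> U" using w by (auto simp: U_def)
  moreover have "connected U" unfolding U_def
    by (intro connected_continuous_image continuous_intros) auto
  moreover have "U \<noteq> {a}" for a
  proof
    assume "U = {a}"
    then have "\<i> * of_real w / 2 = a" if "w \<in> {w1..w2}" for w using that unfolding U_def by blast
    from this[of w1] this[of w2] have "\<i> * of_real w1 / 2 = \<i> * of_real w2 / (2 :: complex)" using w by simp
    then show False using w by (auto simp: complex_eq_iff)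
  qed
  ultimately have lim: "\<i> * of_real w1 / 2 islimpt U" using connected_imp_perfect by blast
  have "H 0 = 0"
    by (rule analytic_continuation[OF hol open_UNIV connected_UNIV _ _ lim]) (auto simp: U_def zero)
  then have "of_real (e\<^sup>2 + (Re scale)\<^sup>2) * (T2 om)\<^sup>2 = 0"
    using T2_even[of om] scale_of_real
    by (simp add: H_def T_0 power2_eq_square algebra_simps) 
  then have "e\<^sup>2 + (Re scale)\<^sup>2 = 0" using constants_nonzero(1)
    by (metis mult_eq_0_iff of_real_eq_0_iff power_eq_0_iff)
  then show False using e by (simp add: add_nonneg_eq_0_iff)
qed

end

section \<open>The first theta series\<close>

definition theta_coeff :: "complex \<Rightarrow> nat \<Rightarrow> complex" where
  "theta_coeff \<tau> n = (- 1) ^ n * exp (\<i> * of_real pi * \<tau> * (of_nat n + 1 / 2)\<^sup>2)"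

text \<open>
  The part of the bilateral exponential series of \<open>\<i> \<theta>\<^sub>1\<close> with non-negative index. It is \<open>exp (\<i> x)\<close>
  times an entire power series in \<open>exp (2 \<i> x)\<close>.
\<close>

definition half_theta :: "complex \<Rightarrow> complex \<Rightarrow> complex" where
  "half_theta \<tau> x = exp (\<i> * x) * (\<Sum>n. theta_coeff \<tau> n * exp (2 * \<i> * x) ^ n)"

lemma theta_coeff_Suc:
  "theta_coeff \<tau> (Suc n) = - exp (\<i> * of_real pi * \<tau>) * exp (2 * \<i> * (of_real pi * \<tau>)) ^ n
      * exp (\<i> * of_real pi * \<tau>) * theta_coeff \<tau> n"
proof -
  have "exp (\<i> * of_real pi * \<tau> * (of_nat (Suc n) + 1 / 2)\<^sup>2)
     = exp (\<i> * of_real pi * \<tau> + of_nat n * (2 * \<i> * (of_real pi * \<tau>)) + \<i> * of_real pi * \<tau>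
         + \<i> * of_real pi * \<tau> * (of_nat n + 1 / 2)\<^sup>2)"
    by (rule arg_cong[where f = exp]) (simp add: power2_eq_square algebra_simps)
  then have e: "exp (\<i> * of_real pi * \<tau> * (of_nat (Suc n) + 1 / 2)\<^sup>2)
     = exp (\<i> * of_real pi * \<tau>) * exp (2 * \<i> * (of_real pi * \<tau>)) ^ n * exp (\<i> * of_real pi * \<tau>)
         * exp (\<i> * of_real pi * \<tau> * (of_nat n + 1 / 2)\<^sup>2)"
    by (simp only: exp_add exp_of_nat_mult)
  show ?thesis unfolding theta_coeff_def e by (simp only: power_Suc mult_ac mult_minus_left mult_minus_right mult_1_left)
qed

lemma theta_coeff_summable:
  assumes "Im \<tau> > 0"
  shows "summable (\<lambda>n. theta_coeff \<tau> n * z ^ n)"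
proof -
  define q where "q = exp (\<i> * of_real pi * \<tau>)"
  have r: "cmod (exp (2 * \<i> * (of_real pi * \<tau>))) < 1" using assms by simp
  have "(\<lambda>n. q * exp (2 * \<i> * (of_real pi * \<tau>)) ^ n * q * z) \<longlonglongrightarrow> q * 0 * q * z"
    by (intro tendsto_mult tendsto_const LIMSEQ_power_zero r)
  then have "\<forall>\<^sub>F n in sequentially. cmod (q * exp (2 * \<i> * (of_real pi * \<tau>)) ^ n * q * z) < 1 / 2"
    by (auto dest!: tendstoD[of _ _ _ "1/2"] simp: dist_norm)
  then obtain N where N: "\<And>n. n \<ge> N \<Longrightarrow> cmod (q * exp (2 * \<i> * (of_real pi * \<tau>)) ^ n * q * z) < 1 / 2"
    by (auto simp: eventually_sequentially)
  show ?thesis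
  proof (rule summable_ratio_test[of "1/2" N])
    fix n assume "n \<ge> N"
    have "theta_coeff \<tau> (Suc n) * z ^ Suc n
        = - ((q * exp (2 * \<i> * (of_real pi * \<tau>)) ^ n * q * z) * (theta_coeff \<tau> n * z ^ n))"
      unfolding theta_coeff_Suc q_def by (simp add: mult_ac)
    then have "cmod (theta_coeff \<tau> (Suc n) * z ^ Suc n)
        = cmod (q * exp (2 * \<i> * (of_real pi * \<tau>)) ^ n * q * z) * cmod (theta_coeff \<tau> n * z ^ n)"
      by (metis norm_minus_cancel norm_mult)
    also have "\<dots> \<le> 1/2 * cmod (theta_coeff \<tau> n * z ^ n)"
      using N[OF \<open>n \<ge> N\<close>] by (intro mult_right_mono) auto
    finally show "cmod (theta_coeff \<tau> (Suc n) * z ^ Suc n) \<le> 1/2 * cmod (theta_coeff \<tau> n * z ^ n)" .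
  qed simp
qed

lemma half_theta_holomorphic:
  assumes "Im \<tau> > 0"
  shows "half_theta \<tau> holomorphic_on UNIV"
proof -
  have "(\<lambda>z. \<Sum>n. theta_coeff \<tau> n * z ^ n) holomorphic_on UNIV"
    using termdiffs_strong_converges_everywhere[OF theta_coeff_summable[OF assms]]
    unfolding holomorphic_on_def field_differentiable_def by blast
  moreover have "(\<lambda>x. exp (2 * \<i> * x)) holomorphic_on UNIV" by (intro holomorphic_intros)
  ultimately have "(\<lambda>x. \<Sum>n. theta_coeff \<tau> n * exp (2 * \<i> * x) ^ n) holomorphic_on UNIV"
    using holomorphic_on_compose_gen[of "\<lambda>x. exp (2 * \<i> * x)" UNIV _ UNIV] by (simp add: o_def)
  then show ?thesis unfolding half_theta_def[abs_def] by (intro holomorphic_intros)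
qed

text \<open>
  Shifting by \<open>\<pi> \<tau>\<close> shifts the index of the series, because \<open>(n + 1/2)\<^sup>2 + 2 n + 1 = (n + 3/2)\<^sup>2 - 1\<close>. One
  boundary term is lost; in \<open>\<theta>\<^sub>1\<close> it cancels against the one from the opposite half.
\<close>

lemma half_theta_shift_up:
  assumes "Im \<tau> > 0"
  shows "half_theta \<tau> (x + of_real pi * \<tau>)
    = - exp (- (\<i> * of_real pi * \<tau>) - 2 * \<i> * x) * (half_theta \<tau> x - theta_coeff \<tau> 0 * exp (\<i> * x))"
proof -
  define q where "q = exp (\<i> * of_real pi * \<tau>)"
  define Z where "Z = exp (2 * \<i> * x)"
  define Q where "Q = exp (2 * \<i> * (of_real pi * \<tau>))"
  let ?c = "theta_coeff \<tau>"
  have nz: "q \<noteq> 0" "Z \<noteq> 0" by (simp_all add: q_def Z_def)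
  have s: "summable (\<lambda>n. ?c n * y ^ n)" for y by (rule theta_coeff_summable[OF assms])
  have sS: "summable (\<lambda>n. ?c (Suc n) * Z ^ Suc n)" using s[of Z] by (subst summable_Suc_iff)
  have tm: "?c n * (Q * Z) ^ n = - inverse (q * q * Z) * (?c (Suc n) * Z ^ Suc n)" for n
    unfolding theta_coeff_Suc q_def[symmetric] Q_def[symmetric]
    using nz by (simp add: power_mult_distrib field_simps)
  have "(\<Sum>n. ?c n * (Q * Z) ^ n) = - inverse (q * q * Z) * (\<Sum>n. ?c (Suc n) * Z ^ Suc n)"
    unfolding tm by (rule suminf_mult[OF sS])
  also have "(\<Sum>n. ?c (Suc n) * Z ^ Suc n) = (\<Sum>n. ?c n * Z ^ n) - ?c 0"
    using suminf_split_head[OF s[of Z]] by simp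
  finally have *: "(\<Sum>n. ?c n * (Q * Z) ^ n) = - inverse (q * q * Z) * ((\<Sum>n. ?c n * Z ^ n) - ?c 0)" .
  have e: "exp (\<i> * (x + of_real pi * \<tau>)) = q * exp (\<i> * x)"
    "exp (2 * \<i> * (x + of_real pi * \<tau>)) = Q * Z"
    "exp (- (\<i> * of_real pi * \<tau>) - 2 * \<i> * x) = inverse (q * Z)"
    by (simp_all add: q_def Q_def Z_def distrib_left exp_add exp_diff exp_minus mult_ac divide_inverse)
  show ?thesis unfolding half_theta_def e * Z_def[symmetric]
    using nz by (simp add: field_simps)
qed

lemma half_theta_shift_down:
  assumes "Im \<tau> > 0"
  shows "half_theta \<tau> (x - of_real pi * \<tau>)
    = theta_coeff \<tau> 0 * exp (- (\<i> * of_real pi * \<tau>) + \<i> * x)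
      - exp (- (\<i> * of_real pi * \<tau>) + 2 * \<i> * x) * half_theta \<tau> x"
proof -
  have "half_theta \<tau> x = - exp (- (\<i> * of_real pi * \<tau>) - 2 * \<i> * (x - of_real pi * \<tau>))
     * (half_theta \<tau> (x - of_real pi * \<tau>) - theta_coeff \<tau> 0 * exp (\<i> * (x - of_real pi * \<tau>)))"
    using half_theta_shift_up[OF assms, of "x - of_real pi * \<tau>"] by simp
  then have "- exp (- (\<i> * of_real pi * \<tau>) + 2 * \<i> * x) * half_theta \<tau> x
     = (exp (- (\<i> * of_real pi * \<tau>) + 2 * \<i> * x) * exp (- (\<i> * of_real pi * \<tau>) - 2 * \<i> * (x - of_real pi * \<tau>)))
     * (half_theta \<tau> (x - of_real pi * \<tau>) - theta_coeff \<tau> 0 * exp (\<i> * (x - of_real pi * \<tau>)))"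
    by simp
  also have "exp (- (\<i> * of_real pi * \<tau>) + 2 * \<i> * x) * exp (- (\<i> * of_real pi * \<tau>) - 2 * \<i> * (x - of_real pi * \<tau>)) = 1"
    unfolding exp_add[symmetric] by (simp add: algebra_simps)
  also have "exp (\<i> * (x - of_real pi * \<tau>)) = exp (- (\<i> * of_real pi * \<tau>) + \<i> * x)"
    by (rule arg_cong[where f = exp]) (simp add: algebra_simps)
  finally show ?thesis by (simp add: algebra_simps)
qed

lemma theta1_terms_sums:
  assumes "Im \<tau> > 0"
  shows "(\<lambda>n. (- 1) ^ n * exp (\<i> * of_real pi * \<tau> * (of_nat n + 1 / 2)\<^sup>2) * sin (of_nat (2 * n + 1) * x))
           sums (- \<i> / 2 * (half_theta \<tau> x - half_theta \<tau> (- x)))"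
proof -
  let ?c = "theta_coeff \<tau>"
  have s: "summable (\<lambda>n. ?c n * y ^ n)" for y by (rule theta_coeff_summable[OF assms])
  have sn: "sin (of_nat (2 * n + 1) * x)
      = - \<i> / 2 * (exp (\<i> * x) * exp (2 * \<i> * x) ^ n - exp (\<i> * - x) * exp (2 * \<i> * - x) ^ n)" for n
  proof -
    have "exp (\<i> * (of_nat (2 * n + 1) * y)) = exp (\<i> * y) * exp (2 * \<i> * y) ^ n" for y
      unfolding exp_of_nat_mult[symmetric] exp_add[symmetric]
      by (rule arg_cong[where f = exp]) (simp add: algebra_simps)
    from this[of x] this[of "- x"] show ?thesis
      unfolding sin_exp_eq by (simp add: field_simps)
  qed
  have e': "(\<lambda>n. exp (\<i> * y) * (?c n * exp (2 * \<i> * y) ^ n)) sums half_theta \<tau> y" for y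
    unfolding half_theta_def by (intro sums_mult summable_sums s)
  have "(\<lambda>n. - \<i> / 2 * (exp (\<i> * x) * (?c n * exp (2 * \<i> * x) ^ n)
        - exp (\<i> * - x) * (?c n * exp (2 * \<i> * - x) ^ n)))
      sums (- \<i> / 2 * (half_theta \<tau> x - half_theta \<tau> (- x)))"
    by (intro sums_mult sums_diff e')
  moreover have "- \<i> / 2 * (exp (\<i> * x) * (?c n * exp (2 * \<i> * x) ^ n)
        - exp (\<i> * - x) * (?c n * exp (2 * \<i> * - x) ^ n))
      = (- 1) ^ n * exp (\<i> * of_real pi * \<tau> * (of_nat n + 1 / 2)\<^sup>2) * sin (of_nat (2 * n + 1) * x)" for n
    unfolding sn theta_coeff_def by (simp add: algebra_simps)
  ultimately show ?thesis by simp
qed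

lemma theta1_via_half_theta:
  assumes "Im \<tau> > 0"
  shows "theta1 \<tau> x = - \<i> * (half_theta \<tau> x - half_theta \<tau> (- x))"
  unfolding theta1_def sums_unique[OF theta1_terms_sums[OF assms, of x], symmetric] by simp

lemma theta2_eq_theta1: "theta2 \<tau> x = theta1 \<tau> (x + of_real pi / 2)"
proof -
  have c: "cos (y + of_nat n * of_real pi) = (- 1) ^ n * cos y" for n and y :: complex
  proof (induction n)
    case (Suc n)
    have "y + of_nat (Suc n) * of_real pi = (y + of_nat n * of_real pi) + of_real pi"
      by (simp add: algebra_simps)
    moreover have "cos (z + of_real pi) = - cos z" for z :: complex
      by (simp add: cos_add sin_of_real cos_of_real)
    ultimately have "cos (y + of_nat (Suc n) * of_real pi) = - cos (y + of_nat n * of_real pi)"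
      by (simp only:)
    then show ?case using Suc by simp
  qed simp
  have "(- 1) ^ n * exp a * sin (of_nat (2 * n + 1) * (x + of_real pi / 2)) = exp a * cos (of_nat (2 * n + 1) * x)" for n and a :: complex
  proof -
    have "sin (of_nat (2 * n + 1) * (x + of_real pi / 2)) = sin (of_real pi / 2 - (- (of_nat (2 * n + 1) * x + of_nat n * of_real pi)))"
      by (rule arg_cong[where f = sin]) (simp add: field_simps)
    also have "\<dots> = cos (of_nat (2 * n + 1) * x + of_nat n * of_real pi)"
      by (simp only: cos_sin_eq[symmetric] cos_minus)
    finally have sn: "sin (of_nat (2 * n + 1) * (x + of_real pi / 2)) = (- 1) ^ n * cos (of_nat (2 * n + 1) * x)"
      by (simp only: c)
    have "(- 1) ^ n * exp a * ((- 1) ^ n * X) = ((- 1) ^ n * (- 1) ^ n) * (exp a * X)" for X :: complex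
      by (simp only: mult_ac)
    moreover have "(- 1) ^ n * (- 1) ^ n = (1 :: complex)" by (simp flip: power_mult_distrib)
    ultimately show ?thesis unfolding sn by simp
  qed
  then show ?thesis unfolding theta1_def theta2_def by (simp only:)
qed

text \<open>
  For \<open>Re \<tau> = 1/2\<close> the phase of \<open>exp (\<i> \<pi> \<tau> (n + 1/2)\<^sup>2)\<close> is \<open>\<pi>/8 + \<pi> n (n + 1)/2\<close>, where \<open>n (n + 1)/2\<close> is an
  integer. The factor \<open>exp (- \<i> \<pi> / 8)\<close> therefore makes all coefficients real.
\<close>

lemma real_theta_theta1:
  assumes tau: "Im \<tau> > 0" "Re \<tau> = 1 / 2" and d: "deriv (theta1 \<tau>) 0 \<noteq> 0"
  defines "K \<equiv> exp (- (\<i> * of_real (pi / 8)))"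
  shows "real_theta \<tau> (\<lambda>x. K * theta1 \<tau> x)"
proof unfold_locales
  have K0: "K \<noteq> 0" by (simp add: K_def)
  have th: "theta1 \<tau> = (\<lambda>x. - \<i> * (half_theta \<tau> x - half_theta \<tau> (- x)))"
    using theta1_via_half_theta[OF tau(1)] by auto
  have "(\<lambda>x. half_theta \<tau> (- x)) holomorphic_on UNIV"
    using holomorphic_on_compose_gen[OF _ half_theta_holomorphic[OF tau(1)], of uminus UNIV]
    by (simp add: o_def holomorphic_on_minus)
  then have hol: "theta1 \<tau> holomorphic_on UNIV"
    unfolding th by (intro holomorphic_intros half_theta_holomorphic[OF tau(1)])
  show "Im \<tau> > 0" "Re \<tau> = 1 / 2" by fact+
  show "(\<lambda>x. K * theta1 \<tau> x) holomorphic_on UNIV" by (intro holomorphic_intros hol)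
  show "K * theta1 \<tau> (- x) = - (K * theta1 \<tau> x)" for x by (simp add: th algebra_simps)
  have hp: "half_theta \<tau> (x + of_real pi) = - half_theta \<tau> x" for x
    by (simp add: half_theta_def distrib_left exp_add mult_ac exp_two_pi_i')
  show "K * theta1 \<tau> (x + of_real pi) = - (K * theta1 \<tau> x)" for x
    using hp[of x] hp[of "- x - of_real pi"] by (simp add: th algebra_simps)
  show "K * theta1 \<tau> (x + of_real pi * \<tau>)
      = - exp (- (\<i> * of_real pi * \<tau>) - 2 * \<i> * x) * (K * theta1 \<tau> x)" for x
  proof -
    have "half_theta \<tau> (- (x + of_real pi * \<tau>)) = half_theta \<tau> (- x - of_real pi * \<tau>)" by simp
    also have "\<dots> = theta_coeff \<tau> 0 * exp (- (\<i> * of_real pi * \<tau>) - \<i> * x)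
      - exp (- (\<i> * of_real pi * \<tau>) - 2 * \<i> * x) * half_theta \<tau> (- x)"
      using half_theta_shift_down[OF tau(1), of "- x"] by simp
    finally have 2: "half_theta \<tau> (- (x + of_real pi * \<tau>)) = \<dots>" .
    have "exp (- (\<i> * of_real pi * \<tau>) - \<i> * x) = exp (- (\<i> * of_real pi * \<tau>) - 2 * \<i> * x) * exp (\<i> * x)"
      unfolding exp_add[symmetric] by (rule arg_cong[where f = exp]) (simp add: algebra_simps)
    then show ?thesis unfolding th 2 half_theta_shift_up[OF tau(1)]
      by (simp add: algebra_simps)
  qed
  have "((\<lambda>x. K * theta1 \<tau> x) has_field_derivative K * deriv (theta1 \<tau>) 0) (at 0)"
    using hol holomorphic_derivI by (intro DERIV_cmult) blast
  then show "deriv (\<lambda>x. K * theta1 \<tau> x) 0 \<noteq> 0"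
    using d K0 by (simp add: DERIV_imp_deriv)
  show "cnj (K * theta1 \<tau> x) = K * theta1 \<tau> (cnj x)" for x
  proof -
    define r where "r n = (- 1) ^ n * exp (\<i> * of_real pi * \<tau> * (of_nat n + 1 / 2)\<^sup>2) * K" for n
    have real: "cnj (r n) = r n" for n
    proof -
      have "even (n * Suc n)" by simp
      then obtain m where m: "n * Suc n = 2 * m" by (rule evenE)
      have "\<i> * of_real pi * \<tau> * (of_nat n + 1 / 2)\<^sup>2 - \<i> * of_real (pi / 8)
         = of_nat n * of_nat (Suc n) / 2 * (\<i> * of_real pi) + of_real (- pi * Im \<tau> * (real n + 1 / 2)\<^sup>2)"
        by (simp add: complex_eq_iff power2_eq_square tau(2)) (simp add: field_simps)
      also have "of_nat n * of_nat (Suc n) / 2 = (of_nat m :: complex)"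
        using arg_cong[OF m, of "of_nat :: nat \<Rightarrow> complex"] by (simp add: algebra_simps)
      finally have "exp (\<i> * of_real pi * \<tau> * (of_nat n + 1 / 2)\<^sup>2) * K
          = exp (\<i> * of_real pi) ^ m * exp (of_real (- pi * Im \<tau> * (real n + 1 / 2)\<^sup>2))"
        unfolding K_def exp_add[symmetric] exp_of_nat_mult[symmetric] by simp
      also have "\<dots> = of_real ((- 1) ^ m * exp (- pi * Im \<tau> * (real n + 1 / 2)\<^sup>2))"
        unfolding exp_of_real by simp
      finally have "r n = of_real ((- 1) ^ n * ((- 1) ^ m * exp (- pi * Im \<tau> * (real n + 1 / 2)\<^sup>2)))"
        unfolding r_def mult.assoc by simp
      then show ?thesis by (simp only: complex_cnj_complex_of_real)
    qed
    have K: "(\<lambda>n. 2 * (r n * sin (of_nat (2 * n + 1) * y))) sums (K * theta1 \<tau> y)" for y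
    proof -
      have e: "K * theta1 \<tau> y = 2 * K * (- \<i> / 2 * (half_theta \<tau> y - half_theta \<tau> (- y)))"
        unfolding theta1_via_half_theta[OF tau(1)] by simp
      have t: "2 * (r n * sin (of_nat (2 * n + 1) * y)) = 2 * K *
          ((- 1) ^ n * exp (\<i> * of_real pi * \<tau> * (of_nat n + 1 / 2)\<^sup>2) * sin (of_nat (2 * n + 1) * y))" for n
        unfolding r_def by (simp only: mult_ac)
      show ?thesis unfolding e t by (intro sums_mult theta1_terms_sums tau)
    qed
    have "(\<lambda>n. cnj (2 * (r n * sin (of_nat (2 * n + 1) * x)))) sums cnj (K * theta1 \<tau> x)"
      using K[of x] by (simp only: sums_cnj)
    moreover have "cnj (2 * (r n * sin (of_nat (2 * n + 1) * x))) = 2 * (r n * sin (of_nat (2 * n + 1) * cnj x))" for n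
      by (simp add: real cnj_sin)
    ultimately show ?thesis using K[of "cnj x"] sums_unique2 by simp
  qed
qed

section \<open>Rotations by unit quaternions\<close>

lemma norm_quat: "(norm (q :: quat))\<^sup>2 = (cmod (fst q))\<^sup>2 + (cmod (snd q))\<^sup>2"
  by (simp add: norm_prod_def)

lemma norm_qmult: "norm (p \<odot> q) = norm p * norm q"
proof -
  have "(norm (p \<odot> q))\<^sup>2 = (norm p * norm q)\<^sup>2"
    unfolding power_mult_distrib norm_quat
    by (simp add: qmult_def cmod_power2) (simp add: power2_eq_square algebra_simps)
  then show ?thesis by (simp add: power2_eq_iff_nonneg)
qed

lemma bounded_bilinear_qmult: "bounded_bilinear (\<odot>)"
proof
  show "\<exists>K. \<forall>a b. norm (a \<odot> b) \<le> norm a * norm b * K"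
    by (rule exI[of _ 1]) (simp add: norm_qmult)
qed (simp_all add: qmult_def prod_eq_iff algebra_simps)

lemmas qmult_linear =
  bounded_bilinear.add_left[OF bounded_bilinear_qmult]
  bounded_bilinear.add_right[OF bounded_bilinear_qmult]
  bounded_bilinear.diff_left[OF bounded_bilinear_qmult]
  bounded_bilinear.diff_right[OF bounded_bilinear_qmult]
  bounded_bilinear.minus_left[OF bounded_bilinear_qmult]
  bounded_bilinear.minus_right[OF bounded_bilinear_qmult]
  bounded_bilinear.scaleR_left[OF bounded_bilinear_qmult]
  bounded_bilinear.scaleR_right[OF bounded_bilinear_qmult]

lemma qreal_pair: "qreal r = (of_real r, 0)"
  by (simp add: qreal_def qcomplex_def)

lemma qreal_mult: "qreal r \<odot> q = r *\<^sub>R q" "q \<odot> qreal r = r *\<^sub>R q"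
  by (simp_all add: qreal_pair qmult_def prod_eq_iff complex_eq_iff)

lemma norm_qconj: "norm (qconj q) = norm q"
  by (simp add: qconj_def norm_prod_def)

lemma bounded_linear_qconj: "bounded_linear qconj"
  by (rule bounded_linear_intro[where K = 1])
     (auto simp: norm_qconj, auto simp: qconj_def prod_eq_iff)

lemma qconj_qmult: "qconj (p \<odot> q) = qconj q \<odot> qconj p"
  by (simp add: qconj_def qmult_def algebra_simps)

lemma qconj_self: "qconj q \<odot> q = qreal ((norm q)\<^sup>2)" "q \<odot> qconj q = qreal ((norm q)\<^sup>2)"
  unfolding norm_quat qreal_pair
  by (simp_all add: qconj_def qmult_def prod_eq_iff complex_eq_iff cmod_power2)
     (simp_all add: power2_eq_square algebra_simps)

lemma unit_qconj:
  assumes "norm q = 1"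
  shows "qconj q \<odot> q = qreal 1" "q \<odot> qconj q = qreal 1" "qinv q = qconj q"
  using assms by (simp_all add: qconj_self qinv_def)

lemma unit_cancel:
  assumes "norm q = 1"
  shows "qconj q \<odot> (q \<odot> x) = x" "q \<odot> (qconj q \<odot> x) = x"
  using unit_qconj[OF assms] by (simp_all add: qreal_mult flip: qmult_assoc)

definition rot :: "quat \<Rightarrow> quat \<Rightarrow> quat" where "rot q x = qconj q \<odot> x \<odot> q"

lemma bounded_linear_rot: "bounded_linear (rot q)"
  unfolding rot_def[abs_def]
  by (intro bounded_linear_compose[OF bounded_bilinear.bounded_linear_left[OF bounded_bilinear_qmult]]
        bounded_bilinear.bounded_linear_right[OF bounded_bilinear_qmult])

lemma rot_linear:
  "rot q (x + y) = rot q x + rot q y" "rot q (x - y) = rot q x - rot q y"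
  "rot q (- x) = - rot q x" "rot q (r *\<^sub>R x) = r *\<^sub>R rot q x"
  by (simp_all add: rot_def qmult_linear)

lemma rot_rot: "rot (p \<odot> q) x = rot q (rot p x)"
  by (simp add: rot_def qconj_qmult qmult_assoc)

lemma rot_qmult: "norm q = 1 \<Longrightarrow> rot q (x \<odot> y) = rot q x \<odot> rot q y"
  by (simp add: rot_def qmult_assoc unit_cancel)

lemma rot_qreal: "norm q = 1 \<Longrightarrow> rot q (qreal r) = qreal r"
  by (simp add: rot_def qreal_mult qmult_linear unit_qconj) (simp add: qreal_pair prod_eq_iff complex_eq_iff)

lemma norm_rot: "norm q = 1 \<Longrightarrow> norm (rot q x) = norm x"
  by (simp add: rot_def norm_qmult norm_qconj)

lemma rot_eq_self_iff: "norm q = 1 \<Longrightarrow> rot q x = x \<longleftrightarrow> x \<odot> q = q \<odot> x"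
  unfolding rot_def by (metis qmult_assoc unit_cancel)

lemma rot_inject: "norm q = 1 \<Longrightarrow> rot q x = rot q y \<longleftrightarrow> x = y"
  using norm_rot[of q "x - y"] by (simp add: rot_linear) (metis norm_eq_zero right_minus_eq)

lemma Re_fst_rot: "norm q = 1 \<Longrightarrow> Re (fst (rot q x)) = Re (fst x)"
proof -
  assume q: "norm q = 1"
  have "x = qreal (Re (fst x)) + (\<i> * of_real (Im (fst x)), snd x)"
    by (simp add: qreal_pair prod_eq_iff complex_eq_iff)
  moreover have "Re (fst (rot q (\<i> * of_real b, z))) = 0" for b z
    by (simp add: rot_def qmult_def qconj_def algebra_simps)
  ultimately show ?thesis using q
    by (metis Re_complex_of_real add.right_neutral fst_add fst_conv plus_complex.simps(1) qreal_pair rot_linear(1) rot_qreal)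
qed

lemma inner_via_qmult: "p \<bullet> q = Re (fst (p \<odot> qconj (q :: quat)))"
  by (simp add: inner_prod_def inner_complex_def qmult_def qconj_def)

lemma rot_qconj: "norm q = 1 \<Longrightarrow> rot q (qconj x) = qconj (rot q x)"
proof -
  have "qconj (qconj q) = q" by (simp add: qconj_def)
  then show ?thesis by (simp add: rot_def qconj_qmult qmult_assoc)
qed

lemma inner_rot: "norm q = 1 \<Longrightarrow> rot q x \<bullet> rot q y = x \<bullet> y"
  by (simp add: inner_via_qmult Re_fst_rot flip: rot_qconj rot_qmult)

lemma bounded_linear_vecH: "bounded_linear vecH"
proof -
  have "linear vecH"
    by (rule linearI) (simp_all add: vecH_def vec_eq_iff forall_3)
  then show ?thesis by (simp add: linear_conv_bounded_linear)
qed

lemma bounded_linear_imH: "bounded_linear imH"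
proof -
  have "linear imH"
    by (rule linearI) (simp_all add: imH_def prod_eq_iff complex_eq_iff)
  then show ?thesis by (simp add: linear_conv_bounded_linear)
qed

lemmas vecH_linear = linear_add[OF bounded_linear.linear[OF bounded_linear_vecH]]
  linear_diff[OF bounded_linear.linear[OF bounded_linear_vecH]]
  linear_scale[OF bounded_linear.linear[OF bounded_linear_vecH]]
  linear_neg[OF bounded_linear.linear[OF bounded_linear_vecH]]
  linear_0[OF bounded_linear.linear[OF bounded_linear_vecH]]

lemmas imH_linear = linear_add[OF bounded_linear.linear[OF bounded_linear_imH]]
  linear_diff[OF bounded_linear.linear[OF bounded_linear_imH]]
  linear_scale[OF bounded_linear.linear[OF bounded_linear_imH]]
  linear_neg[OF bounded_linear.linear[OF bounded_linear_imH]]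
  linear_0[OF bounded_linear.linear[OF bounded_linear_imH]]

lemma Re_fst_imH: "Re (fst (imH x)) = 0"
  by (simp add: imH_def)

lemma inner_imH: "imH x \<bullet> imH y = x \<bullet> y"
  by (simp add: imH_def inner_prod_def inner_complex_def inner_vec_def sum_3)

lemma imH_inject: "imH x = imH y \<longleftrightarrow> x = y"
  by (metis vecH_imH)

lemma imH_rot_vecH: "norm q = 1 \<Longrightarrow> Re (fst x) = 0 \<Longrightarrow> imH (vecH (rot q x)) = rot q x"
  by (simp add: imH_vecH Re_fst_rot)

lemma inner_vecH: "Re (fst x) = 0 \<Longrightarrow> Re (fst y) = 0 \<Longrightarrow> vecH x \<bullet> vecH y = x \<bullet> y"
  using inner_imH[of "vecH x" "vecH y"] by (simp add: imH_vecH)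

lemma imH_qmult: "imH x \<odot> imH y = imH (cross3 x y) - qreal (x \<bullet> y)"
  by (simp add: imH_def qmult_def qreal_pair cross3_def inner_vec_def sum_3 vector_3 prod_eq_iff complex_eq_iff
      algebra_simps)

lemma imH_commute_iff: "imH x \<odot> imH y = imH y \<odot> imH x \<longleftrightarrow> cross3 x y = 0"
proof -
  have "imH x \<odot> imH y - imH y \<odot> imH x = imH (2 *\<^sub>R cross3 x y)"
    unfolding imH_qmult using cross_skew[of y x] by (simp add: imH_linear inner_commute)
      (simp add: scaleR_2)
  then show ?thesis
    by (metis imH_linear(5) imH_inject right_minus_eq scaleR_eq_0_iff zero_neq_numeral)
qed

text \<open>\<open>rotation M\<close> is the rotation of three-space induced by a unit quaternion.\<close>

definition rotation :: "quat \<Rightarrow> real^3 \<Rightarrow> real^3" where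
  "rotation M x = vecH (rot M (imH x))"

lemma bounded_linear_rotation: "bounded_linear (rotation M)"
  unfolding rotation_def[abs_def]
  by (intro bounded_linear_compose[OF bounded_linear_vecH] bounded_linear_compose[OF bounded_linear_rot]
        bounded_linear_imH)

lemma imH_rotation: "norm M = 1 \<Longrightarrow> imH (rotation M x) = rot M (imH x)"
  by (simp add: rotation_def imH_rot_vecH Re_fst_imH)

lemma rotation_vecH_rot:
  "norm q = 1 \<Longrightarrow> Re (fst x) = 0 \<Longrightarrow> rotation M (vecH (rot q x)) = vecH (rot (q \<odot> M) x)"
  by (simp add: rotation_def rot_rot imH_rot_vecH)

lemma inner_rotation: "norm M = 1 \<Longrightarrow> rotation M x \<bullet> rotation M y = x \<bullet> y"
  by (metis inner_imH imH_rotation inner_rot)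

definition axis_angle :: "real^3 \<Rightarrow> real \<Rightarrow> quat" where
  "axis_angle A t = qreal (cos t) + sin t *\<^sub>R imH A"

lemma axis_angle_mult:
  assumes "norm A = 1"
  shows "axis_angle A a \<odot> axis_angle A b = axis_angle A (a + b)"
proof -
  have "A \<bullet> A = 1" using assms by (simp add: norm_eq_1)
  then have "imH A \<odot> imH A = - qreal 1" by (simp add: imH_qmult imH_linear)
  then show ?thesis
    by (simp add: axis_angle_def qmult_linear qreal_mult cos_add sin_add)
       (simp add: qreal_pair prod_eq_iff complex_eq_iff algebra_simps)
qed

lemma norm_axis_angle:
  assumes "norm A = 1"
  shows "norm (axis_angle A t) = 1"
proof -
  have "qconj (axis_angle A t) = axis_angle A (- t)"
    by (simp add: axis_angle_def qconj_def qreal_pair imH_def prod_eq_iff complex_eq_iff)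
  then have "qreal ((norm (axis_angle A t))\<^sup>2) = axis_angle A (- t) \<odot> axis_angle A t"
    by (metis qconj_self(1))
  also have "\<dots> = qreal 1"
    unfolding axis_angle_mult[OF assms] by (simp add: axis_angle_def imH_linear)
  finally have "(norm (axis_angle A t))\<^sup>2 = 1" by (simp add: qreal_pair del: of_real_power)
  then show ?thesis by (simp add: power2_eq_1_iff) (metis norm_ge_zero neg_0_le_iff_le not_one_le_zero)
qed

text \<open>
  The sign \<open>\<sigma>\<close> absorbs that a unit quaternion and its negative induce the same rotation.
\<close>

lemma axis_angle_fixes_iff:
  assumes A: "norm A = 1" and \<sigma>: "\<bar>\<sigma>\<bar> = 1" and t: "sin t \<noteq> 0"
  shows "rotation (\<sigma> *\<^sub>R axis_angle A t) x = x \<longleftrightarrow> cross3 A x = 0"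
proof -
  let ?M = "\<sigma> *\<^sub>R axis_angle A t"
  have M: "norm ?M = 1" using \<sigma> norm_axis_angle[OF A] by simp
  have "rotation ?M x = x \<longleftrightarrow> rot ?M (imH x) = imH x"
    using imH_rotation[OF M] imH_inject by metis
  also have "\<dots> \<longleftrightarrow> imH x \<odot> ?M = ?M \<odot> imH x" by (rule rot_eq_self_iff[OF M])
  also have "\<dots> \<longleftrightarrow> imH x \<odot> imH A = imH A \<odot> imH x"
    using t \<sigma> by (auto simp: axis_angle_def qmult_linear qreal_mult)
  also have "\<dots> \<longleftrightarrow> cross3 A x = 0" using imH_commute_iff[of A x] by metis
  finally show ?thesis .
qed

lemma inner_axis_rotation:
  assumes A: "norm A = 1" and \<sigma>: "\<bar>\<sigma>\<bar> = 1"
  shows "A \<bullet> rotation (\<sigma> *\<^sub>R axis_angle A t) x = A \<bullet> x"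
proof -
  let ?M = "\<sigma> *\<^sub>R axis_angle A t"
  have M: "norm ?M = 1" using \<sigma> norm_axis_angle[OF A] by simp
  have "imH A \<odot> ?M = ?M \<odot> imH A" by (simp add: axis_angle_def qmult_linear qreal_mult)
  then have "rotation ?M A = A"
    using rot_eq_self_iff[OF M] imH_rotation[OF M] imH_inject by metis
  then show ?thesis using inner_rotation[OF M, of A x] by simp
qed

text \<open>
  The Bonnet differential in vector form, used where \<open>f\<close> is tangential and orthogonal to \<open>x\<close>: only the
  first and the last term survive there.
\<close>

lemma bonnet_vector_form:
  "vecH ((qreal c - imH f) \<odot> imH x \<odot> (qreal c + imH f))
     = (c\<^sup>2 - f \<bullet> f) *\<^sub>R x + (2 * (f \<bullet> x)) *\<^sub>R f + (2 * c) *\<^sub>R cross3 x f"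
  by (simp add: imH_def qmult_def qreal_pair cross3_def inner_vec_def sum_3 vecH_def vec_eq_iff forall_3)
     (simp add: power2_eq_square algebra_simps)

section \<open>Incommensurable periods\<close>

text \<open>
  By Dirichlet's theorem the integer combinations of the two periods contain arbitrarily small nonzero
  numbers, all of them periods.
\<close>

lemma incommensurable_periods_constant:
  fixes g :: "real \<Rightarrow> real"
  assumes cont: "continuous_on UNIV g" and a: "\<And>x. g (x + a) = g x" and b: "\<And>x. g (x + b) = g x"
    and pos: "a > 0" "b > 0" and irr: "a / b \<notin> \<rat>"
  shows "g x = g y"
proof -
  have ia: "g (z + of_int k * a) = g z" for z and k :: int
    using a by (induction k arbitrary: z rule: int_induct[where k = 0])
      (simp_all add: distrib_right left_diff_distrib flip: add.assoc, metis diff_add_cancel add_diff_eq)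
  have ib: "g (z + of_int k * b) = g z" for z and k :: int
    using b by (induction k arbitrary: z rule: int_induct[where k = 0])
      (simp_all add: distrib_right left_diff_distrib flip: add.assoc, metis diff_add_cancel add_diff_eq)
  have "\<bar>g x - g y\<bar> < e" if "e > 0" for e
  proof -
    obtain d where d: "d > 0" "\<And>z. \<bar>z - y\<bar> < d \<Longrightarrow> \<bar>g z - g y\<bar> < e"
      using cont \<open>e > 0\<close> unfolding continuous_on_iff dist_real_def by (metis UNIV_I)
    obtain N where N: "real N > b / d" using reals_Archimedean2 by blast
    have "N > 0" using N pos d by (metis divide_pos_pos gr0I less_asym of_nat_0)
    then obtain h k :: int where hk: "0 < k" "\<bar>of_int k * (a / b) - of_int h\<bar> < 1 / N"
      using Dirichlet_approx by blast
    define p where "p = of_int k * a - of_int h * b"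
    have "p \<noteq> 0"
    proof
      assume "p = 0"
      then have "a / b = of_int h / of_int k" using pos hk by (simp add: p_def field_simps)
      then show False using irr by simp
    qed
    have "\<bar>p\<bar> = \<bar>of_int k * (a / b) - of_int h\<bar> * b"
      using pos by (simp add: p_def abs_mult[symmetric] field_simps flip: abs_mult_pos)
    also have "\<dots> < 1 / N * b" using hk pos by (intro mult_strict_right_mono) auto
    also have "\<dots> < d" using N d \<open>N > 0\<close> by (simp add: field_simps)
    finally have pd: "\<bar>p\<bar> < d" .
    have per: "g (z + of_int j * p) = g z" for z j
    proof -
      have "z + of_int j * p = (z + of_int (j * k) * a) + of_int (- (j * h)) * b"
        by (simp add: p_def algebra_simps)
      then show ?thesis by (simp only: ia ib)
    qed
    define j where "j = \<lfloor>(x - y) / \<bar>p\<bar>\<rfloor>"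
    have "of_int j \<le> (x - y) / \<bar>p\<bar>" "(x - y) / \<bar>p\<bar> < of_int j + 1" by (simp_all add: j_def)
    then have "0 \<le> x - y - of_int j * \<bar>p\<bar>" "x - y - of_int j * \<bar>p\<bar> < \<bar>p\<bar>"
      using \<open>p \<noteq> 0\<close> by (simp_all add: pos_le_divide_eq pos_divide_less_eq algebra_simps)
    then have "\<bar>(x - of_int j * \<bar>p\<bar>) - y\<bar> < d" using pd by linarith
    then have "\<bar>g (x - of_int j * \<bar>p\<bar>) - g y\<bar> < e" by (rule d)
    moreover have "g (x - of_int j * \<bar>p\<bar>) = g x"
      using per[of x "- j"] per[of x j] by (cases "p \<ge> 0") simp_all
    ultimately show ?thesis by simp
  qed
  then show ?thesis by (metis abs_eq_0 eq_iff_diff_eq_0 less_irrefl zero_less_abs_iff)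
qed

section \<open>The isothermic cylinder in its moving frame\<close>

text \<open>
  The frame equation in pairs of complex numbers: \<open>W k = (0, \<i> W)\<close> for complex \<open>W\<close>.
\<close>

locale framed_cylinder = planar_curves +
  fixes w s :: "real \<Rightarrow> real" and \<Phi> :: "real \<Rightarrow> quat"
  assumes w_range: "\<And>v. 0 < w v" "\<And>v. w v < 2 * pi * Im \<tau>"
    and w_deriv: "\<And>v. (w has_real_derivative deriv w v) (at v)"
    and s_cont: "continuous_on UNIV s"
    and s_sq: "\<And>v. (s v)\<^sup>2 = 1 - (deriv w v)\<^sup>2"
    and unit: "\<And>v. norm (\<Phi> v) = 1"
    and frame: "\<And>v. (\<Phi> has_vector_derivative (s v *\<^sub>R (0, \<i> * W (w v))) \<odot> \<Phi> v) (at v)"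
begin

definition pos :: "real \<Rightarrow> real \<Rightarrow> complex" where "pos u v = of_real u + \<i> * of_real (w v)"

lemma pos_strip: "pos u v \<in> strip"
  using w_range[of v] by (simp add: pos_def strip_def)

lemma dG_pos: "dG (pos u v) \<noteq> 0" "cmod (dG (pos u v)) > 0"
  using dG_nonzero[OF pos_strip] by simp_all

definition cyl :: "real \<times> real \<Rightarrow> real^3" where
  "cyl = (\<lambda>(u, v). vecH (rot (\<Phi> v) (0, G (pos u v))))"

lemma imH_cyl: "imH (cyl (u, v)) = rot (\<Phi> v) (0, G (pos u v))"
  by (simp add: cyl_def imH_rot_vecH unit)

lemma pos_deriv_u: "((\<lambda>u. pos u v) has_vector_derivative 1) (at u)"
  unfolding pos_def by (auto intro!: derivative_eq_intros)

lemma pos_deriv_v: "(pos u has_vector_derivative \<i> * of_real (deriv w v)) (at v)"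
  unfolding pos_def[abs_def]
  using w_deriv[of v] by (auto intro!: derivative_eq_intros simp: has_real_derivative_iff_has_vector_derivative)

text \<open>
  The product rule for \<open>\<Phi>\<^sup>-\<^sup>1 x \<Phi>\<close>: the frame contributes the commutator with its logarithmic
  derivative.
\<close>

lemma rot_deriv:
  assumes "(x has_vector_derivative x') (at v)"
  shows "((\<lambda>v. rot (\<Phi> v) (x v)) has_vector_derivative
     rot (\<Phi> v) (x' + s v *\<^sub>R (x v \<odot> (0, \<i> * W (w v)) - (0, \<i> * W (w v)) \<odot> x v))) (at v)"
proof -
  define B :: quat where "B = s v *\<^sub>R (0, \<i> * W (w v))"
  note mult = bounded_bilinear.has_vector_derivative[OF bounded_bilinear_qmult]
  have Bc: "qconj B = - B" by (simp add: B_def qconj_def)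
  have "((\<lambda>v. qconj (\<Phi> v)) has_vector_derivative qconj (B \<odot> \<Phi> v)) (at v)"
    using frame[of v] unfolding B_def
    by (rule bounded_linear.has_vector_derivative[OF bounded_linear_qconj])
  from mult[OF mult[OF this assms] frame[of v]]
  have "((\<lambda>v. rot (\<Phi> v) (x v)) has_vector_derivative
     qconj (\<Phi> v) \<odot> x v \<odot> (B \<odot> \<Phi> v) + (qconj (\<Phi> v) \<odot> x' + qconj (B \<odot> \<Phi> v) \<odot> x v) \<odot> \<Phi> v) (at v)"
    by (simp add: rot_def B_def)
  moreover have "qconj (\<Phi> v) \<odot> x v \<odot> (B \<odot> \<Phi> v) + (qconj (\<Phi> v) \<odot> x' + qconj (B \<odot> \<Phi> v) \<odot> x v) \<odot> \<Phi> v
      = rot (\<Phi> v) (x' + (x v \<odot> B - B \<odot> x v))"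
    by (simp add: rot_def qconj_qmult Bc qmult_linear qmult_assoc)
  moreover have "x v \<odot> B - B \<odot> x v = s v *\<^sub>R (x v \<odot> (0, \<i> * W (w v)) - (0, \<i> * W (w v)) \<odot> x v)"
    unfolding B_def by (simp only: qmult_linear(7,8) scaleR_diff_right)
  ultimately show ?thesis by (simp only:)
qed

text \<open>
  The partial derivatives of the cylinder, expressed in the moving frame.
\<close>

definition E_u :: "real \<Rightarrow> real \<Rightarrow> quat" where "E_u u v = (0, dG (pos u v))"
definition E_v :: "real \<Rightarrow> real \<Rightarrow> quat" where
  "E_v u v = (\<i> * of_real (s v * cmod (dG (pos u v))), \<i> * of_real (deriv w v) * dG (pos u v))"

lemma imaginary_frame: "Re (fst (E_u u v)) = 0" "Re (fst (E_v u v)) = 0"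
  by (simp_all add: E_u_def E_v_def)

lemma frame_inner:
  "E_u u v \<bullet> E_u u v = (cmod (dG (pos u v)))\<^sup>2" "E_u u v \<bullet> E_v u v = 0"
  by (simp_all add: E_u_def E_v_def inner_prod_def inner_complex_def cmod_power2)
     (simp_all add: power2_eq_square algebra_simps)

lemma G_pos_deriv_u: "((\<lambda>u. G (pos u v)) has_vector_derivative dG (pos u v)) (at u)"
  using field_vector_diff_chain_at[OF pos_deriv_u G_has_deriv[OF pos_strip]] by (simp add: o_def)

lemma G_pos_deriv_v: "((\<lambda>v. G (pos u v)) has_vector_derivative \<i> * of_real (deriv w v) * dG (pos u v)) (at v)"
  using field_vector_diff_chain_at[OF pos_deriv_v G_has_deriv[OF pos_strip]] by (simp add: o_def)

lemma cyl_deriv_u: "((\<lambda>u. cyl (u, v)) has_vector_derivative vecH (rot (\<Phi> v) (E_u u v))) (at u)"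
  unfolding cyl_def prod.case E_u_def
  by (intro bounded_linear.has_vector_derivative[OF bounded_linear_vecH]
      bounded_linear.has_vector_derivative[OF bounded_linear_rot] has_vector_derivative_Pair G_pos_deriv_u has_vector_derivative_const)

lemma cyl_deriv_v: "((\<lambda>v. cyl (u, v)) has_vector_derivative vecH (rot (\<Phi> v) (E_v u v))) (at v)"
proof -
  have "((\<lambda>v. rot (\<Phi> v) (0, G (pos u v))) has_vector_derivative
     rot (\<Phi> v) ((0, \<i> * of_real (deriv w v) * dG (pos u v))
       + s v *\<^sub>R ((0, G (pos u v)) \<odot> (0, \<i> * W (w v)) - (0, \<i> * W (w v)) \<odot> (0, G (pos u v))))) (at v)"
    by (intro rot_deriv has_vector_derivative_Pair G_pos_deriv_v has_vector_derivative_const)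
  moreover have "(0, \<i> * of_real (deriv w v) * dG (pos u v))
       + s v *\<^sub>R ((0, G (pos u v)) \<odot> (0, \<i> * W (w v)) - (0, \<i> * W (w v)) \<odot> (0, G (pos u v))) = E_v u v"
  proof -
    have "cmod (dG (pos u v)) = 2 * Re (G (pos u v) * cnj (W (w v)))"
      using speed_via_frame[OF pos_strip[of u v]] by (simp add: pos_def)
    then show ?thesis
      by (simp add: E_v_def qmult_def prod_eq_iff complex_eq_iff algebra_simps)
  qed
  ultimately show ?thesis unfolding cyl_def prod.case
    by (intro bounded_linear.has_vector_derivative[OF bounded_linear_vecH]) simp
qed

lemma partial_u_cyl: "partial_u cyl (u, v) = vecH (rot (\<Phi> v) (E_u u v))"
  unfolding partial_u_def prod.case by (rule vector_derivative_at[OF cyl_deriv_u])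

lemma partial_v_cyl: "partial_v cyl (u, v) = vecH (rot (\<Phi> v) (E_v u v))"
  unfolding partial_v_def prod.case by (rule vector_derivative_at[OF cyl_deriv_v])

lemma partials_inner:
  "partial_u cyl (u, v) \<bullet> partial_u cyl (u, v) = (cmod (dG (pos u v)))\<^sup>2"
  "partial_u cyl (u, v) \<bullet> partial_v cyl (u, v) = 0"
  by (simp_all add: partial_u_cyl partial_v_cyl inner_vecH Re_fst_rot unit imaginary_frame inner_rot frame_inner)

definition cyl_h :: "real \<Rightarrow> real \<Rightarrow> real" where "cyl_h u v = ln (cmod (dG (pos u v)))"

lemma exp_cyl_h:
  "exp (- (2 * cyl_h u v)) = 1 / (cmod (dG (pos u v)))\<^sup>2" "exp (- cyl_h u v) = 1 / cmod (dG (pos u v))"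
proof -
  have "exp (cyl_h u v) = cmod (dG (pos u v))" using dG_pos[of u v] by (simp add: cyl_h_def)
  then show "exp (- (2 * cyl_h u v)) = 1 / (cmod (dG (pos u v)))\<^sup>2" "exp (- cyl_h u v) = 1 / cmod (dG (pos u v))"
    by (simp_all add: exp_minus exp_double divide_inverse)
qed

text \<open>
  The differentials of the Christoffel dual and of a Bonnet surface with constant \<open>c\<close> at \<open>(u, v)\<close>, applied to the
  tangent vector \<open>x\<close> and expressed in the moving frame. Both depend on \<open>v\<close> only through \<open>w\<close>, its derivative and
  \<open>s\<close>, so they inherit every period of these data.
\<close>

definition dual_form :: "real \<Rightarrow> real \<Rightarrow> real \<times> real \<Rightarrow> quat" where
  "dual_form u v x = (1 / (cmod (dG (pos u v)))\<^sup>2) *\<^sub>R (fst x *\<^sub>R E_u u v - snd x *\<^sub>R E_v u v)"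

lemma Re_dual_form: "Re (fst (dual_form u v x)) = 0"
  by (simp add: dual_form_def imaginary_frame)

lemma dual_form_axes:
  "dual_form u v (h, 0) = h *\<^sub>R dual_form u v (1, 0)" "dual_form u v (0, h) = h *\<^sub>R dual_form u v (0, 1)"
  by (simp_all add: dual_form_def)

lemma christoffel_dual_deriv:
  assumes "christoffel_dual cyl_h cyl f'"
  shows "(f' has_derivative (\<lambda>x. vecH (rot (\<Phi> v) (dual_form u v x)))) (at (u, v))"
  using assms unfolding christoffel_dual_def partial_u_cyl partial_v_cyl
  by (simp add: dual_form_def[abs_def] rot_linear vecH_linear exp_cyl_h case_prod_unfold)

definition bonnet_form :: "real \<Rightarrow> real \<Rightarrow> real \<Rightarrow> real \<times> real \<Rightarrow> quat" where
  "bonnet_form c u v x = (qreal c - (0, G (pos u v))) \<odot> dual_form u v x \<odot> (qreal c + (0, G (pos u v)))"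

lemma Re_bonnet_form: "Re (fst (bonnet_form c u v x)) = 0"
proof -
  have "Re (fst ((qreal c - (0, g)) \<odot> y \<odot> (qreal c + (0, g)))) = 0" if "Re (fst y) = 0" for g y
    using that by (simp add: qmult_def qreal_pair algebra_simps)
  then show ?thesis unfolding bonnet_form_def using Re_dual_form by blast
qed

lemma bonnet_form_axes:
  "bonnet_form c u v (h, 0) = h *\<^sub>R bonnet_form c u v (1, 0)"
  "bonnet_form c u v (0, h) = h *\<^sub>R bonnet_form c u v (0, 1)"
  unfolding bonnet_form_def dual_form_axes(1)[of _ _ h] dual_form_axes(2)[of _ _ h]
  by (simp_all only: bounded_bilinear.scaleR_left[OF bounded_bilinear_qmult]
      bounded_bilinear.scaleR_right[OF bounded_bilinear_qmult])

lemma bonnet_deriv: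
  assumes dual: "christoffel_dual cyl_h cyl f'" and "bonnet_cylinder cyl f' c g"
  shows "(g has_derivative (\<lambda>x. vecH (rot (\<Phi> v) (bonnet_form c u v x)))) (at (u, v))"
proof -
  obtain D where D: "(g has_derivative D) (at (u, v))"
    "\<And>x. imH (D x) = (qreal c - imH (cyl (u, v))) \<odot> imH (frechet_derivative f' (at (u, v)) x)
                          \<odot> (qreal c + imH (cyl (u, v)))"
    using assms(2) unfolding bonnet_cylinder_def by blast
  have fr: "frechet_derivative f' (at (u, v)) = (\<lambda>x. vecH (rot (\<Phi> v) (dual_form u v x)))"
    using frechet_derivative_at[OF christoffel_dual_deriv[OF dual]] by simp
  have "imH (D x) = rot (\<Phi> v) (bonnet_form c u v x)" for x
    unfolding D(2) fr imH_cyl imH_rot_vecH[OF unit Re_dual_form] bonnet_form_def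
    by (simp add: rot_qmult[OF unit] rot_linear rot_qreal[OF unit])
  then have "D = (\<lambda>x. vecH (rot (\<Phi> v) (bonnet_form c u v x)))"
    by (metis vecH_imH)
  then show ?thesis using D(1) by simp
qed

lemma bonnet_deriv_u:
  assumes "christoffel_dual cyl_h cyl f'" "bonnet_cylinder cyl f' c g"
  shows "((\<lambda>u. g (u, v)) has_vector_derivative vecH (rot (\<Phi> v) (bonnet_form c u v (1, 0)))) (at u)"
proof -
  have "((\<lambda>u. (u, v)) has_derivative (\<lambda>h. (h, 0))) (at u)"
    by (auto intro!: derivative_eq_intros)
  from diff_chain_at[OF this bonnet_deriv[OF assms]] show ?thesis
    unfolding has_vector_derivative_def o_def
    by (rule has_derivative_eq_rhs)
       (rule ext, subst bonnet_form_axes(1), simp add: rot_linear vecH_linear)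
qed

lemma bonnet_deriv_v:
  assumes "christoffel_dual cyl_h cyl f'" "bonnet_cylinder cyl f' c g"
  shows "((\<lambda>v. g (u, v)) has_vector_derivative vecH (rot (\<Phi> v) (bonnet_form c u v (0, 1)))) (at v)"
proof -
  have "((\<lambda>v. (u, v)) has_derivative (\<lambda>h. (0, h))) (at v)"
    by (auto intro!: derivative_eq_intros)
  from diff_chain_at[OF this bonnet_deriv[OF assms]] show ?thesis
    unfolding has_vector_derivative_def o_def
    by (rule has_derivative_eq_rhs)
       (rule ext, subst bonnet_form_axes(2), simp add: rot_linear vecH_linear)
qed

lemma dual_deriv_v:
  assumes "christoffel_dual cyl_h cyl f'"
  shows "((\<lambda>v. f' (u, v)) has_vector_derivative - (exp (- 2 * cyl_h u v) *\<^sub>R partial_v cyl (u, v))) (at v)"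
proof -
  have "((\<lambda>v. (u, v)) has_derivative (\<lambda>h. (0, h))) (at v)"
    by (auto intro!: derivative_eq_intros)
  from diff_chain_at[OF this christoffel_dual_deriv[OF assms]] show ?thesis
    unfolding has_vector_derivative_def o_def
    by (rule has_derivative_eq_rhs)
       (simp add: fun_eq_iff dual_form_def rot_linear vecH_linear partial_v_cyl exp_cyl_h)
qed

section \<open>Reflection and the dual surface\<close>

text \<open>
  By the reflection formula for \<open>dG\<close>, the frame coefficients of \<open>f_v\<close> at \<open>\<pi> - u\<close> are those at \<open>u\<close> divided by
  the metric. So the dual surface is \<open>- f (\<pi> - u, v)\<close> up to a translation along each v-curve, and it has
  no axial displacement.
\<close>

lemma dual_is_reflection:
  assumes dual: "christoffel_dual cyl_h cyl f'"
  shows "f' (u, v2) - f' (u, v1) = cyl (pi - u, v1) - cyl (pi - u, v2)"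
proof -
  have "((\<lambda>v. f' (u, v) + cyl (pi - u, v)) has_vector_derivative 0) (at v)" for v
  proof -
    have p: "pos (pi - u) v = of_real pi - cnj (pos u v)" by (simp add: pos_def)
    have d: "dG (pos (pi - u) v) = (1 / (cmod (dG (pos u v)))\<^sup>2) *\<^sub>R dG (pos u v)"
      using dG_pos[of u v] complex_norm_square[of "dG (pos u v)"]
      unfolding p dG_reflect by (simp add: scaleR_conv_of_real field_simps)
    have "cmod (dG (pos (pi - u) v)) = (1 / (cmod (dG (pos u v)))\<^sup>2) * cmod (dG (pos u v))"
      unfolding d by simp
    then have "E_v (pi - u) v = (1 / (cmod (dG (pos u v)))\<^sup>2) *\<^sub>R E_v u v"
      unfolding E_v_def d by (simp add: scaleR_conv_of_real)
    then have "vecH (rot (\<Phi> v) (E_v (pi - u) v)) = exp (- 2 * cyl_h u v) *\<^sub>R partial_v cyl (u, v)"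
      by (simp add: rot_linear vecH_linear partial_v_cyl exp_cyl_h)
    then show ?thesis
      using has_vector_derivative_add[OF dual_deriv_v[OF dual, of u v] cyl_deriv_v[of "pi - u" v]] by simp
  qed
  then have "(\<lambda>v. f' (u, v) + cyl (pi - u, v)) v2 = (\<lambda>v. f' (u, v) + cyl (pi - u, v)) v1"
    by (intro has_derivative_zero_unique[of UNIV]) (auto simp: has_vector_derivative_def)
  then show ?thesis by (simp add: algebra_simps)
qed

end

context framed_cylinder
begin

section \<open>Closing in the u-direction\<close>

text \<open>
  The first component is \<open>c\<close> times a purely imaginary number, the second is the sum of a derivative of
  the reflected curve and of \<open>G\<^sup>2 / dG\<close>: each has an explicit primitive of period \<open>2 \<pi>\<close>.
\<close>

lemma bonnet_form_u:
  "bonnet_form c u v (1, 0)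
     = (of_real c * (G (pos u v) / dG (pos u v) - cnj (G (pos u v) / dG (pos u v))),
        of_real (c\<^sup>2) / cnj (dG (pos u v)) + (G (pos u v))\<^sup>2 / dG (pos u v))"
proof -
  define d where "d = dG (pos u v)"
  define g where "g = G (pos u v)"
  have d0: "d \<noteq> 0" using dG_pos by (simp add: d_def)
  have "of_real (1 / (cmod d)\<^sup>2) * d = 1 / cnj d"
    using complex_norm_square[of d] d0 by (simp add: field_simps)
  then have E: "dual_form u v (1, 0) = (0, 1 / cnj d)"
    by (simp add: dual_form_def E_u_def scaleR_conv_of_real d_def)
  show ?thesis unfolding bonnet_form_def E d_def[symmetric] g_def[symmetric]
    using d0 by (simp add: qmult_def qreal_pair power2_eq_square algebra_simps)
qed

lemma bonnet_u_periodic: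
  assumes dual: "christoffel_dual cyl_h cyl f'" "bonnet_cylinder cyl f' c g"
  shows "g (u + 2 * pi, v) = g (u, v)"
proof -
  obtain P1 where P1: "\<And>z. P1 (z + 2 * of_real pi) = P1 z"
    "\<And>z. z \<in> strip \<Longrightarrow> (P1 has_field_derivative (G z)\<^sup>2 / dG z) (at z)"
    using primitive_G_squared by blast
  obtain P2 and b :: real where P2: "\<And>z. P2 (z + 2 * of_real pi) = P2 z"
    "\<And>z. z \<in> strip \<Longrightarrow> (P2 has_field_derivative G z / dG z - of_real b) (at z)"
    using primitive_G_quotient by blast
  define P where "P u = (of_real c * (P2 (pos u v) - cnj (P2 (pos u v))),
      P1 (pos u v) - of_real (c\<^sup>2) * G (pos (pi - u) v))" for u
  have d1: "((\<lambda>u. P1 (pos u v)) has_vector_derivative (G (pos u v))\<^sup>2 / dG (pos u v)) (at u)" for u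
    using field_vector_diff_chain_at[OF pos_deriv_u P1(2)[OF pos_strip]] by (simp add: o_def)
  have d2: "((\<lambda>u. P2 (pos u v)) has_vector_derivative G (pos u v) / dG (pos u v) - of_real b) (at u)" for u
    using field_vector_diff_chain_at[OF pos_deriv_u P2(2)[OF pos_strip]] by (simp add: o_def)
  have p: "pos (pi - u) v = of_real pi - cnj (pos u v)" for u by (simp add: pos_def)
  have d3: "((\<lambda>u. G (pos (pi - u) v)) has_vector_derivative - (1 / cnj (dG (pos u v)))) (at u)" for u
  proof -
    have "((\<lambda>u. pos (pi - u) v) has_vector_derivative - 1) (at u)"
      unfolding pos_def by (auto intro!: derivative_eq_intros)
    from field_vector_diff_chain_at[OF this G_has_deriv[OF pos_strip]] show ?thesis
      by (simp add: o_def p dG_reflect)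
  qed
  have "(P has_vector_derivative bonnet_form c u v (1, 0)) (at u)" for u
  proof -
    have "(P has_vector_derivative
      (of_real c * ((G (pos u v) / dG (pos u v) - of_real b) - cnj (G (pos u v) / dG (pos u v) - of_real b)),
       (G (pos u v))\<^sup>2 / dG (pos u v) - of_real (c\<^sup>2) * - (1 / cnj (dG (pos u v))))) (at u)"
      unfolding P_def
      by (intro has_vector_derivative_Pair has_vector_derivative_mult_right has_vector_derivative_diff has_vector_derivative_cnj d1 d2 d3)
    then show ?thesis unfolding bonnet_form_u by (simp add: add.commute)
  qed
  then have "((\<lambda>u. vecH (rot (\<Phi> v) (P u))) has_vector_derivative vecH (rot (\<Phi> v) (bonnet_form c u v (1, 0)))) (at u)" for u
    by (intro bounded_linear.has_vector_derivative[OF bounded_linear_vecH]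
      bounded_linear.has_vector_derivative[OF bounded_linear_rot])
  then have "((\<lambda>u. g (u, v) - vecH (rot (\<Phi> v) (P u))) has_vector_derivative 0) (at u)" for u
    using has_vector_derivative_diff[OF bonnet_deriv_u[OF dual, of v u]] by force
  then have "(\<lambda>u. g (u, v) - vecH (rot (\<Phi> v) (P u))) (u + 2 * pi) = (\<lambda>u. g (u, v) - vecH (rot (\<Phi> v) (P u))) u"
    by (intro has_derivative_zero_unique[of UNIV]) (auto simp: has_vector_derivative_def)
  moreover have "P (u + 2 * pi) = P u"
  proof -
    have "pos (u + 2 * pi) v = pos u v + 2 * of_real pi"
      "pos (pi - u) v = pos (pi - (u + 2 * pi)) v + 2 * of_real pi" by (simp_all add: pos_def)
    then show ?thesis by (simp add: P_def P1 P2 G_periodic)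
  qed
  ultimately show ?thesis by simp
qed

section \<open>Monodromy\<close>

definition monodromy :: "real \<Rightarrow> quat" where "monodromy L = qconj (\<Phi> 0) \<odot> \<Phi> L"

definition frame_period :: "real \<Rightarrow> bool" where
  "frame_period L \<longleftrightarrow> (\<forall>v. w (v + L) = w v \<and> s (v + L) = s v)"

text \<open>
  \<open>\<Phi> (v + L)\<close> solves the same linear equation as \<open>\<Phi>\<close>, so the two differ by a constant right factor.
\<close>

lemma frame_period_shift:
  assumes "frame_period L"
  shows "\<Phi> (v + L) = \<Phi> v \<odot> monodromy L"
proof -
  note mult = bounded_bilinear.has_vector_derivative[OF bounded_bilinear_qmult]
  have "((\<lambda>v. qconj (\<Phi> v) \<odot> \<Phi> (v + L)) has_vector_derivative 0) (at v)" for v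
  proof -
    define B :: quat where "B = s v *\<^sub>R (0, \<i> * W (w v))"
    have Bc: "qconj B = - B" by (simp add: B_def qconj_def)
    have 1: "((\<lambda>v. qconj (\<Phi> v)) has_vector_derivative qconj (B \<odot> \<Phi> v)) (at v)"
      using frame[of v] unfolding B_def
      by (rule bounded_linear.has_vector_derivative[OF bounded_linear_qconj])
    have "((\<lambda>v. v + L) has_vector_derivative 1) (at v)" by (auto intro!: derivative_eq_intros)
    from vector_diff_chain_at[OF this frame[of "v + L"]]
    have 2: "((\<lambda>v. \<Phi> (v + L)) has_vector_derivative B \<odot> \<Phi> (v + L)) (at v)"
      using assms by (simp add: o_def frame_period_def B_def)
    from mult[OF 1 2] show ?thesis
      by (simp add: qconj_qmult Bc qmult_linear qmult_assoc)
  qed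
  then have "(\<lambda>v. qconj (\<Phi> v) \<odot> \<Phi> (v + L)) v = (\<lambda>v. qconj (\<Phi> v) \<odot> \<Phi> (v + L)) 0"
    by (intro has_derivative_zero_unique[of UNIV]) (auto simp: has_vector_derivative_def)
  then have "\<Phi> v \<odot> (qconj (\<Phi> v) \<odot> \<Phi> (v + L)) = \<Phi> v \<odot> monodromy L"
    by (simp add: monodromy_def)
  then show ?thesis by (simp add: unit_cancel unit)
qed

lemma frame_period_deriv_w:
  assumes "frame_period L"
  shows "deriv w (v + L) = deriv w v"
proof -
  have "((\<lambda>v. w (v + L)) has_real_derivative deriv w (v + L) * 1) (at v)"
    by (rule DERIV_chain2[OF w_deriv]) (auto intro!: derivative_eq_intros)
  moreover have "(\<lambda>v. w (v + L)) = w" using assms by (auto simp: frame_period_def)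
  ultimately show ?thesis using w_deriv[of v] DERIV_unique by fastforce
qed

lemma pos_shift: "frame_period L \<Longrightarrow> pos u (v + L) = pos u v"
  by (simp add: pos_def frame_period_def)

lemma bonnet_form_shift:
  assumes "frame_period L"
  shows "bonnet_form c u (v + L) = bonnet_form c u v"
  using assms frame_period_deriv_w[OF assms]
  by (simp add: fun_eq_iff bonnet_form_def dual_form_def E_u_def E_v_def pos_shift frame_period_def)

lemma cyl_shift:
  assumes "frame_period L"
  shows "cyl (u, v + L) = rotation (monodromy L) (cyl (u, v))"
  by (simp add: cyl_def pos_shift[OF assms] frame_period_shift[OF assms] rotation_vecH_rot unit)

text \<open>
  The frame coefficients of the differential have the period \<open>L\<close>, hence the differential is rotated by the
  monodromy. The surface itself is then rotated and translated.
\<close>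

lemma bonnet_shift:
  assumes per: "frame_period L" and dual: "christoffel_dual cyl_h cyl f'" "bonnet_cylinder cyl f' c g"
  obtains t where "\<And>u v. g (u, v + L) = rotation (monodromy L) (g (u, v)) + t"
proof -
  let ?k = "\<lambda>p. g (fst p, snd p + L) - rotation (monodromy L) (g p)"
  have "(?k has_derivative (\<lambda>_. 0)) (at p)" for p
  proof -
    obtain u v where p: "p = (u, v)" by (cases p)
    have "((\<lambda>p :: real \<times> real. (fst p, snd p + L)) has_derivative (\<lambda>x. x)) (at p)"
      by (auto intro!: derivative_eq_intros)
    moreover have "(g has_derivative (\<lambda>x. vecH (rot (\<Phi> (v + L)) (bonnet_form c u (v + L) x)))) (at (fst p, snd p + L))"
      using bonnet_deriv[OF dual, of "v + L" u] by (simp add: p)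
    ultimately have d1: "((\<lambda>p. g (fst p, snd p + L)) has_derivative
        (\<lambda>x. vecH (rot (\<Phi> (v + L)) (bonnet_form c u (v + L) x)))) (at p)"
      using diff_chain_at[of "\<lambda>p. (fst p, snd p + L)" "\<lambda>x. x" p g] by (simp add: o_def)
    have d2: "((\<lambda>p. rotation (monodromy L) (g p)) has_derivative
        (\<lambda>x. rotation (monodromy L) (vecH (rot (\<Phi> v) (bonnet_form c u v x))))) (at p)"
      using bonnet_deriv[OF dual, of v u] unfolding p
      by (rule bounded_linear.has_derivative[OF bounded_linear_rotation])
    have "vecH (rot (\<Phi> (v + L)) (bonnet_form c u (v + L) x))
        = rotation (monodromy L) (vecH (rot (\<Phi> v) (bonnet_form c u v x)))" for x
      by (simp add: bonnet_form_shift[OF per] frame_period_shift[OF per] rotation_vecH_rot unit Re_bonnet_form)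
    then show ?thesis using has_derivative_diff[OF d1 d2] by simp
  qed
  then have const: "?k p = ?k (0, 0)" for p
    by (intro has_derivative_zero_unique[of UNIV]) auto
  have "g (u, v + L) = rotation (monodromy L) (g (u, v)) + ?k (0, 0)" for u v
    using const[of "(u, v)"] by (simp add: algebra_simps)
  then show thesis using that by blast
qed

section \<open>The distinguished v-curve\<close>

definition \<rho> :: real where "\<rho> = - Re scale"

lemma rho_nonzero: "\<rho> \<noteq> 0"
  using constants_nonzero(3) scale_of_real by (auto simp: \<rho>_def)

text \<open>
  Along \<open>u = \<omega>\<close> the cylinder lies on a sphere around the origin, and its position vector points in the
  direction of the planar curvature line.
\<close>

lemma cyl_at_omega: "cyl (\<omega>, v) = (\<rho> / cmod (dG (pos \<omega> v))) *\<^sub>R partial_u cyl (\<omega>, v)"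
proof -
  have "G (pos \<omega> v) = - scale * (dG (pos \<omega> v) / of_real (cmod (dG (pos \<omega> v))))"
    using G_on_critical_line[OF w_range] by (simp add: pos_def)
  then have "(0, G (pos \<omega> v)) = (\<rho> / cmod (dG (pos \<omega> v))) *\<^sub>R E_u \<omega> v"
    by (subst (asm) scale_of_real) (simp add: E_u_def \<rho>_def scaleR_conv_of_real)
  moreover have "cyl (\<omega>, v) = vecH (rot (\<Phi> v) (0, G (pos \<omega> v)))" by (simp add: cyl_def)
  ultimately show ?thesis by (simp only: partial_u_cyl rot_linear vecH_linear)
qed

text \<open>
  At \<open>u = \<omega>\<close> the position vector is a multiple of \<open>f_u\<close>, so it is orthogonal to \<open>f_v\<close>, has the constant
  length \<open>\<bar>\<rho>\<bar>\<close>, and its cross product with \<open>f_v\<close> is normal to the surface. This turns the Bonnet differential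
  into the weighted normal plus a multiple of the dual differential.
\<close>

lemma bonnet_v_at_omega:
  assumes dual: "christoffel_dual cyl_h cyl f'" "bonnet_cylinder cyl f' c g"
  shows "vecH (rot (\<Phi> v) (bonnet_form c \<omega> v (0, 1)))
    = (c\<^sup>2 - \<rho>\<^sup>2) *\<^sub>R - (exp (- 2 * cyl_h \<omega> v) *\<^sub>R partial_v cyl (\<omega>, v))
      + (2 * c * \<rho>) *\<^sub>R (exp (- cyl_h \<omega> v) *\<^sub>R gauss_map cyl_h cyl (\<omega>, v))"
proof -
  define F where "F = cyl (\<omega>, v)"
  define x where "x = - (exp (- 2 * cyl_h \<omega> v) *\<^sub>R partial_v cyl (\<omega>, v))"
  define r where "r = cmod (dG (pos \<omega> v))"
  have r: "r > 0" using dG_pos by (simp add: r_def)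
  have imx: "imH x = rot (\<Phi> v) (dual_form \<omega> v (0, 1))"
    by (simp add: x_def imH_linear partial_v_cyl imH_rot_vecH unit imaginary_frame dual_form_def exp_cyl_h rot_linear)
  have F: "F = (\<rho> / r) *\<^sub>R partial_u cyl (\<omega>, v)" by (simp add: F_def r_def cyl_at_omega)
  have FF: "F \<bullet> F = \<rho>\<^sup>2" using r by (simp add: F partials_inner r_def[symmetric] power2_eq_square)
  have Fx: "F \<bullet> x = 0" by (simp add: F x_def partials_inner)
  have n: "exp (- cyl_h \<omega> v) *\<^sub>R gauss_map cyl_h cyl (\<omega>, v)
     = (1 / r ^ 3) *\<^sub>R cross3 (partial_u cyl (\<omega>, v)) (partial_v cyl (\<omega>, v))"
    by (simp add: gauss_map_def exp_cyl_h r_def power2_eq_square power3_eq_cube)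
  have xF: "cross3 x F = \<rho> *\<^sub>R (exp (- cyl_h \<omega> v) *\<^sub>R gauss_map cyl_h cyl (\<omega>, v))"
    unfolding n unfolding F x_def
    using cross_skew[of "partial_v cyl (\<omega>, v)" "partial_u cyl (\<omega>, v)"]
    by (simp add: cross_mult_left cross_mult_right cross_minus_left exp_cyl_h r_def power2_eq_square power3_eq_cube)
  have "rot (\<Phi> v) (bonnet_form c \<omega> v (0, 1)) = (qreal c - imH F) \<odot> imH x \<odot> (qreal c + imH F)"
    unfolding imx F_def imH_cyl bonnet_form_def
    by (simp add: rot_qmult[OF unit] rot_linear rot_qreal[OF unit])
  then show ?thesis
    unfolding x_def[symmetric] by (simp only: bonnet_vector_form FF Fx xF) simp
qed

lemma weighted_normal_integral:
  assumes dual: "christoffel_dual cyl_h cyl f'" "bonnet_cylinder cyl f' c g" and c: "c \<noteq> 0" and V: "V > 0"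
  shows "((\<lambda>v. exp (- cyl_h \<omega> v) *\<^sub>R gauss_map cyl_h cyl (\<omega>, v)) has_integral
    (1 / (2 * c * \<rho>)) *\<^sub>R ((g (\<omega>, V) - g (\<omega>, 0)) - (c\<^sup>2 - \<rho>\<^sup>2) *\<^sub>R (f' (\<omega>, V) - f' (\<omega>, 0)))) {0..V}"
proof -
  define x where "x v = - (exp (- 2 * cyl_h \<omega> v) *\<^sub>R partial_v cyl (\<omega>, v))" for v
  define N where "N v = exp (- cyl_h \<omega> v) *\<^sub>R gauss_map cyl_h cyl (\<omega>, v)" for v
  have g: "((\<lambda>v. g (\<omega>, v)) has_vector_derivative (c\<^sup>2 - \<rho>\<^sup>2) *\<^sub>R x v + (2 * c * \<rho>) *\<^sub>R N v) (at v)" for v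
    using bonnet_deriv_v[OF dual, of \<omega> v] unfolding bonnet_v_at_omega[OF dual] x_def N_def .
  have f: "((\<lambda>v. f' (\<omega>, v)) has_vector_derivative x v) (at v)" for v
    using dual_deriv_v[OF dual(1)] by (simp add: x_def)
  have "((\<lambda>v. (1 / (2 * c * \<rho>)) *\<^sub>R (g (\<omega>, v) - (c\<^sup>2 - \<rho>\<^sup>2) *\<^sub>R f' (\<omega>, v))) has_vector_derivative
     (1 / (2 * c * \<rho>)) *\<^sub>R (((c\<^sup>2 - \<rho>\<^sup>2) *\<^sub>R x v + (2 * c * \<rho>) *\<^sub>R N v) - (c\<^sup>2 - \<rho>\<^sup>2) *\<^sub>R x v)) (at v)" for v
    by (intro bounded_linear.has_vector_derivative[OF bounded_linear_scaleR_right] has_vector_derivative_diff g f)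
  moreover have "(1 / (2 * c * \<rho>)) *\<^sub>R (((c\<^sup>2 - \<rho>\<^sup>2) *\<^sub>R x v + (2 * c * \<rho>) *\<^sub>R N v) - (c\<^sup>2 - \<rho>\<^sup>2) *\<^sub>R x v) = N v" for v
    using c rho_nonzero by simp
  ultimately have "(N has_integral
      (1 / (2 * c * \<rho>)) *\<^sub>R (g (\<omega>, V) - (c\<^sup>2 - \<rho>\<^sup>2) *\<^sub>R f' (\<omega>, V))
      - (1 / (2 * c * \<rho>)) *\<^sub>R (g (\<omega>, 0) - (c\<^sup>2 - \<rho>\<^sup>2) *\<^sub>R f' (\<omega>, 0))) {0..V}"
    using V by (intro fundamental_theorem_of_calculus) (auto intro: has_vector_derivative_at_within)
  then show ?thesis by (simp add: N_def[abs_def] algebra_simps)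
qed

end

section \<open>Periodic Bonnet cylinders\<close>

text \<open>
  A quaternion that commutes with an imaginary one has its vector part parallel to it; it cannot be
  parallel to two independent directions. The two elements are the tangent vectors of the cylinder in its frame.
\<close>

lemma commuting_with_tangent_frame_is_real:
  assumes \<alpha>: "\<alpha> \<noteq> 0" and sp: "s\<^sup>2 + p\<^sup>2 = 1"
    and c1: "n \<odot> (0, \<alpha>) = (0, \<alpha>) \<odot> n"
    and c2: "n \<odot> (\<i> * of_real (s * cmod \<alpha>), \<i> * of_real p * \<alpha>) = (\<i> * of_real (s * cmod \<alpha>), \<i> * of_real p * \<alpha>) \<odot> n"
  shows "\<exists>r. n = qreal r"
proof -
  obtain a b where n: "n = (a, b)" by (cases n)
  have 1: "b * cnj \<alpha> = \<alpha> * cnj b" "a * \<alpha> = \<alpha> * cnj a"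
    using c1 by (simp_all add: n qmult_def)
  then have a: "cnj a = a" using \<alpha> by (simp add: mult.commute)
  have "cnj (b * cnj \<alpha>) = b * cnj \<alpha>" using 1 by (simp add: mult.commute)
  then have "b * cnj \<alpha> = of_real (Re (b * cnj \<alpha>))" by (metis Reals_cnj_iff of_real_Re)
  then have "b * (cnj \<alpha> * \<alpha>) = of_real (Re (b * cnj \<alpha>)) * \<alpha>" by (metis mult.assoc)
  then have "b * of_real ((cmod \<alpha>)\<^sup>2) = of_real (Re (b * cnj \<alpha>)) * \<alpha>"
    using complex_norm_square[of \<alpha>] by (simp add: mult.commute)
  then have b: "b = of_real (Re (b * cnj \<alpha>) / (cmod \<alpha>)\<^sup>2) * \<alpha>"
    using \<alpha> by (simp add: field_simps)
  define t where "t = Re (b * cnj \<alpha>) / (cmod \<alpha>)\<^sup>2"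
  have bt: "b = of_real t * \<alpha>" using b by (simp add: t_def)
  have e1: "- (b * cnj (\<i> * of_real p * \<alpha>)) = - (\<i> * of_real p * \<alpha> * cnj b)"
    and e2: "b * cnj (\<i> * of_real (s * cmod \<alpha>)) = \<i> * of_real (s * cmod \<alpha>) * b"
    using c2 a by (simp_all add: n qmult_def mult_ac)
  have "of_real (t * p) * (\<i> * (\<alpha> * cnj \<alpha>)) = - (of_real (t * p) * (\<i> * (\<alpha> * cnj \<alpha>)))"
    using e1 unfolding bt by (simp add: mult_ac)
  then have tp: "t * p = 0" using \<alpha> by (auto simp: equal_neg_zero)
  have "of_real (t * s) * (\<i> * of_real (cmod \<alpha>) * \<alpha>) = - (of_real (t * s) * (\<i> * of_real (cmod \<alpha>) * \<alpha>))"
    using e2 unfolding bt by (simp add: mult_ac)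
  then have ts: "t * s = 0" using \<alpha> by (auto simp: equal_neg_zero)
  have "t\<^sup>2 = t\<^sup>2 * (s\<^sup>2 + p\<^sup>2)" using sp by simp
  also have "\<dots> = (t * s)\<^sup>2 + (t * p)\<^sup>2" by (simp add: algebra_simps)
  finally have "t = 0" using tp ts by simp
  moreover have "a = of_real (Re a)" using a by (simp add: complex_eq_iff)
  ultimately show ?thesis using n bt by (metis mult_zero_left of_real_0 qreal_pair)
qed

context framed_cylinder
begin

lemma norm_vecH_rot: "Re (fst x) = 0 \<Longrightarrow> norm (vecH (rot (\<Phi> v) x)) = norm x"
  unfolding norm_eq_sqrt_inner by (simp add: inner_vecH Re_fst_rot unit inner_rot)

lemma norm_bonnet_form_u:
  "norm (bonnet_form c u v (1, 0)) = (c\<^sup>2 + (cmod (G (pos u v)))\<^sup>2) / cmod (dG (pos u v))"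
proof -
  have n: "norm (qreal c - (0, g)) = sqrt (c\<^sup>2 + (cmod g)\<^sup>2)" "norm (qreal c + (0, g)) = sqrt (c\<^sup>2 + (cmod g)\<^sup>2)" for g
    by (simp_all add: qreal_pair norm_prod_def)
  have "norm (dual_form u v (1, 0)) = 1 / cmod (dG (pos u v))"
  proof -
    have "norm (0 :: complex, z :: complex) = cmod z" for z by (simp add: norm_prod_def)
    then show ?thesis using dG_pos[of u v] by (simp add: dual_form_def E_u_def power2_eq_square)
  qed
  then show ?thesis unfolding bonnet_form_def norm_qmult n by simp
qed

lemma same_derivative_if_shift_invariant:
  assumes dual: "christoffel_dual cyl_h cyl f'" "bonnet_cylinder cyl f' c g"
    and per: "\<And>u v. g (u, v + L) = g (u, v)"
  shows "vecH (rot (\<Phi> (v + L)) (bonnet_form c u (v + L) (1, 0))) = vecH (rot (\<Phi> v) (bonnet_form c u v (1, 0)))"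
    and "vecH (rot (\<Phi> (v + L)) (bonnet_form c u (v + L) (0, 1))) = vecH (rot (\<Phi> v) (bonnet_form c u v (0, 1)))"
proof -
  show "vecH (rot (\<Phi> (v + L)) (bonnet_form c u (v + L) (1, 0))) = vecH (rot (\<Phi> v) (bonnet_form c u v (1, 0)))"
    using bonnet_deriv_u[OF dual, of "v + L" u] bonnet_deriv_u[OF dual, of v u] per
      vector_derivative_unique_at by simp
  have "((\<lambda>v. v + L) has_vector_derivative 1) (at v)" by (auto intro!: derivative_eq_intros)
  from vector_diff_chain_at[OF this bonnet_deriv_v[OF dual, of u "v + L"]]
  show "vecH (rot (\<Phi> (v + L)) (bonnet_form c u (v + L) (0, 1))) = vecH (rot (\<Phi> v) (bonnet_form c u v (0, 1)))"
    using bonnet_deriv_v[OF dual, of u v] per vector_derivative_unique_at by (simp add: o_def)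
qed

text \<open>
  If the surface repeats after a period of the frame, the monodromy fixes its tangent vectors, which are the
  \<open>C1 \<odot> E \<odot> C2\<close> with \<open>E\<close> tangent to the dual surface. As \<open>C1 \<odot> C2\<close> is real, conjugation by these factors
  reduces the claim to an element that commutes with two independent tangent vectors of the cylinder.
\<close>

lemma shift_invariant_imp_trivial_monodromy:
  assumes dual: "christoffel_dual cyl_h cyl f'" "bonnet_cylinder cyl f' c g" and c: "c \<noteq> 0"
    and L: "frame_period L" and per: "\<And>u v. g (u, v + L) = g (u, v)"
  shows "\<exists>r. monodromy L = qreal r"
proof -
  define M where "M = \<Phi> L \<odot> qconj (\<Phi> 0)"
  define a where "a = G (pos 0 0)"
  define C1 where "C1 = qreal c - (0, a)"
  define C2 where "C2 = qreal c + (0, a)"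
  define k where "k = c\<^sup>2 + (cmod a)\<^sup>2"
  have k: "k > 0" using c by (simp add: k_def add_pos_nonneg)
  have "qconj C1 = C2" "qconj C2 = C1" "(norm C1)\<^sup>2 = k" "(norm C2)\<^sup>2 = k"
    by (simp_all add: C1_def C2_def qconj_def qreal_pair norm_quat k_def)
  then have CC: "C1 \<odot> C2 = qreal k" "C2 \<odot> C1 = qreal k"
    using qconj_self[of C1] by simp_all
  have PhiL: "\<Phi> L = M \<odot> \<Phi> 0" by (simp add: M_def qmult_assoc unit_qconj unit qreal_mult)
  have nM: "norm M = 1" by (simp add: M_def norm_qmult norm_qconj unit)
  have comm: "bonnet_form c 0 0 x \<odot> M = M \<odot> bonnet_form c 0 0 x" if "x = (1, 0) \<or> x = (0, 1)" for x
  proof -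
    have "vecH (rot (\<Phi> L) (bonnet_form c 0 0 x)) = vecH (rot (\<Phi> 0) (bonnet_form c 0 0 x))"
      using same_derivative_if_shift_invariant[OF dual per, of 0 0] that bonnet_form_shift[OF L, of c 0 0] by auto
    then have "rot (\<Phi> L) (bonnet_form c 0 0 x) = rot (\<Phi> 0) (bonnet_form c 0 0 x)"
      using imH_rot_vecH[OF unit Re_bonnet_form] by metis
    then have "rot M (bonnet_form c 0 0 x) = bonnet_form c 0 0 x"
      unfolding PhiL rot_rot using rot_inject[OF unit] by blast
    then show ?thesis using rot_eq_self_iff[OF nM] by blast
  qed
  define Z where "Z = C2 \<odot> M \<odot> C1"
  have commZ: "Z \<odot> E = E \<odot> Z" if "(C1 \<odot> E \<odot> C2) \<odot> M = M \<odot> (C1 \<odot> E \<odot> C2)" for E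
  proof -
    have "C2 \<odot> ((C1 \<odot> E \<odot> C2) \<odot> M) \<odot> C1 = (C2 \<odot> C1) \<odot> (E \<odot> Z)"
      by (simp add: Z_def qmult_assoc)
    moreover have "C2 \<odot> (M \<odot> (C1 \<odot> E \<odot> C2)) \<odot> C1 = (Z \<odot> E) \<odot> (C2 \<odot> C1)"
      by (simp add: Z_def qmult_assoc)
    ultimately show ?thesis using that k by (simp add: CC qreal_mult)
  qed
  define d where "d = dG (pos 0 0)"
  have d: "d \<noteq> 0" using dG_pos by (simp add: d_def)
  define e where "e = 1 / (cmod d)\<^sup>2"
  have e: "e \<noteq> 0" using d by (simp add: e_def)
  have df: "dual_form 0 0 (1, 0) = e *\<^sub>R (0, d)"
    "dual_form 0 0 (0, 1) = (- e) *\<^sub>R (\<i> * of_real (s 0 * cmod d), \<i> * of_real (deriv w 0) * d)"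
    by (simp_all only: dual_form_def E_u_def E_v_def d_def e_def fst_conv snd_conv) simp_all
  have "Z \<odot> dual_form 0 0 x = dual_form 0 0 x \<odot> Z" if "x = (1, 0) \<or> x = (0, 1)" for x
    using comm[OF that] commZ unfolding bonnet_form_def C1_def C2_def a_def by blast
  from this[of "(1, 0)"] this[of "(0, 1)"]
  have "e *\<^sub>R (Z \<odot> (0, d)) = e *\<^sub>R ((0, d) \<odot> Z)"
    "(- e) *\<^sub>R (Z \<odot> (\<i> * of_real (s 0 * cmod d), \<i> * of_real (deriv w 0) * d))
      = (- e) *\<^sub>R ((\<i> * of_real (s 0 * cmod d), \<i> * of_real (deriv w 0) * d) \<odot> Z)"
    unfolding df qmult_linear(7,8) by blast+
  then have "\<exists>r. Z = qreal r"
    using e s_sq[of 0] by (intro commuting_with_tangent_frame_is_real[OF d, of "s 0" "deriv w 0"]) simp_all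
  then obtain r where r: "Z = qreal r" by blast
  have "(k * k) *\<^sub>R M = (C1 \<odot> C2) \<odot> M \<odot> (C1 \<odot> C2)" by (simp add: CC qreal_mult)
  also have "\<dots> = C1 \<odot> Z \<odot> C2" by (simp add: Z_def qmult_assoc)
  also have "\<dots> = (r * k) *\<^sub>R qreal 1"
    by (simp add: r qreal_mult qmult_linear CC) (simp add: qreal_pair scaleR_conv_of_real)
  finally have "(k * k) *\<^sub>R M = (r * k) *\<^sub>R qreal 1" .
  then have "inverse (k * k) *\<^sub>R ((k * k) *\<^sub>R M) = inverse (k * k) *\<^sub>R ((r * k) *\<^sub>R qreal 1)"
    by (rule arg_cong)
  also have "inverse (k * k) *\<^sub>R ((k * k) *\<^sub>R M) = M"
  proof -
    have "inverse (k * k) * (k * k) = 1" by (rule left_inverse) (use k in simp)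
    then show ?thesis by (simp only: scaleR_scaleR scaleR_one)
  qed
  also have "inverse (k * k) *\<^sub>R ((r * k) *\<^sub>R qreal 1) = qreal (inverse (k * k) * (r * k))"
    by (simp add: qreal_pair scaleR_conv_of_real)
  finally have "M = qreal (inverse (k * k) * (r * k))" .
  then obtain r' where "M = qreal r'" by blast
  then have "monodromy L = qreal r'"
    unfolding monodromy_def PhiL by (simp add: qreal_mult qmult_linear unit_qconj unit) (simp add: qreal_pair scaleR_conv_of_real)
  then show ?thesis by blast
qed

lemma continuous_dG_pos: "continuous_on UNIV (\<lambda>v. dG (pos u v))"
proof (rule continuous_at_imp_continuous_on, intro ballI)
  fix v
  have T: "isCont (\<lambda>v. T ((pos u v + a) / 2)) v" "isCont (\<lambda>v. T2 ((pos u v + a) / 2)) v" for a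
  proof -
    have "isCont (\<lambda>v. (pos u v + a) / 2) v"
      using has_vector_derivative_continuous[OF pos_deriv_v] by (intro continuous_intros) auto
    then show "isCont (\<lambda>v. T ((pos u v + a) / 2)) v" "isCont (\<lambda>v. T2 ((pos u v + a) / 2)) v"
      using isCont_o2 DERIV_isCont T_has_deriv T2_has_deriv by blast+
  qed
  show "isCont (\<lambda>v. dG (pos u v)) v"
    unfolding dG_def using T(2)[of "- om"] T(1)[of om] strip_nonzero(2)[OF pos_strip[of u v]]
    by (intro continuous_intros) simp_all
qed

lemma continuous_G_pos: "continuous_on UNIV (\<lambda>v. G (pos u v))"
  using has_vector_derivative_continuous[OF G_pos_deriv_v] by (auto intro: continuous_at_imp_continuous_on)

text \<open>
  The length of \<open>g_u\<close> depends only on \<open>u\<close> and \<open>w v\<close>, so it has the period \<open>L\<close> of the frame besides the period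
  \<open>P\<close> of the surface. Were these incommensurable, it would be constant along v-curves, which fails for
  \<open>u = \<pi> + \<omega>\<close> as soon as \<open>w\<close> sweeps out an interval.
\<close>

lemma metric_period_commensurable:
  assumes dual: "christoffel_dual cyl_h cyl f'" "bonnet_cylinder cyl f' c g" and c: "c \<noteq> 0"
    and L: "frame_period L" "L > 0" and P: "P > 0" "\<And>u v. g (u, v + P) = g (u, v)"
    and nonconst: "w v1 \<noteq> w v2"
  shows "P / L \<in> \<rat>"
proof (rule ccontr)
  assume irr: "P / L \<notin> \<rat>"
  define N where "N v = (c\<^sup>2 + (cmod (G (pos (pi + \<omega>) v)))\<^sup>2) / cmod (dG (pos (pi + \<omega>) v))" for v
  have cont: "continuous_on UNIV N"
    unfolding N_def using dG_pos by (intro continuous_intros continuous_G_pos continuous_dG_pos) auto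
  have NL: "N (v + L) = N v" for v by (simp add: N_def pos_shift[OF L(1)])
  have NP: "N (v + P) = N v" for v
  proof -
    have "norm (bonnet_form c (pi + \<omega>) (v + P) (1, 0)) = norm (bonnet_form c (pi + \<omega>) v (1, 0))"
      using same_derivative_if_shift_invariant(1)[OF dual P(2), of v "pi + \<omega>"]
        norm_vecH_rot[OF Re_bonnet_form] by metis
    then show ?thesis by (simp add: norm_bonnet_form_u N_def)
  qed
  have const: "N x = N 0" for x
    by (rule incommensurable_periods_constant[OF cont NP NL P(1) L(2) irr])
  define w1 where "w1 = min (w v1) (w v2)"
  define w2 where "w2 = max (w v1) (w v2)"
  have w12: "w1 < w2" "0 < w1" "w2 < 2 * pi * Im \<tau>"
    using nonconst w_range by (auto simp: w1_def w2_def min_def max_def)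
  obtain x where x: "x \<in> {w1..w2}"
    "c\<^sup>2 + (cmod (G (of_real pi + om + \<i> * of_real x)))\<^sup>2 \<noteq> N 0 * cmod (dG (of_real pi + om + \<i> * of_real x))"
    using conformal_factor_not_constant[OF c w12, of "N 0"] by blast
  have "continuous_on UNIV w" using w_deriv DERIV_isCont by (blast intro: continuous_at_imp_continuous_on)
  then have "connected (range w)" by (rule connected_continuous_image) simp
  moreover have "w1 \<in> range w" "w2 \<in> range w" by (auto simp: w1_def w2_def min_def max_def)
  ultimately have "x \<in> range w" using x(1) connected_contains_Icc by blast
  then obtain v where v: "x = w v" by blast
  have "of_real pi + om + \<i> * of_real x = pos (pi + \<omega>) v" by (simp add: pos_def v)
  then show False using x(2) const[of v] dG_pos[of "pi + \<omega>" v] by (simp add: N_def field_simps)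
qed

end

section \<open>Closing after several fundamental pieces\<close>

locale fundamental_piece = framed_cylinder +
  fixes V \<theta> \<sigma> :: real and A :: "real^3"
  assumes V: "V > 0" and V_period: "frame_period V"
    and A: "norm A = 1" and theta: "0 < \<theta>" "\<theta> \<le> pi" and sigma: "\<bar>\<sigma>\<bar> = 1"
    and monodromy_V: "monodromy V = \<sigma> *\<^sub>R axis_angle A (\<theta> / 2)"
begin

lemma multiple_period: "frame_period (real k * V)"
proof (induction k)
  case (Suc k)
  have "v + real (Suc k) * V = (v + real k * V) + V" for v by (simp add: algebra_simps)
  then show ?case using Suc V_period unfolding frame_period_def by (simp only:) simp
qed (simp add: frame_period_def)

lemma monodromy_multiple: "monodromy (real k * V) = \<sigma> ^ k *\<^sub>R axis_angle A (real k * \<theta> / 2)"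
proof (induction k)
  case 0
  show ?case by (simp add: monodromy_def unit_qconj unit axis_angle_def imH_linear)
next
  case (Suc k)
  have "\<Phi> (real k * V + V) = \<Phi> (real k * V) \<odot> monodromy V" by (rule frame_period_shift[OF V_period])
  then have "monodromy (real k * V + V) = monodromy (real k * V) \<odot> monodromy V"
    by (simp add: monodromy_def qmult_assoc)
  also have "\<dots> = (\<sigma> ^ k * \<sigma>) *\<^sub>R axis_angle A (real k * \<theta> / 2 + \<theta> / 2)"
    unfolding Suc monodromy_V qmult_linear(7,8) axis_angle_mult[OF A] by simp
  finally show ?case by (simp add: algebra_simps add_divide_distrib)
qed

lemma sin_half_theta: "sin (\<theta> / 2) \<noteq> 0"
  using theta sin_gt_zero[of "\<theta> / 2"] by simp

definition axial :: real where
  "axial = A \<bullet> integral {0..V} (\<lambda>v. exp (- cyl_h \<omega> v) *\<^sub>R gauss_map cyl_h cyl (\<omega>, v))"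

context
  fixes f' g :: "real \<times> real \<Rightarrow> real^3" and c :: real
  assumes dual: "christoffel_dual cyl_h cyl f'" "bonnet_cylinder cyl f' c g" and c: "c \<noteq> 0"
begin

text \<open>
  The rotation preserves axial parts, so every fundamental piece adds the same axial displacement. It is
  computed along \<open>u = \<omega>\<close>, where the dual surface contributes nothing and the weighted normal remains.
\<close>

lemma axial_displacement:
  "A \<bullet> (g (u, v + real k * V) - g (u, v)) = real k * (2 * c * \<rho> * axial)"
proof -
  obtain t where t: "\<And>u v. g (u, v + V) = rotation (monodromy V) (g (u, v)) + t"
    using bonnet_shift[OF V_period dual] by blast
  have step: "A \<bullet> (g (u, v + V) - g (u, v)) = A \<bullet> t" for u v
    unfolding t monodromy_V by (simp add: inner_axis_rotation[OF A sigma] inner_add_right inner_diff_right)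
  have "axial = A \<bullet> ((1 / (2 * c * \<rho>)) *\<^sub>R ((g (\<omega>, V) - g (\<omega>, 0)) - (c\<^sup>2 - \<rho>\<^sup>2) *\<^sub>R (f' (\<omega>, V) - f' (\<omega>, 0))))"
    unfolding axial_def using integral_unique[OF weighted_normal_integral[OF dual c V]] by simp
  moreover have "A \<bullet> (f' (\<omega>, V) - f' (\<omega>, 0)) = 0"
    using cyl_shift[OF V_period, of "pi - \<omega>" 0] dual_is_reflection[OF dual(1), of \<omega> V 0]
    by (simp add: monodromy_V inner_axis_rotation[OF A sigma] inner_diff_right)
  moreover have "A \<bullet> (g (\<omega>, V) - g (\<omega>, 0)) = A \<bullet> t" using step[of \<omega> 0] by simp
  ultimately have "axial = 1 / (2 * c * \<rho>) * (A \<bullet> t)"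
    by (simp add: inner_diff_right[of A "g (\<omega>, V) - g (\<omega>, 0)"])
  then have at: "A \<bullet> t = 2 * c * \<rho> * axial" using c rho_nonzero by simp
  show ?thesis
  proof (induction k)
    case (Suc k)
    have e: "v + real (Suc k) * V = (v + real k * V) + V" by (simp add: algebra_simps)
    show ?case using Suc step[of u "v + real k * V"] unfolding e at
      by (simp add: inner_diff_right algebra_simps)
  qed simp
qed

text \<open>
  A continuous periodic curve is bounded, whereas a nonzero axial displacement accumulates.
\<close>

lemma periodic_imp_axial_zero:
  assumes P: "P > 0" "\<And>u v. g (u, v + P) = g (u, v)"
  shows "axial = 0"
proof (rule ccontr)
  assume "axial \<noteq> 0"
  define a where "a = \<bar>2 * c * \<rho> * axial\<bar>"
  have a: "a > 0" using \<open>axial \<noteq> 0\<close> c rho_nonzero by (simp add: a_def)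
  have "continuous_on UNIV (\<lambda>v. g (\<omega>, v))"
    using has_vector_derivative_continuous[OF bonnet_deriv_v[OF dual]] by (auto intro: continuous_at_imp_continuous_on)
  then have "compact ((\<lambda>v. g (\<omega>, v)) ` {0..P})"
    by (intro compact_continuous_image) (auto intro: continuous_on_subset)
  then have "bounded ((\<lambda>v. g (\<omega>, v)) ` {0..P})" by (rule compact_imp_bounded)
  then obtain B where B: "\<And>v. v \<in> {0..P} \<Longrightarrow> norm (g (\<omega>, v)) \<le> B"
    unfolding bounded_iff by blast
  have bd: "norm (g (\<omega>, v)) \<le> B" for v
  proof -
    have "g (\<omega>, v) = g (\<omega>, v + of_int (- \<lfloor>v / P\<rfloor>) * P)"
      using period_of_int_multiple[of "\<lambda>v. g (\<omega>, v)" P v "- \<lfloor>v / P\<rfloor>"] P(2) by simp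
    moreover have "v + of_int (- \<lfloor>v / P\<rfloor>) * P = frac (v / P) * P"
      using P(1) by (simp add: frac_def field_simps)
    moreover have "frac (v / P) * P \<in> {0..P}"
      using P(1) frac_ge_0[of "v / P"] frac_lt_1[of "v / P"] by (simp add: mult_le_cancel_right2 less_imp_le)
    ultimately show ?thesis using B by simp
  qed
  obtain k where k: "real k * a > 2 * B" using a reals_Archimedean3 by blast
  have "real k * a = \<bar>A \<bullet> (g (\<omega>, 0 + real k * V) - g (\<omega>, 0))\<bar>"
    unfolding axial_displacement by (simp add: a_def abs_mult)
  also have "\<dots> \<le> norm A * norm (g (\<omega>, 0 + real k * V) - g (\<omega>, 0))" by (rule Cauchy_Schwarz_ineq2)
  also have "\<dots> \<le> norm (g (\<omega>, 0 + real k * V)) + norm (g (\<omega>, 0))" using A norm_triangle_ineq4 by simp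
  also have "\<dots> \<le> 2 * B" using bd[of "0 + real k * V"] bd[of 0] by simp
  finally show False using k by simp
qed

lemma periodic_imp_rational:
  assumes P: "P > 0" "\<And>u v. g (u, v + P) = g (u, v)" and nonconst: "w v1 \<noteq> w v2"
  shows "\<exists>k m :: nat. k \<ge> 1 \<and> m \<ge> 1 \<and> real k * \<theta> = 2 * pi * real m"
proof -
  have "P / V \<in> \<rat>" by (rule metric_period_commensurable[OF dual c V_period V P nonconst])
  then obtain m n :: nat where mn: "n \<noteq> 0" "\<bar>P / V\<bar> = real m / real n"
    by (rule Rats_abs_nat_div_natE)
  then have e: "real n * P = real m * V" using P V by (simp add: field_simps)
  have "m \<noteq> 0" using e P(1) mn(1) by (cases m) auto
  have "g (u, v + real j * P) = g (u, v)" for j u v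
  proof (induction j)
    case (Suc j)
    have "v + real (Suc j) * P = (v + real j * P) + P" by (simp add: algebra_simps)
    then show ?case using Suc P(2) by (simp only:)
  qed simp
  from this[of _ _ n] have "\<And>u v. g (u, v + real m * V) = g (u, v)" by (simp add: e)
  from shift_invariant_imp_trivial_monodromy[OF dual c multiple_period this]
  obtain r where "\<sigma> ^ m *\<^sub>R axis_angle A (real m * \<theta> / 2) = qreal r"
    unfolding monodromy_multiple by blast
  then have "\<sigma> ^ m *\<^sub>R (sin (real m * \<theta> / 2) *\<^sub>R imH A) = qreal (r - \<sigma> ^ m * cos (real m * \<theta> / 2))"
    by (simp add: axis_angle_def scaleR_add_right) (simp add: qreal_pair prod_eq_iff complex_eq_iff)
  then have "imH ((\<sigma> ^ m * sin (real m * \<theta> / 2)) *\<^sub>R A) = qreal (r - \<sigma> ^ m * cos (real m * \<theta> / 2))"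
    by (simp add: imH_linear)
  then have "(\<sigma> ^ m * sin (real m * \<theta> / 2)) *\<^sub>R A = vecH (qreal (r - \<sigma> ^ m * cos (real m * \<theta> / 2)))"
    by (metis vecH_imH)
  also have "\<dots> = 0" by (simp add: vecH_def qreal_pair vec_eq_iff forall_3)
  finally have "sin (real m * \<theta> / 2) = 0" using A sigma by auto
  then obtain i :: int where i: "real m * \<theta> / 2 = of_int i * pi" using sin_zero_iff_int2 by blast
  have "real m * \<theta> / 2 > 0" using \<open>m \<noteq> 0\<close> theta by simp
  then have "i > 0" unfolding i by (simp add: zero_less_mult_iff)
  then have "real m * \<theta> = 2 * pi * real (nat i)" "nat i \<ge> 1" using i by simp_all
  then show ?thesis using \<open>m \<noteq> 0\<close> by (metis One_nat_def Suc_leI gr0I)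
qed

text \<open>
  After \<open>k\<close> pieces the rotation is the identity and only a translation \<open>t\<close> is left. It commutes with
  the rotation of a single piece, so \<open>t\<close> is parallel to the axis; its axial part is zero by assumption.
\<close>

lemma rational_and_axial_zero_imp_periodic:
  assumes k: "k \<ge> 1" "real k * \<theta> = 2 * pi * real m" and ax: "axial = 0"
  shows "g (u, v + real k * V) = g (u, v)"
proof -
  have "real k * \<theta> / 2 = real m * pi" using k by simp
  then have "monodromy (real k * V) = qreal (\<sigma> ^ k * (- 1) ^ m)"
    unfolding monodromy_multiple by (simp add: axis_angle_def qreal_pair scaleR_conv_of_real)
  moreover have "rotation (qreal r) x = r\<^sup>2 *\<^sub>R x" for r x
    by (simp add: rotation_def rot_def qreal_mult qmult_linear vecH_linear vecH_imH power2_eq_square)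
       (simp add: qconj_def qreal_pair vecH_def imH_def qmult_def vec_eq_iff forall_3)
  moreover have "(\<sigma> ^ k * (- 1) ^ m)\<^sup>2 = 1"
  proof -
    have "\<bar>\<sigma> ^ k * (- 1) ^ m\<bar> = 1" using sigma by (simp add: abs_mult power_abs)
    then show ?thesis by (metis power2_abs power_one)
  qed
  ultimately have id: "rotation (monodromy (real k * V)) x = x" for x by simp
  obtain t where t: "\<And>u v. g (u, v + real k * V) = g (u, v) + t"
    using bonnet_shift[OF multiple_period[of k] dual] id by metis
  obtain t1 where t1: "\<And>u v. g (u, v + V) = rotation (monodromy V) (g (u, v)) + t1"
    using bonnet_shift[OF V_period dual] by blast
  have "g (0, (0 + V) + real k * V) = rotation (monodromy V) (g (0, 0)) + t1 + t" by (simp only: t t1)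
  moreover have "g (0, (0 + real k * V) + V) = rotation (monodromy V) (g (0, 0) + t) + t1" by (simp only: t t1)
  moreover have "(0 + V) + real k * V = (0 + real k * V) + V" by simp
  ultimately have "rotation (monodromy V) t = t"
    using linear_add[OF bounded_linear.linear[OF bounded_linear_rotation]] by (simp add: add.commute)
  then have "cross3 A t = 0"
    unfolding monodromy_V using axis_angle_fixes_iff[OF A sigma sin_half_theta] by blast
  moreover have "A \<bullet> t = 0" using axial_displacement[of 0 0 k] t[of 0 0] ax by simp
  ultimately have "t = 0" using norm_and_cross_eq_0[of A t] A by auto
  then show ?thesis using t by simp
qed

text \<open>
  For constant \<open>w\<close> the cylinder is a surface of revolution about the constant axis \<open>\<alpha>\<close> spanned by the frame
  derivative. The speed formula at \<open>u = \<omega>\<close> shows that \<open>f_u\<close> is not parallel to \<open>\<alpha>\<close>. The normal is the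
  direction of \<open>f_u\<close> turned by a right angle in the plane of the curve, so it has a nonzero
  component along \<open>\<alpha>\<close>, and with the given weight this component is constant. This case has to be
  excluded separately since the metric then has every period.
\<close>

lemma constant_w_imp_axial_nonzero:
  assumes const: "\<And>v. w v = w 0"
  shows "axial \<noteq> 0"
proof -
  have "w = (\<lambda>_. w 0)" using const by auto
  then have dw: "deriv w v = 0" for v by (metis deriv_const)
  have s2: "(s v)\<^sup>2 = 1" for v using s_sq[of v] dw by simp
  have sc: "s v = s 0" for v
  proof (rule ccontr)
    assume ne: "s v \<noteq> s 0"
    have pm: "s v = 1 \<or> s v = - 1" for v using s2[of v] by (simp add: power2_eq_1_iff)
    have "connected (range s)" using s_cont by (rule connected_continuous_image) simp
    moreover have "- 1 \<in> range s" "1 \<in> range s" using ne pm[of v] pm[of 0] by (metis rangeI)+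
    ultimately have "0 \<in> range s" using connected_contains_Icc[of "range s" "- 1" 1] by auto
    then show False using pm by (metis rangeE zero_neq_one neg_equal_0_iff_equal)
  qed
  define x :: quat where "x = (0, \<i> * W (w 0))"
  define \<alpha> where "\<alpha> = vecH (rot (\<Phi> 0) x)"
  have x0: "Re (fst x) = 0" by (simp add: x_def)
  have rc: "rot (\<Phi> v) x = rot (\<Phi> 0) x" for v
  proof -
    have "((\<lambda>v. rot (\<Phi> v) x) has_vector_derivative 0) (at v)" for v
    proof -
      have "x \<odot> (0, \<i> * W (w v)) - (0, \<i> * W (w v)) \<odot> x = 0" using const[of v] by (simp add: x_def)
      then show ?thesis using rot_deriv[OF has_vector_derivative_const[of x], of v]
        by (simp add: linear_0[OF bounded_linear.linear[OF bounded_linear_rot]])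
    qed
    then show ?thesis
      by (intro has_derivative_zero_unique[of UNIV "\<lambda>v. rot (\<Phi> v) x"]) (auto simp: has_vector_derivative_def)
  qed
  have "rotation (monodromy V) \<alpha> = \<alpha>"
    unfolding \<alpha>_def using rotation_vecH_rot[OF unit x0, of "monodromy V" 0] frame_period_shift[OF V_period, of 0] rc[of V]
    by simp
  then have "cross3 A \<alpha> = 0"
    unfolding monodromy_V using axis_angle_fixes_iff[OF A sigma sin_half_theta] by blast
  moreover have "cross3 A (cross3 A \<alpha>) = (A \<bullet> \<alpha>) *\<^sub>R A - (A \<bullet> A) *\<^sub>R \<alpha>"
    by (rule Lagrange)
  ultimately have \<alpha>A: "\<alpha> = (A \<bullet> \<alpha>) *\<^sub>R A" using A by (simp add: norm_eq_1)
  define d where "d v = dG (pos \<omega> v)" for v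
  define r where "r v = cmod (d v)" for v
  have r: "r v > 0" for v using dG_pos by (simp add: r_def d_def)
  have W: "r v = 2 * Re (G (pos \<omega> v) * cnj (W (w 0)))" for v
    using speed_via_frame[OF pos_strip[of \<omega> v]] const[of v] by (simp add: pos_def r_def d_def)
  have G: "G (pos \<omega> v) = of_real (\<rho> / r v) * d v" for v
  proof -
    have "G (pos \<omega> v) = - scale * (d v / of_real (r v))"
      using G_on_critical_line[OF w_range] by (simp add: pos_def r_def d_def)
    then show ?thesis by (subst (asm) scale_of_real) (simp add: \<rho>_def)
  qed
  have dW: "Re (d v * cnj (W (w 0))) = (r v)\<^sup>2 / (2 * \<rho>)" for v
    using W[of v] r[of v] rho_nonzero unfolding G by (simp add: field_simps power2_eq_square)
  have n: "\<alpha> \<bullet> (exp (- cyl_h \<omega> v) *\<^sub>R gauss_map cyl_h cyl (\<omega>, v)) = - s 0 / (2 * \<rho>)" for v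
  proof -
    define pu where "pu = partial_u cyl (\<omega>, v)"
    define pv where "pv = partial_v cyl (\<omega>, v)"
    have "imH (cross3 pu pv) = imH pu \<odot> imH pv"
      using imH_qmult[of pu pv] partials_inner(2)[of \<omega> v] by (simp add: pu_def pv_def qreal_pair zero_prod_def[symmetric])
    also have "\<dots> = rot (\<Phi> v) (E_u \<omega> v \<odot> E_v \<omega> v)"
      by (simp add: pu_def pv_def partial_u_cyl partial_v_cyl imH_rot_vecH unit imaginary_frame rot_qmult)
    finally have "\<alpha> \<bullet> cross3 pu pv = x \<bullet> (E_u \<omega> v \<odot> E_v \<omega> v)"
      using inner_imH[of \<alpha> "cross3 pu pv"] rc[of v]
      by (simp add: \<alpha>_def imH_rot_vecH[OF unit x0]) (metis inner_rot unit)
    also have "\<dots> = - s 0 * r v * Re (d v * cnj (W (w 0)))"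
      using sc[of v] by (simp add: x_def E_u_def E_v_def dw d_def r_def qmult_def inner_prod_def inner_complex_def algebra_simps)
    also have "\<dots> = - s 0 / (2 * \<rho>) * (r v) ^ 3" unfolding dW by (simp add: power2_eq_square power3_eq_cube)
    finally have "\<alpha> \<bullet> cross3 pu pv = - s 0 / (2 * \<rho>) * (r v) ^ 3" .
    moreover have "exp (- cyl_h \<omega> v) *\<^sub>R gauss_map cyl_h cyl (\<omega>, v) = (1 / r v ^ 3) *\<^sub>R cross3 pu pv"
      by (simp add: gauss_map_def exp_cyl_h r_def d_def pu_def pv_def power2_eq_square power3_eq_cube)
    ultimately show ?thesis using r[of v] by simp
  qed
  have "((\<lambda>v. exp (- cyl_h \<omega> v) *\<^sub>R gauss_map cyl_h cyl (\<omega>, v)) has_integral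
     integral {0..V} (\<lambda>v. exp (- cyl_h \<omega> v) *\<^sub>R gauss_map cyl_h cyl (\<omega>, v))) {0..V}"
    using weighted_normal_integral[OF dual c V] by (auto intro: integrable_integral has_integral_integrable)
  from has_integral_linear[OF this bounded_linear_inner_right[of \<alpha>]]
  have "((\<lambda>v. - s 0 / (2 * \<rho>)) has_integral \<alpha> \<bullet> integral {0..V} (\<lambda>v. exp (- cyl_h \<omega> v) *\<^sub>R gauss_map cyl_h cyl (\<omega>, v))) {0..V}"
    by (simp only: o_def n)
  moreover have "((\<lambda>v. - s 0 / (2 * \<rho>)) has_integral V * (- s 0 / (2 * \<rho>))) {0..V}"
    using has_integral_const_real[of "- s 0 / (2 * \<rho>)" 0 V] V by simp
  ultimately have "\<alpha> \<bullet> integral {0..V} (\<lambda>v. exp (- cyl_h \<omega> v) *\<^sub>R gauss_map cyl_h cyl (\<omega>, v)) = V * (- s 0 / (2 * \<rho>))"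
    by (rule has_integral_unique)
  then have "(A \<bullet> \<alpha>) * axial = V * (- s 0 / (2 * \<rho>))"
    by (subst (asm) \<alpha>A) (simp add: axial_def)
  moreover have "s 0 \<noteq> 0" using s2[of 0] by auto
  ultimately show ?thesis using V rho_nonzero by auto
qed

end

theorem torus_iff:
  assumes dual: "christoffel_dual cyl_h cyl f'" and c: "c \<noteq> 0"
    and p: "bonnet_cylinder cyl f' c f_plus" and m: "bonnet_cylinder cyl f' (- c) f_minus"
  shows "is_torus f_plus \<and> is_torus f_minus \<longleftrightarrow>
    (\<exists>k m :: nat. k \<ge> 1 \<and> m \<ge> 1 \<and> real k * \<theta> = 2 * pi * real m) \<and> axial = 0"
proof
  assume "is_torus f_plus \<and> is_torus f_minus"
  then obtain P where P: "P > 0" "\<And>u v. f_plus (u, v + P) = f_plus (u, v)"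
    unfolding is_torus_def by blast
  have ax: "axial = 0" by (rule periodic_imp_axial_zero[OF dual p c P])
  then obtain v where "w v \<noteq> w 0" using constant_w_imp_axial_nonzero[OF dual p c] by blast
  then show "(\<exists>k m :: nat. k \<ge> 1 \<and> m \<ge> 1 \<and> real k * \<theta> = 2 * pi * real m) \<and> axial = 0"
    using periodic_imp_rational[OF dual p c P] ax by blast
next
  assume "(\<exists>k m :: nat. k \<ge> 1 \<and> m \<ge> 1 \<and> real k * \<theta> = 2 * pi * real m) \<and> axial = 0"
  then obtain k j :: nat where k: "k \<ge> 1" "real k * \<theta> = 2 * pi * real j" and ax: "axial = 0" by blast
  have "real k * V > 0" using k V by simp
  then show "is_torus f_plus \<and> is_torus f_minus"
    unfolding is_torus_def
    using bonnet_u_periodic[OF dual p] bonnet_u_periodic[OF dual m] c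
      rational_and_axial_zero_imp_periodic[OF dual p c k ax]
      rational_and_axial_zero_imp_periodic[OF dual m _ k ax] by (meson neg_equal_0_iff_equal)
qed

end

section \<open>The closing conditions\<close>

lemma real_analytic_has_derivative:
  assumes "real_analytic g"
  shows "(g has_real_derivative deriv g x) (at x)"
proof -
  obtain r a where r: "r > 0" "\<And>y. \<bar>y - x\<bar> < r \<Longrightarrow> (\<lambda>n. a n * (y - x) ^ n) sums g y"
    using assms unfolding real_analytic_def by blast
  define S where "S z = (\<Sum>n. a n * z ^ n)" for z
  have "summable (\<lambda>n. a n * (r / 2) ^ n)"
    using r(2)[of "x + r / 2"] r(1) by (auto intro: sums_summable)
  then have "(S has_real_derivative (\<Sum>n. diffs a n * 0 ^ n)) (at 0)"
    unfolding S_def[abs_def] using r(1) by (intro termdiffs_strong) auto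
  then have "(S has_real_derivative (\<Sum>n. diffs a n * 0 ^ n)) (at (x - x))" by simp
  then have "((\<lambda>y. S (y - x)) has_real_derivative (\<Sum>n. diffs a n * 0 ^ n) * 1) (at x)"
    by (rule DERIV_chain2) (auto intro!: derivative_eq_intros)
  moreover have "\<forall>\<^sub>F y in nhds x. S (y - x) = g y"
  proof -
    have "\<forall>\<^sub>F y in nhds x. dist y x < r" using r(1) by (rule eventually_nhds_metric[THEN iffD2, OF exI, OF conjI]) simp
    then show ?thesis
      by eventually_elim (use r(2) in \<open>simp add: S_def dist_real_def sums_unique[symmetric]\<close>)
  qed
  ultimately have "(g has_real_derivative (\<Sum>n. diffs a n * 0 ^ n) * 1) (at x)"
    using DERIV_cong_ev[of x x "\<lambda>y. S (y - x)" g] by blast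
  then show ?thesis using DERIV_imp_deriv by metis
qed

theorem theorem6:
  fixes \<tau> \<tau>\<^sub>0 :: complex and \<omega> V \<theta> \<epsilon> :: real
    and w s :: "real \<Rightarrow> real" and h :: "real \<Rightarrow> real \<Rightarrow> real"
    and \<Phi> :: "real \<Rightarrow> quat" and A :: "real^3"
    and f f_dual f_plus f_minus n :: "real \<times> real \<Rightarrow> real^3"
  assumes "Re \<tau>\<^sub>0 = 1 / 2" and "Im \<tau>\<^sub>0 > 0" and "deriv (deriv (theta2 \<tau>\<^sub>0)) 0 = 0"
    and "Re \<tau> = 1 / 2" and "0 < Im \<tau>" and "Im \<tau> < Im \<tau>\<^sub>0"
    and "0 < \<omega>" and "\<omega> < pi / 4" and "deriv (theta2 \<tau>) (complex_of_real \<omega>) = 0"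
    and "admissible \<tau> w s"
    and "rotation_frame \<tau> \<omega> w s \<Phi>"
    and "f = isothermic_cylinder \<tau> \<omega> w \<Phi>"
    and "h = (\<lambda>u v. metric_h \<tau> \<omega> u (w v))"
    and "n = gauss_map h f"
    and "yields_fundamental_piece w s f V"
    and "monodromy_axis_angle \<Phi> V A \<theta>"
    and "christoffel_dual h f f_dual"
    and "\<epsilon> \<noteq> 0"
    and "bonnet_cylinder f f_dual \<epsilon> f_plus"
    and "bonnet_cylinder f f_dual (- \<epsilon>) f_minus"
  shows "is_torus f_plus \<and> is_torus f_minus \<longleftrightarrow>
         (\<exists>k m :: nat. k \<ge> 1 \<and> m \<ge> 1 \<and> real k * \<theta> = 2 * pi * real m) \<and>
         A \<bullet> integral {0..V} (\<lambda>v. exp (- h \<omega> v) *\<^sub>R n (\<omega>, v)) = 0"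
proof -
  note tau = \<open>0 < Im \<tau>\<close> \<open>Re \<tau> = 1 / 2\<close>
  have V: "V > 0" "\<And>v. w (v + V) = w v" "\<And>v. s (v + V) = s v" "\<not> (\<forall>u v. f (u, v + V) = f (u, v))"
    using \<open>yields_fundamental_piece w s f V\<close> by (auto simp: yields_fundamental_piece_def)
  \<comment> \<open>Division by zero yields zero, so otherwise the planar curves would vanish and the cylinder would close after one period.\<close>
  have d0: "deriv (theta1 \<tau>) 0 \<noteq> 0"
  proof
    assume "deriv (theta1 \<tau>) 0 = 0"
    then have "planar_gamma \<tau> \<omega> u x = 0" for u x by (simp add: planar_gamma_def)
    then have "f (u, v) = vecH (qinv (\<Phi> v) \<odot> qcomplex 0 \<odot> qj \<odot> \<Phi> v)" for u v
      by (simp add: \<open>f = _\<close> isothermic_cylinder_def)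
    then have "f (u, v) = 0" for u v
      by (simp add: qcomplex_def qmult_def vecH_def vec_eq_iff forall_3)
    then show False using V(4) by simp
  qed
  define K where "K = exp (- (\<i> * of_real (pi / 8)))"
  have K0: "K \<noteq> 0" by (simp add: K_def)
  define T where "T x = K * theta1 \<tau> x" for x
  interpret real_theta \<tau> T
    unfolding T_def[abs_def] K_def by (rule real_theta_theta1[OF tau d0])
  have T2: "T2 x = K * theta2 \<tau> x" for x
    by (simp add: T2_def T_def theta2_eq_theta1)
  have "theta2 \<tau> = (\<lambda>x. inverse K * T2 x)" using K0 by (simp add: T2 fun_eq_iff)
  then have "theta2 \<tau> field_differentiable (at x)" for x
    using T2_has_deriv[of x] by (auto simp: field_differentiable_def intro: DERIV_cmult)
  then have "deriv T2 x = K * deriv (theta2 \<tau>) x" for x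
    unfolding T2[abs_def] by (rule deriv_cmult)
  then interpret planar_curves \<tau> T \<omega>
    by unfold_locales (use assms in auto)
  have "theta1 \<tau> = (\<lambda>x. inverse K * T x)" using K0 by (simp add: T_def fun_eq_iff)
  then have "theta1 \<tau> field_differentiable (at 0)"
    using T_has_deriv[of 0] by (auto simp: field_differentiable_def intro: DERIV_cmult)
  then have dT: "deriv T 0 = K * deriv (theta1 \<tau>) 0"
    unfolding T_def[abs_def] by (rule deriv_cmult)
  have gamma: "planar_gamma \<tau> \<omega> u x = G (of_real u + \<i> * of_real x)" for u x
    using K0 by (simp add: planar_gamma_def G_def scale_def T2 T_def dT power_mult_distrib power2_eq_square)
  have W1: "frame_W1 \<tau> \<omega> x = W x" for x
    using K0 by (simp add: frame_W1_def W_def T2 T_def dT)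
  have adm: "real_analytic w" "real_analytic s" "\<And>v. 0 < w v" "\<And>v. w v < 2 * pi * Im \<tau>"
    "\<And>v. (s v)\<^sup>2 = 1 - (deriv w v)\<^sup>2"
    using \<open>admissible \<tau> w s\<close> by (auto simp: admissible_def)
  have unit: "norm (\<Phi> v) = 1" for v
    using \<open>rotation_frame \<tau> \<omega> w s \<Phi>\<close> by (simp add: rotation_frame_def)
  interpret framed_cylinder \<tau> T \<omega> w s \<Phi>
  proof unfold_locales
    show "(\<Phi> has_vector_derivative (s v *\<^sub>R (0, \<i> * W (w v))) \<odot> \<Phi> v) (at v)" for v
    proof -
      have d: "(\<Phi> has_vector_derivative vector_derivative \<Phi> (at v)) (at v)"
        and e: "vector_derivative \<Phi> (at v) \<odot> qinv (\<Phi> v) = s v *\<^sub>R (qcomplex (frame_W1 \<tau> \<omega> (w v)) \<odot> qk)"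
        using \<open>rotation_frame \<tau> \<omega> w s \<Phi>\<close> vector_derivative_works by (auto simp: rotation_frame_def)
      have "vector_derivative \<Phi> (at v) = (vector_derivative \<Phi> (at v) \<odot> qinv (\<Phi> v)) \<odot> \<Phi> v"
        using unit_qconj[OF unit] by (simp add: qmult_assoc qreal_mult)
      also have "\<dots> = (s v *\<^sub>R (0, \<i> * W (w v))) \<odot> \<Phi> v"
        unfolding e W1 by (simp add: qcomplex_def qk_def qmult_def mult.commute)
      finally show ?thesis using d by simp
    qed
    show "continuous_on UNIV s"
      using DERIV_isCont[OF real_analytic_has_derivative[OF adm(2)]] by (auto intro: continuous_at_imp_continuous_on)
  qed (use adm unit real_analytic_has_derivative in auto)
  have f: "f = cyl"
  proof (rule ext, clarify)
    fix u v
    have "q \<odot> qcomplex z \<odot> qj \<odot> r = q \<odot> (0, z) \<odot> r" for q r z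
      by (simp add: qmult_def qcomplex_def qj_def)
    then show "f (u, v) = cyl (u, v)"
      by (simp add: \<open>f = _\<close> isothermic_cylinder_def cyl_def rot_def gamma pos_def unit_qconj(3)[OF unit])
  qed
  have h: "h = cyl_h"
    using vector_derivative_at[OF G_pos_deriv_u]
    by (simp add: \<open>h = _\<close> fun_eq_iff metric_h_def cyl_h_def gamma pos_def)
  have period: "frame_period V" using V by (simp add: frame_period_def)
  have A: "norm A = 1" and th: "0 \<le> \<theta>" "\<theta> \<le> pi"
    and mono: "monodromy V = axis_angle A (\<theta> / 2) \<or> - monodromy V = axis_angle A (\<theta> / 2)"
    using \<open>monodromy_axis_angle \<Phi> V A \<theta>\<close>
    by (auto simp: monodromy_axis_angle_def monodromy_def axis_angle_def unit_qconj(3)[OF unit])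
  obtain \<sigma> :: real where \<sigma>: "\<bar>\<sigma>\<bar> = 1" "monodromy V = \<sigma> *\<^sub>R axis_angle A (\<theta> / 2)"
  proof (cases "monodromy V = axis_angle A (\<theta> / 2)")
    case True
    then show thesis by (intro that[of 1]) auto
  next
    case False
    then have "- monodromy V = axis_angle A (\<theta> / 2)" using mono by blast
    then have "monodromy V = (- 1) *\<^sub>R axis_angle A (\<theta> / 2)" by (metis minus_minus scaleR_minus1_left)
    then show thesis by (intro that[of "- 1"]) auto
  qed
  \<comment> \<open>A trivial monodromy would close the cylinder after one period.\<close>
  have "\<theta> \<noteq> 0"
  proof
    assume "\<theta> = 0"
    then have M: "monodromy V = qreal \<sigma>"
      using \<sigma>(2) by (simp add: axis_angle_def qreal_pair scaleR_conv_of_real)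
    have "\<sigma> * \<sigma> = 1" using \<sigma>(1) by (metis abs_mult_self_eq mult_1)
    moreover have "qconj (qreal \<sigma>) = qreal \<sigma>" by (simp add: qconj_def qreal_pair)
    ultimately have "rotation (monodromy V) x = x" for x
      by (simp add: M rotation_def rot_def qreal_mult vecH_imH)
    then show False using cyl_shift[OF period] V(4) by (simp add: f)
  qed
  then interpret fundamental_piece \<tau> T \<omega> w s \<Phi> V \<theta> \<sigma> A
    by unfold_locales (use V period A th \<sigma> in auto)
  show ?thesis
    using torus_iff[of f_dual \<epsilon> f_plus f_minus] assms
    by (simp add: f h axial_def)
qed

end
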